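(* Let $k$ be an algebraically closed field of characteristic zero, let $G$ be a finite group, let $\omega\colon G\times G\times G\to k^{\times}$ be a (normalized) $3$-cocycle, and let $\mathcal{C}=\mathcal{C}(G,\omega)$. Let $H, L$ be subgroups of $G$ and let $\psi\in C^2(H,k^{\times})$ and $\xi\in C^2(L,k^{\times})$ be (normalized) $2$-cochains satisfying $d\psi=\omega|_{H\times H\times H}$ and $d\xi=\omega|_{L\times L\times L}$. Then $\mathcal{M}_0(H,\psi)$ and $\mathcal{M}_0(L,\xi)$ are equivalent as $\mathcal{C}$-module categories if and only if there exists an element $g\in G$ such that $H={}^gL$ and the class of the $2$-cocycle $$\xi^{-1}\,\psi^g\,\Omega_g|_{L\times L}$$ is trivial in $H^2(L,k^{\times})$.
   Context: All cochains take values in $k^\times$ with trivial group action, are written multiplicatively, and are normalized (value $1$ whenever an argument is the identity). For a $2$-cochain $f$, $df(a,b,c)=\frac{f(b,c)f(a,bc)}{f(ab,c)f(a,b)}$. Notation: ${}^gx=gxg^{-1}$ and ${}^gL=\{{}^gx: x\in L\}$. If $H={}^gL$, then $\psi^g\in C^2(L,k^\times)$ is $\psi^g(g_1,g_2)=\psi({}^gg_1,{}^gg_2)$. For $g\in G$, $\Omega_g\colon G\times G\to k^\times$ is $$\Omega_g(g_1,g_2)=\frac{\omega({}^gg_1,{}^gg_2,g)\,\omega(g,g_1,g_2)}{\omega({}^gg_1,g,g_2)}.$$ $\mathcal{C}(G,\omega)$ is the fusion category of finite-dimensional $G$-graded $k$-vector spaces with the usual graded tensor product and associativity constraint $a_{U,V,W}((u\otimes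 v)\otimes w)=\omega^{-1}(g_1,g_2,g_3)\,u\otimes(v\otimes w)$ for homogeneous $u\in U_{g_1}$, $v\in V_{g_2}$, $w\in W_{g_3}$. For a subgroup $H$ and a $2$-cochain $\psi$ on $H$ with $d\psi=\omega|_{H\times H\times H}$, $A(H,\psi)=k_\psi H$ is the algebra in $\mathcal{C}$ with basis $\{e_h\}_{h\in H}$, $e_h$ of degree $h$, and multiplication $e_he_{h'}=\psi(h,h')e_{hh'}$. A right $\mathcal{C}$-module category is a finite semisimple $k$-linear abelian category $\mathcal{M}$ with a bifunctor $\bar\otimes\colon\mathcal{M}\times\mathcal{C}\to\mathcal{M}$ and natural isomorphisms $\mu_{M,X,Y}\colon M\bar\otimes(X\otimes Y)\to(M\bar\otimes X)\bar\otimes Y$, $r_M\colon M\bar\otimes\mathbf 1\to M$ satisfying the usual pentagon and triangle axioms. A $\mathcal{C}$-module functor is a functor $F$ with natural isomorphisms $\zeta_{M,X}\colon F(M\bar\otimes X)\to F(M)\bar\otimes' X$ compatible with associativity and unit constraints; an equivalence of $\mathcal{C}$-module categories is a $\mathcal{C}$-module functor that is an equivalence of categories. $\mathcal{M}_0(H,\psi)$ is the category of left $A(H,\psi)$-modules in $\mathcal{C}$, regarded as a right $\mathcal{C}$-module category: for a left $A$-module $M$ with structure map $m_M$, $M\bar\otimes X=M\otimes X$ with action $(m_M\otimes\mathrm{id}_X)\,a_{A,M,X}^{-1}$, and associativity constraint $\mu_{M,X,Y}=a^{-1}_{M,X,Y}$. *)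

theory Defs
  imports
    "HOL-Computational_Algebra.Polynomial"
    "HOL-Library.FuncSet"
    "HOL-Library.Function_Algebras"
    "HOL-Algebra.Coset"
begin

section \<open>Cochains\<close>

text \<open>
  An \<open>n\<close>-cochain on a group \<open>\<Gamma>\<close> is a function into the nonzero scalars, defined on the carrier
  only; following the usual device for representing partial functions, it takes the fixed
  value \<open>1\<close> as soon as one argument lies outside the carrier.  All cochains are normalized.
\<close>

definition C1 :: "('g, 'z) monoid_scheme \<Rightarrow> ('g \<Rightarrow> 'k::field) set" where
  "C1 \<Gamma> = {f. (\<forall>a\<in>carrier \<Gamma>. f a \<noteq> 0) \<and> (\<forall>a. a \<notin> carrier \<Gamma> \<longrightarrow> f a = 1) \<and> f \<one>\<^bsub>\<Gamma>\<^esub> = 1}"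

definition C2 :: "('g, 'z) monoid_scheme \<Rightarrow> ('g \<Rightarrow> 'g \<Rightarrow> 'k::field) set" where
  "C2 \<Gamma> = {f.
     (\<forall>a\<in>carrier \<Gamma>. \<forall>b\<in>carrier \<Gamma>. f a b \<noteq> 0) \<and>
     (\<forall>a b. a \<notin> carrier \<Gamma> \<or> b \<notin> carrier \<Gamma> \<longrightarrow> f a b = 1) \<and>
     (\<forall>a\<in>carrier \<Gamma>. f \<one>\<^bsub>\<Gamma>\<^esub> a = 1 \<and> f a \<one>\<^bsub>\<Gamma>\<^esub> = 1)}"

definition C3 :: "('g, 'z) monoid_scheme \<Rightarrow> ('g \<Rightarrow> 'g \<Rightarrow> 'g \<Rightarrow> 'k::field) set" where
  "C3 \<Gamma> = {f.
     (\<forall>a\<in>carrier \<Gamma>. \<forall>b\<in>carrier \<Gamma>. \<forall>c\<in>carrier \<Gamma>. f a b c \<noteq> 0) \<and>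
     (\<forall>a b c. a \<notin> carrier \<Gamma> \<or> b \<notin> carrier \<Gamma> \<or> c \<notin> carrier \<Gamma> \<longrightarrow> f a b c = 1) \<and>
     (\<forall>a\<in>carrier \<Gamma>. \<forall>b\<in>carrier \<Gamma>. f \<one>\<^bsub>\<Gamma>\<^esub> a b = 1 \<and> f a \<one>\<^bsub>\<Gamma>\<^esub> b = 1 \<and> f a b \<one>\<^bsub>\<Gamma>\<^esub> = 1)}"

definition d1 :: "('g, 'z) monoid_scheme \<Rightarrow> ('g \<Rightarrow> 'k::field) \<Rightarrow> 'g \<Rightarrow> 'g \<Rightarrow> 'k" where
  "d1 \<Gamma> f a b = f b * f a / f (a \<otimes>\<^bsub>\<Gamma>\<^esub> b)"

definition d2 :: "('g, 'z) monoid_scheme \<Rightarrow> ('g \<Rightarrow> 'g \<Rightarrow> 'k::field) \<Rightarrow> 'g \<Rightarrow> 'g \<Rightarrow> 'g \<Rightarrow> 'k" where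
  "d2 \<Gamma> f a b c = f b c * f a (b \<otimes>\<^bsub>\<Gamma>\<^esub> c) / (f (a \<otimes>\<^bsub>\<Gamma>\<^esub> b) c * f a b)"

definition d3 ::
  "('g, 'z) monoid_scheme \<Rightarrow> ('g \<Rightarrow> 'g \<Rightarrow> 'g \<Rightarrow> 'k::field) \<Rightarrow> 'g \<Rightarrow> 'g \<Rightarrow> 'g \<Rightarrow> 'g \<Rightarrow> 'k" where
  "d3 \<Gamma> f a b c d =
     f b c d * f a (b \<otimes>\<^bsub>\<Gamma>\<^esub> c) d * f a b c / (f (a \<otimes>\<^bsub>\<Gamma>\<^esub> b) c d * f a b (c \<otimes>\<^bsub>\<Gamma>\<^esub> d))"

definition Z3 :: "('g, 'z) monoid_scheme \<Rightarrow> ('g \<Rightarrow> 'g \<Rightarrow> 'g \<Rightarrow> 'k::field) set" where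
  "Z3 \<Gamma> = {f \<in> C3 \<Gamma>. \<forall>a\<in>carrier \<Gamma>. \<forall>b\<in>carrier \<Gamma>. \<forall>c\<in>carrier \<Gamma>. \<forall>d\<in>carrier \<Gamma>. d3 \<Gamma> f a b c d = 1}"

text \<open>Restriction of a two-argument function to \<open>S \<times> S\<close>.\<close>

definition restrict2 :: "'g set \<Rightarrow> ('g \<Rightarrow> 'g \<Rightarrow> 'k::field) \<Rightarrow> 'g \<Rightarrow> 'g \<Rightarrow> 'k" where
  "restrict2 S f a b = (if a \<in> S \<and> b \<in> S then f a b else 1)"

definition Z2 :: "('g, 'z) monoid_scheme \<Rightarrow> ('g \<Rightarrow> 'g \<Rightarrow> 'k::field) monoid" where
  "Z2 \<Gamma> = \<lparr>carrier = {f \<in> C2 \<Gamma>. \<forall>a\<in>carrier \<Gamma>. \<forall>b\<in>carrier \<Gamma>. \<forall>c\<in>carrier \<Gamma>. d2 \<Gamma> f a b c = 1},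
     monoid.mult = (\<lambda>f f' a b. f a b * f' a b), monoid.one = (\<lambda>a b. 1)\<rparr>"

definition B2 :: "('g, 'z) monoid_scheme \<Rightarrow> ('g \<Rightarrow> 'g \<Rightarrow> 'k::field) set" where
  "B2 \<Gamma> = (\<lambda>f. restrict2 (carrier \<Gamma>) (d1 \<Gamma> f)) ` C1 \<Gamma>"

definition H2 :: "('g, 'z) monoid_scheme \<Rightarrow> ('g \<Rightarrow> 'g \<Rightarrow> 'k::field) set monoid" where
  "H2 \<Gamma> = Z2 \<Gamma> Mod B2 \<Gamma>"

definition class2 ::
  "('g, 'z) monoid_scheme \<Rightarrow> ('g \<Rightarrow> 'g \<Rightarrow> 'k::field) \<Rightarrow> ('g \<Rightarrow> 'g \<Rightarrow> 'k) set" where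
  "class2 \<Gamma> f = B2 \<Gamma> #>\<^bsub>Z2 \<Gamma>\<^esub> f"

definition conj_by :: "('g, 'z) monoid_scheme \<Rightarrow> 'g \<Rightarrow> 'g \<Rightarrow> 'g" where
  "conj_by G g x = g \<otimes>\<^bsub>G\<^esub> x \<otimes>\<^bsub>G\<^esub> inv\<^bsub>G\<^esub> g"

definition conj_cochain ::
  "('g, 'z) monoid_scheme \<Rightarrow> ('g \<Rightarrow> 'g \<Rightarrow> 'k::field) \<Rightarrow> 'g \<Rightarrow> 'g \<Rightarrow> 'g \<Rightarrow> 'k" where
  "conj_cochain G \<psi> g a b = \<psi> (conj_by G g a) (conj_by G g b)"

definition Omega ::
  "('g, 'z) monoid_scheme \<Rightarrow> ('g \<Rightarrow> 'g \<Rightarrow> 'g \<Rightarrow> 'k::field) \<Rightarrow> 'g \<Rightarrow> 'g \<Rightarrow> 'g \<Rightarrow> 'k" where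
  "Omega G \<omega> g a b =
     \<omega> (conj_by G g a) (conj_by G g b) g * \<omega> g a b / \<omega> (conj_by G g a) g b"

section \<open>Categories, functors and natural isomorphisms\<close>

record ('o, 'm) category =
  Obj :: "'o set"
  Arr :: "'m set"
  Dom :: "'m \<Rightarrow> 'o"
  Cod :: "'m \<Rightarrow> 'o"
  Ident :: "'o \<Rightarrow> 'm"
  Comp :: "'m \<Rightarrow> 'm \<Rightarrow> 'm"  (infixr "\<cdot>\<index>" 55)

definition Hom :: "('o, 'm, 'z) category_scheme \<Rightarrow> 'o \<Rightarrow> 'o \<Rightarrow> 'm set" where
  "Hom C X Y = {f \<in> Arr C. Dom C f = X \<and> Cod C f = Y}"

definition inverse_arrows :: "('o, 'm, 'z) category_scheme \<Rightarrow> 'm \<Rightarrow> 'm \<Rightarrow> bool" where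
  "inverse_arrows C f h \<longleftrightarrow>
     f \<in> Arr C \<and> h \<in> Hom C (Cod C f) (Dom C f) \<and>
     h \<cdot>\<^bsub>C\<^esub> f = Ident C (Dom C f) \<and> f \<cdot>\<^bsub>C\<^esub> h = Ident C (Cod C f)"

definition iso_arrow :: "('o, 'm, 'z) category_scheme \<Rightarrow> 'm \<Rightarrow> bool" where
  "iso_arrow C f \<longleftrightarrow> (\<exists>h. inverse_arrows C f h)"

definition inv_arrow :: "('o, 'm, 'z) category_scheme \<Rightarrow> 'm \<Rightarrow> 'm" where
  "inv_arrow C f = (THE h. inverse_arrows C f h)"

definition is_functor ::
  "('o, 'm, 'y) category_scheme \<Rightarrow> ('p, 'n, 'z) category_scheme \<Rightarrow> ('o \<Rightarrow> 'p) \<Rightarrow> ('m \<Rightarrow> 'n) \<Rightarrow> bool"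
where
  "is_functor C D Fo Fa \<longleftrightarrow>
     (\<forall>X\<in>Obj C. Fo X \<in> Obj D) \<and>
     (\<forall>f\<in>Arr C. Fa f \<in> Hom D (Fo (Dom C f)) (Fo (Cod C f))) \<and>
     (\<forall>X\<in>Obj C. Fa (Ident C X) = Ident D (Fo X)) \<and>
     (\<forall>f\<in>Arr C. \<forall>h\<in>Arr C. Dom C h = Cod C f \<longrightarrow> Fa (h \<cdot>\<^bsub>C\<^esub> f) = Fa h \<cdot>\<^bsub>D\<^esub> Fa f)"

definition natural_iso ::
  "('o, 'm, 'y) category_scheme \<Rightarrow> ('p, 'n, 'z) category_scheme \<Rightarrow>
   ('o \<Rightarrow> 'p) \<Rightarrow> ('m \<Rightarrow> 'n) \<Rightarrow> ('o \<Rightarrow> 'p) \<Rightarrow> ('m \<Rightarrow> 'n) \<Rightarrow> ('o \<Rightarrow> 'n) \<Rightarrow> bool"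
where
  "natural_iso C D Fo Fa Fo' Fa' \<eta> \<longleftrightarrow>
     (\<forall>X\<in>Obj C. \<eta> X \<in> Hom D (Fo X) (Fo' X) \<and> iso_arrow D (\<eta> X)) \<and>
     (\<forall>f\<in>Arr C. \<eta> (Cod C f) \<cdot>\<^bsub>D\<^esub> Fa f = Fa' f \<cdot>\<^bsub>D\<^esub> \<eta> (Dom C f))"

definition is_equivalence ::
  "('o, 'm, 'y) category_scheme \<Rightarrow> ('p, 'n, 'z) category_scheme \<Rightarrow> ('o \<Rightarrow> 'p) \<Rightarrow> ('m \<Rightarrow> 'n) \<Rightarrow> bool"
where
  "is_equivalence C D Fo Fa \<longleftrightarrow>
     is_functor C D Fo Fa \<and>
     (\<exists>Ko Ka \<eta> \<epsilon>.
        is_functor D C Ko Ka \<and>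
        natural_iso C C (\<lambda>X. X) (\<lambda>f. f) (\<lambda>X. Ko (Fo X)) (\<lambda>f. Ka (Fa f)) \<eta> \<and>
        natural_iso D D (\<lambda>Y. Fo (Ko Y)) (\<lambda>f. Fa (Ka f)) (\<lambda>Y. Y) (\<lambda>f. f) \<epsilon>)"

section \<open>Monoidal categories and right module categories\<close>

text \<open>
  \<open>assoc C X Y Z\<close> goes from \<open>(X \<otimes> Y) \<otimes> Z\<close> to \<open>X \<otimes> (Y \<otimes> Z)\<close>, \<open>lunit C X\<close> from \<open>1 \<otimes> X\<close> to \<open>X\<close>, and
  \<open>runit C X\<close> from \<open>X \<otimes> 1\<close> to \<open>X\<close>.
\<close>

record ('o, 'm) monoidal_category = "('o, 'm) category" +
  tens_obj :: "'o \<Rightarrow> 'o \<Rightarrow> 'o"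
  tens_arr :: "'m \<Rightarrow> 'm \<Rightarrow> 'm"
  unit_obj :: "'o"
  assoc :: "'o \<Rightarrow> 'o \<Rightarrow> 'o \<Rightarrow> 'm"
  lunit :: "'o \<Rightarrow> 'm"
  runit :: "'o \<Rightarrow> 'm"

text \<open>
  The first two type parameters belong to the module category, the last two to the monoidal
  category acting on it.  \<open>act_assoc N M X Y\<close> goes from \<open>M \<otimes> (X \<otimes> Y)\<close> to \<open>(M \<otimes> X) \<otimes> Y\<close>, and
  \<open>act_unit N M\<close> from \<open>M \<otimes> 1\<close> to \<open>M\<close>.
\<close>

record ('o, 'm, 'p, 'n) module_category = "('o, 'm) category" +
  act_obj :: "'o \<Rightarrow> 'p \<Rightarrow> 'o"
  act_arr :: "'m \<Rightarrow> 'n \<Rightarrow> 'm"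
  act_assoc :: "'o \<Rightarrow> 'p \<Rightarrow> 'p \<Rightarrow> 'm"
  act_unit :: "'o \<Rightarrow> 'm"

definition is_module_functor ::
  "('p, 'n, 'y) monoidal_category_scheme \<Rightarrow>
   ('o1, 'm1, 'p, 'n, 'z1) module_category_scheme \<Rightarrow>
   ('o2, 'm2, 'p, 'n, 'z2) module_category_scheme \<Rightarrow>
   ('o1 \<Rightarrow> 'o2) \<Rightarrow> ('m1 \<Rightarrow> 'm2) \<Rightarrow> ('o1 \<Rightarrow> 'p \<Rightarrow> 'm2) \<Rightarrow> bool"
where
  "is_module_functor C M N Fo Fa \<zeta> \<longleftrightarrow>
     is_functor M N Fo Fa \<and>
     (\<forall>U\<in>Obj M. \<forall>X\<in>Obj C.
        \<zeta> U X \<in> Hom N (Fo (act_obj M U X)) (act_obj N (Fo U) X) \<and> iso_arrow N (\<zeta> U X)) \<and>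
     (\<forall>f\<in>Arr M. \<forall>h\<in>Arr C.
        \<zeta> (Cod M f) (Cod C h) \<cdot>\<^bsub>N\<^esub> Fa (act_arr M f h) =
        act_arr N (Fa f) h \<cdot>\<^bsub>N\<^esub> \<zeta> (Dom M f) (Dom C h)) \<and>
     (\<forall>U\<in>Obj M. \<forall>X\<in>Obj C. \<forall>Y\<in>Obj C.
        act_arr N (\<zeta> U X) (Ident C Y) \<cdot>\<^bsub>N\<^esub> \<zeta> (act_obj M U X) Y \<cdot>\<^bsub>N\<^esub> Fa (act_assoc M U X Y) =
        act_assoc N (Fo U) X Y \<cdot>\<^bsub>N\<^esub> \<zeta> U (tens_obj C X Y)) \<and>
     (\<forall>U\<in>Obj M. act_unit N (Fo U) \<cdot>\<^bsub>N\<^esub> \<zeta> U (unit_obj C) = Fa (act_unit M U))"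

definition module_equivalent ::
  "('p, 'n, 'y) monoidal_category_scheme \<Rightarrow>
   ('o1, 'm1, 'p, 'n, 'z1) module_category_scheme \<Rightarrow>
   ('o2, 'm2, 'p, 'n, 'z2) module_category_scheme \<Rightarrow> bool"
where
  "module_equivalent C M N \<longleftrightarrow>
     (\<exists>Fo Fa \<zeta>. is_module_functor C M N Fo Fa \<zeta> \<and> is_equivalence M N Fo Fa)"

section \<open>Left modules over an algebra in a monoidal category\<close>

datatype ('o, 'f) arrow = Arrow (src: 'o) (trg: 'o) (fn: 'f)

record ('o, 'm) algebra_in =
  alg_obj :: "'o"
  alg_mult :: "'m"
  alg_unit :: "'m"

definition left_modules ::
  "('o, 'm, 'z) monoidal_category_scheme \<Rightarrow> ('o, 'm) algebra_in \<Rightarrow> ('o \<times> 'm) set"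
where
  "left_modules C A = {(M, a).
     M \<in> Obj C \<and> a \<in> Hom C (tens_obj C (alg_obj A) M) M \<and>
     a \<cdot>\<^bsub>C\<^esub> tens_arr C (alg_mult A) (Ident C M) =
       a \<cdot>\<^bsub>C\<^esub> tens_arr C (Ident C (alg_obj A)) a \<cdot>\<^bsub>C\<^esub> assoc C (alg_obj A) (alg_obj A) M \<and>
     a \<cdot>\<^bsub>C\<^esub> tens_arr C (alg_unit A) (Ident C M) = lunit C M}"

definition left_module_arrows ::
  "('o, 'm, 'z) monoidal_category_scheme \<Rightarrow> ('o, 'm) algebra_in \<Rightarrow> ('o \<times> 'm, 'm) arrow set"
where
  "left_module_arrows C A = {f.
     src f \<in> left_modules C A \<and> trg f \<in> left_modules C A \<and>
     fn f \<in> Hom C (fst (src f)) (fst (trg f)) \<and>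
     fn f \<cdot>\<^bsub>C\<^esub> snd (src f) = snd (trg f) \<cdot>\<^bsub>C\<^esub> tens_arr C (Ident C (alg_obj A)) (fn f)}"

definition left_module_act ::
  "('o, 'm, 'z) monoidal_category_scheme \<Rightarrow> ('o, 'm) algebra_in \<Rightarrow> 'o \<times> 'm \<Rightarrow> 'o \<Rightarrow> 'o \<times> 'm"
where
  "left_module_act C A U X =
     (tens_obj C (fst U) X,
      tens_arr C (snd U) (Ident C X) \<cdot>\<^bsub>C\<^esub> inv_arrow C (assoc C (alg_obj A) (fst U) X))"

definition left_module_category ::
  "('o, 'm, 'z) monoidal_category_scheme \<Rightarrow> ('o, 'm) algebra_in \<Rightarrow>
   ('o \<times> 'm, ('o \<times> 'm, 'm) arrow, 'o, 'm) module_category"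
where
  "left_module_category C A = \<lparr>
     Obj = left_modules C A,
     Arr = left_module_arrows C A,
     Dom = src,
     Cod = trg,
     Ident = (\<lambda>U. Arrow U U (Ident C (fst U))),
     Comp = (\<lambda>h f. Arrow (src f) (trg h) (fn h \<cdot>\<^bsub>C\<^esub> fn f)),
     act_obj = left_module_act C A,
     act_arr = (\<lambda>f h. Arrow (left_module_act C A (src f) (Dom C h))
       (left_module_act C A (trg f) (Cod C h)) (tens_arr C (fn f) h)),
     act_assoc = (\<lambda>U X Y. Arrow (left_module_act C A U (tens_obj C X Y))
       (left_module_act C A (left_module_act C A U X) Y) (inv_arrow C (assoc C (fst U) X Y))),
     act_unit = (\<lambda>U. Arrow (left_module_act C A U (unit_obj C)) U (runit C (fst U)))\<rparr>"

section \<open>Graded vector spaces\<close>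

text \<open>
  To have all finite-dimensional vector spaces inside one HOL type, a vector space is taken to be
  a subspace of the space of all functions \<open>'g label \<Rightarrow> 'k\<close>.  The type \<open>'g label\<close> is infinite,
  so every finite-dimensional space occurs up to isomorphism, and \<open>Pair_label\<close> makes the ambient
  space closed under tensor products: \<open>pure_tensor\<close> is the standard embedding of
  \<open>(I \<Rightarrow> k) \<otimes> (I \<Rightarrow> k)\<close> into \<open>I \<times> I \<Rightarrow> k\<close>, which is injective, so that the span of the pure
  tensors of two subspaces is their tensor product.
\<close>

datatype 'g label = Unit_label | Elem_label 'g | Pair_label "'g label" "'g label"

type_synonym ('g, 'k) vec = "'g label \<Rightarrow> 'k"

definition scale :: "'k::field \<Rightarrow> ('g, 'k) vec \<Rightarrow> ('g, 'k) vec" where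
  "scale c v = (\<lambda>i. c * v i)"

global_interpretation vec: vector_space scale
  by unfold_locales (auto simp: scale_def fun_eq_iff algebra_simps)

definition basis_vec :: "'g label \<Rightarrow> ('g, 'k::field) vec" where
  "basis_vec i = (\<lambda>j. if j = i then 1 else 0)"

definition pure_tensor :: "('g, 'k::field) vec \<Rightarrow> ('g, 'k) vec \<Rightarrow> ('g, 'k) vec" where
  "pure_tensor v w = (\<lambda>i. case i of Pair_label p q \<Rightarrow> v p * w q | _ \<Rightarrow> 0)"

text \<open>A graded space is given by its family of homogeneous components.\<close>

type_synonym ('g, 'k) graded = "'g \<Rightarrow> ('g, 'k) vec set"

type_synonym ('g, 'k) graded_arrow = "(('g, 'k) graded, ('g, 'k) vec \<Rightarrow> ('g, 'k) vec) arrow"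

definition total :: "('g, 'z) monoid_scheme \<Rightarrow> ('g, 'k::field) graded \<Rightarrow> ('g, 'k) vec set" where
  "total G V = vec.span (\<Union>g\<in>carrier G. V g)"

definition graded_spaces :: "('g, 'z) monoid_scheme \<Rightarrow> ('g, 'k::field) graded set" where
  "graded_spaces G = {V.
     (\<forall>g\<in>carrier G. vec.subspace (V g)) \<and>
     (\<forall>g. g \<notin> carrier G \<longrightarrow> V g = {0}) \<and>
     (\<forall>v. (\<forall>g\<in>carrier G. v g \<in> V g) \<and> (\<Sum>g\<in>carrier G. v g) = 0 \<longrightarrow> (\<forall>g\<in>carrier G. v g = 0)) \<and>
     (\<exists>B. finite B \<and> total G V = vec.span B)}"

definition graded_arrows :: "('g, 'z) monoid_scheme \<Rightarrow> ('g, 'k::field) graded_arrow set" where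
  "graded_arrows G = {f.
     src f \<in> graded_spaces G \<and> trg f \<in> graded_spaces G \<and>
     fn f \<in> total G (src f) \<rightarrow>\<^sub>E total G (trg f) \<and>
     (\<forall>u\<in>total G (src f). \<forall>v\<in>total G (src f). fn f (u + v) = fn f u + fn f v) \<and>
     (\<forall>c. \<forall>v\<in>total G (src f). fn f (scale c v) = scale c (fn f v)) \<and>
     (\<forall>g\<in>carrier G. fn f ` src f g \<subseteq> trg f g)}"

definition graded_hom ::
  "('g, 'z) monoid_scheme \<Rightarrow> ('g, 'k::field) graded \<Rightarrow> ('g, 'k) graded \<Rightarrow> ('g, 'k) graded_arrow set"
where
  "graded_hom G V W = {f \<in> graded_arrows G. src f = V \<and> trg f = W}"

definition graded_tensor ::
  "('g, 'z) monoid_scheme \<Rightarrow> ('g, 'k::field) graded \<Rightarrow> ('g, 'k) graded \<Rightarrow> ('g, 'k) graded"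
where
  "graded_tensor G V W = (\<lambda>g. vec.span
     {pure_tensor v w | v w x y.
        x \<in> carrier G \<and> y \<in> carrier G \<and> x \<otimes>\<^bsub>G\<^esub> y = g \<and> v \<in> V x \<and> w \<in> W y})"

definition graded_unit :: "('g, 'z) monoid_scheme \<Rightarrow> ('g, 'k::field) graded" where
  "graded_unit G = (\<lambda>g. if g = \<one>\<^bsub>G\<^esub> then vec.span {basis_vec Unit_label} else {0})"

text \<open>
  In each definite description below the prescribed values are those on a spanning set, so
  that there is at most one such linear map.
\<close>

definition vec_cat ::
  "('g, 'z) monoid_scheme \<Rightarrow> ('g \<Rightarrow> 'g \<Rightarrow> 'g \<Rightarrow> 'k::field) \<Rightarrow>
   (('g, 'k) graded, ('g, 'k) graded_arrow) monoidal_category"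
where
  "vec_cat G \<omega> = \<lparr>
     Obj = graded_spaces G,
     Arr = graded_arrows G,
     Dom = src,
     Cod = trg,
     Ident = (\<lambda>V. Arrow V V (\<lambda>v\<in>total G V. v)),
     Comp = (\<lambda>h f. Arrow (src f) (trg h) (compose (total G (src f)) (fn h) (fn f))),
     tens_obj = graded_tensor G,
     tens_arr = (\<lambda>f h. THE t.
       t \<in> graded_hom G (graded_tensor G (src f) (src h)) (graded_tensor G (trg f) (trg h)) \<and>
       (\<forall>v\<in>total G (src f). \<forall>w\<in>total G (src h).
          fn t (pure_tensor v w) = pure_tensor (fn f v) (fn h w))),
     unit_obj = graded_unit G,
     assoc = (\<lambda>U V W. THE t.
       t \<in> graded_hom G (graded_tensor G (graded_tensor G U V) W)
                        (graded_tensor G U (graded_tensor G V W)) \<and>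
       (\<forall>g1\<in>carrier G. \<forall>g2\<in>carrier G. \<forall>g3\<in>carrier G. \<forall>u\<in>U g1. \<forall>v\<in>V g2. \<forall>w\<in>W g3.
          fn t (pure_tensor (pure_tensor u v) w) =
          scale (inverse (\<omega> g1 g2 g3)) (pure_tensor u (pure_tensor v w)))),
     lunit = (\<lambda>V. THE t. t \<in> graded_hom G (graded_tensor G (graded_unit G) V) V \<and>
       (\<forall>v\<in>total G V. fn t (pure_tensor (basis_vec Unit_label) v) = v)),
     runit = (\<lambda>V. THE t. t \<in> graded_hom G (graded_tensor G V (graded_unit G)) V \<and>
       (\<forall>v\<in>total G V. fn t (pure_tensor v (basis_vec Unit_label)) = v))\<rparr>"

section \<open>Twisted group algebras and their module categories\<close>

definition twisted_space :: "'g set \<Rightarrow> ('g, 'k::field) graded" where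
  "twisted_space H = (\<lambda>h. if h \<in> H then vec.span {basis_vec (Elem_label h)} else {0})"

definition twisted_algebra ::
  "('g, 'z) monoid_scheme \<Rightarrow> 'g set \<Rightarrow> ('g \<Rightarrow> 'g \<Rightarrow> 'k::field) \<Rightarrow>
   (('g, 'k) graded, ('g, 'k) graded_arrow) algebra_in"
where
  "twisted_algebra G H \<psi> = \<lparr>
     alg_obj = twisted_space H,
     alg_mult = (THE t.
       t \<in> graded_hom G (graded_tensor G (twisted_space H) (twisted_space H)) (twisted_space H) \<and>
       (\<forall>h\<in>H. \<forall>h'\<in>H.
          fn t (pure_tensor (basis_vec (Elem_label h)) (basis_vec (Elem_label h'))) =
          scale (\<psi> h h') (basis_vec (Elem_label (h \<otimes>\<^bsub>G\<^esub> h'))))),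
     alg_unit = (THE t. t \<in> graded_hom G (graded_unit G) (twisted_space H) \<and>
       fn t (basis_vec Unit_label) = basis_vec (Elem_label \<one>\<^bsub>G\<^esub>))\<rparr>"

definition M0 ::
  "('g, 'z) monoid_scheme \<Rightarrow> ('g \<Rightarrow> 'g \<Rightarrow> 'g \<Rightarrow> 'k::field) \<Rightarrow> 'g set \<Rightarrow> ('g \<Rightarrow> 'g \<Rightarrow> 'k) \<Rightarrow>
   (('g, 'k) graded \<times> ('g, 'k) graded_arrow,
    (('g, 'k) graded \<times> ('g, 'k) graded_arrow, ('g, 'k) graded_arrow) arrow,
    ('g, 'k) graded, ('g, 'k) graded_arrow) module_category"
where
  "M0 G \<omega> H \<psi> = left_module_category (vec_cat G \<omega>) (twisted_algebra G H \<psi>)"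

end

(*
  An equivalence F from M0(H, psi) to M0(L, xi) sends the regular module A of H to a module N whose
  only idempotent endomorphisms are 0 and 1, because F is fully faithful.  Hence N is free of rank
  one over the algebra of L, generated in a single degree y.  Transporting the right multiplication
  of A through F and its module constraint makes N a bimodule, and comparing the two actions on a
  generator shows that y H y^-1 is contained in L and gives a cochain theta with
  psi(h, k) theta(hk) = theta(h) theta(k) xi(l, m) Omega_y(h, k), where l and m are the conjugates
  of h and k by y.  The other inclusion holds because for l in L and x = y^-1 l y the product of N
  with a simple object of degree x has a nonzero map to N, and F is full.  Since Omega_y composed
  with conjugation by g = y^-1 is inverse to Omega_g up to an explicit coboundary, the equation for
  theta is the asserted cohomology relation.

  Conversely, tensoring with a simple object of degree g^-1 on the left amounts to shifting the
  grading of a module by g.  It keeps the underlying spaces and maps, so that the resulting functor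
  is an isomorphism of categories; only the action of L and the module constraint have to be
  rescaled, by values of omega and the given 1-cochain.
*)

theory Submission
  imports Defs
begin

section \<open>Linear maps on label functions\<close>

text \<open>Tensor products of arrows, the constraints and the algebra structure are definite
  descriptions, so each must first be realised by an explicit linear map. Afterwards every check is
  made on homogeneous pure tensors, where the associator is a scalar: a module becomes a family of
  operators \<open>mact a h\<close>, and the identities to be proved follow from the cocycle
  identity for \<omega> at suitable quadruples.

  Full faithfulness enters through two facts about the regular module A. An endomorphism of A is
  determined by the image of the unit, which lies in a one-dimensional component; hence it is a
  scalar, and an idempotent one is 0 or 1. A projection of one component of N onto a line extends to
  an idempotent endomorphism of N that fixes a nonzero vector; it must be the identity, which gives
  both the support and the rank of N. Further, A tensored with a simple object of degree x has a
  nonzero map to A only if x is in H, by degrees. Functors are not assumed additive, so zero arrows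
  have to be lifted through F explicitly.\<close>

global_interpretation vec_pair: vector_space_pair scale scale
  by unfold_locales

abbreviation lin :: "(('g, 'k::field) vec \<Rightarrow> ('h, 'k) vec) \<Rightarrow> bool" where
  "lin \<equiv> Vector_Spaces.linear scale scale"

lemma linI:
  assumes "\<And>u v. f (u + v) = f u + f v" and "\<And>c v. f (scale c v) = scale c (f v)"
  shows "lin f"
  by (simp add: Vector_Spaces.linear_iff vec.vector_space_axioms assms)

lemmas lin_add = vec_pair.linear_add
lemmas lin_scale = vec_pair.linear_scale
lemmas lin_zero = vec_pair.linear_0
lemmas lin_sum = vec_pair.linear_sum

lemma lin_id: "lin (\<lambda>v. v)"
  by (rule linI) simp_all

lemma lin_comp:
  assumes "lin f" and "lin h"
  shows "lin (\<lambda>v. h (f v))"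
  by (rule linI) (simp_all only: lin_add[OF assms(1)] lin_add[OF assms(2)]
    lin_scale[OF assms(1)] lin_scale[OF assms(2)])

lemma lin_scale_fun:
  assumes "lin f"
  shows "lin (\<lambda>v. scale c (f v))"
  by (rule linI) (simp_all only: lin_add[OF assms] lin_scale[OF assms]
    vec.scale_right_distrib vec.scale_left_commute)

lemma lin_sum_fun:
  assumes "\<And>i. i \<in> I \<Longrightarrow> lin (f i)"
  shows "lin (\<lambda>v. \<Sum>i\<in>I. f i v)"
proof (rule linI)
  show "(\<Sum>i\<in>I. f i (u + v)) = (\<Sum>i\<in>I. f i u) + (\<Sum>i\<in>I. f i v)" for u v
    unfolding sum.distrib[symmetric] by (rule sum.cong[OF refl]) (rule lin_add[OF assms])
  show "(\<Sum>i\<in>I. f i (scale c v)) = scale c (\<Sum>i\<in>I. f i v)" for c v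
    unfolding vec.scale_sum_right by (rule sum.cong[OF refl]) (rule lin_scale[OF assms])
qed

lemma lin_scale_left:
  assumes "\<And>u v. c (u + v) = c u + c v" and "\<And>a v. c (scale a v) = a * c v"
  shows "lin (\<lambda>v. scale (c v) w)"
  by (rule linI) (simp_all add: assms vec.scale_left_distrib)

lemma subspace_lin_eq:
  assumes "lin f" and "lin h"
  shows "vec.subspace {v. f v = h v}"
  by (rule vec.subspaceI) (simp_all add: lin_add[OF assms(1)] lin_add[OF assms(2)]
    lin_scale[OF assms(1)] lin_scale[OF assms(2)] lin_zero[OF assms(1)] lin_zero[OF assms(2)])

lemma subspace_lin_vimage:
  assumes "lin f" and "vec.subspace S"
  shows "vec.subspace {v. f v \<in> S}"
  by (rule vec.subspaceI) (simp_all add: lin_add[OF assms(1)] lin_scale[OF assms(1)]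
    lin_zero[OF assms(1)] vec.subspace_0[OF assms(2)] vec.subspace_add[OF assms(2)]
    vec.subspace_scale[OF assms(2)])

lemma span_lin_mem:
  assumes "v \<in> vec.span B" and "lin f" and "vec.subspace S" and "\<And>b. b \<in> B \<Longrightarrow> f b \<in> S"
  shows "f v \<in> S"
proof -
  have "vec.span B \<subseteq> {v. f v \<in> S}"
    by (rule vec.span_minimal) (use assms in \<open>auto intro: subspace_lin_vimage\<close>)
  then show ?thesis using assms(1) by blast
qed

lemma span_lin_eq:
  assumes "v \<in> vec.span B" and "lin f" and "lin h" and "\<And>b. b \<in> B \<Longrightarrow> f b = h b"
  shows "f v = h v"
proof -
  have "vec.span B \<subseteq> {v. f v = h v}"
    by (rule vec.span_minimal) (use assms in \<open>auto intro: subspace_lin_eq\<close>)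
  then show ?thesis using assms(1) by blast
qed

text \<open>Arrows are linear only on a total space and undefined elsewhere. Extending from a basis
  of \<open>S\<close> replaces them by linear maps on the whole ambient space, which compose freely
  and to which arguments on spanning sets apply.\<close>

lemma lin_extension:
  fixes f :: "('g, 'k::field) vec \<Rightarrow> ('h, 'k) vec"
  assumes S: "vec.subspace S"
    and add: "\<And>u v. u \<in> S \<Longrightarrow> v \<in> S \<Longrightarrow> f (u + v) = f u + f v"
    and scl: "\<And>c v. v \<in> S \<Longrightarrow> f (scale c v) = scale c (f v)"
  shows "\<exists>F. lin F \<and> (\<forall>v\<in>S. F v = f v)"
proof -
  obtain B where B: "B \<subseteq> S" "vec.independent B" "S \<subseteq> vec.span B"
    by (rule vec.basis_exists)
  from vec_pair.linear_independent_extend[OF B(2), of f]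
  obtain F where F: "lin F" "\<forall>x\<in>B. F x = f x"
    by (elim exE conjE)
  have f0: "f 0 = 0"
    using scl[OF vec.subspace_0[OF S], of 0] unfolding vec.scale_zero_left .
  \<comment> \<open>\<open>add\<close> and \<open>scl\<close> apply only inside \<open>S\<close>, so
    membership is part of the induction claim.\<close>
  have FS: "v \<in> S \<and> F v = f v" if "v \<in> vec.span B" for v
    using that
  proof (induction rule: vec.span_induct_alt)
    case base
    show ?case unfolding f0 lin_zero[OF F(1)] using vec.subspace_0[OF S] by (intro conjI refl)
  next
    case (step c x y)
    have x: "x \<in> S" "F x = f x" using step(1) B(1) F(2) by (auto del: ext)
    have y: "y \<in> S" "F y = f y" using step(2) by (rule conjunct1) (use step(2) in \<open>rule conjunct2\<close>)
    note cx = vec.subspace_scale[OF S x(1), of c]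
    have "F (scale c x + y) = f (scale c x + y)"
      unfolding lin_add[OF F(1)] lin_scale[OF F(1)] add[OF cx y(1)] scl[OF x(1)] x(2) y(2) ..
    with vec.subspace_add[OF S cx y(1)] show ?case
      by (intro conjI)
  qed
  show ?thesis
  proof (intro exI conjI ballI, rule F(1))
    fix v assume "v \<in> S"
    with B(3) have "v \<in> vec.span B" by (rule subsetD)
    from FS[OF this] show "F v = f v" ..
  qed
qed

text \<open>A coordinate at which \<open>v\<close> is nonzero, divided by its value there, is a
  linear functional, so no complement of the line has to be chosen.\<close>

lemma lin_projection_line:
  fixes v :: "('g, 'k::field) vec"
  assumes "v \<noteq> 0"
  obtains F :: "('g, 'k) vec \<Rightarrow> ('g, 'k) vec"
  where "lin F" and "F v = v" and "\<And>u. \<exists>c. F u = scale c v"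
proof -
  obtain i where i: "v i \<noteq> 0"
    using assms by (auto simp: fun_eq_iff)
  show thesis
  proof (rule that)
    show "lin (\<lambda>u. scale (u i / v i) v)"
      by (rule lin_scale_left) (simp_all add: scale_def add_divide_distrib)
    show "scale (v i / v i) v = v"
      using i by simp
  qed blast
qed

lemma span_singleton_iff: "v \<in> vec.span {b} \<longleftrightarrow> (\<exists>c. v = scale c b)"
  by (auto simp: vec.span_singleton)

section \<open>Operations on pure tensors\<close>

text \<open>
  Applying the operators slice by slice makes sense on all functions, not only on combinations of
  pure tensors; hence maps out of a tensor product can be defined without choosing bases of it.
\<close>

definition tmap ::
  "(('a, 'k::field) vec \<Rightarrow> ('a, 'k) vec) \<Rightarrow> (('a, 'k) vec \<Rightarrow> ('a, 'k) vec) \<Rightarrow> ('a, 'k) vec \<Rightarrow>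
      ('a, 'k) vec"
where
  "tmap f h t = (\<lambda>i. case i of
      Pair_label p q \<Rightarrow> f (\<lambda>p'. h (\<lambda>q'. t (Pair_label p' q')) q) p
    | _ \<Rightarrow> 0)"

text \<open>Evaluates the left factor of a tensor at the label \<open>p\<close>. Taken at
  \<open>Elem_label h\<close> or at \<open>Unit_label\<close> this extracts the coefficient of a
  basis vector of the algebra or of the unit object, without a basis of the other factor.\<close>

definition slice :: "'a label \<Rightarrow> ('a, 'k::field) vec \<Rightarrow> ('a, 'k) vec" where
  "slice p t = (\<lambda>q. t (Pair_label p q))"

definition slice' :: "'a label \<Rightarrow> ('a, 'k::field) vec \<Rightarrow> ('a, 'k) vec" where
  "slice' q t = (\<lambda>p. t (Pair_label p q))"

definition reassoc :: "('a, 'k::field) vec \<Rightarrow> ('a, 'k) vec" where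
  "reassoc t = (\<lambda>i. case i of
      Pair_label p (Pair_label q r) \<Rightarrow> t (Pair_label (Pair_label p q) r)
    | _ \<Rightarrow> 0)"

definition reassoc' :: "('a, 'k::field) vec \<Rightarrow> ('a, 'k) vec" where
  "reassoc' t = (\<lambda>i. case i of
      Pair_label (Pair_label p q) r \<Rightarrow> t (Pair_label p (Pair_label q r))
    | _ \<Rightarrow> 0)"

lemma pure_add_left: "pure_tensor (u + v) w = pure_tensor u w + pure_tensor v w"
  and pure_add_right: "pure_tensor u (v + w) = pure_tensor u v + pure_tensor u w"
  and pure_scale_left: "pure_tensor (scale c u) w = scale c (pure_tensor u w)"
  and pure_scale_right: "pure_tensor u (scale c w) = scale c (pure_tensor u w)"
  by (auto simp: pure_tensor_def scale_def fun_eq_iff algebra_simps split: label.split)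

lemma pure_zero_left [simp]: "pure_tensor 0 w = 0"
  and pure_zero_right [simp]: "pure_tensor v 0 = 0"
  by (auto simp: pure_tensor_def fun_eq_iff split: label.split)

lemma lin_pure_left: "lin (\<lambda>v. pure_tensor v w)"
  by (rule linI) (simp_all add: pure_add_left pure_scale_left)

lemma lin_pure_right: "lin (\<lambda>w. pure_tensor v w)"
  by (rule linI) (simp_all add: pure_add_right pure_scale_right)

lemma lin_at:
  assumes "lin f"
  shows "f (\<lambda>x. u x + v x) i = f u i + f v i" and "f (\<lambda>x. c * u x) i = c * f u i"
  using fun_cong[OF lin_add[OF assms, of u v], of i] fun_cong[OF lin_scale[OF assms, of c u], of i]
  unfolding plus_fun_def scale_def by simp_all

lemma lin_tmap:
  assumes "lin f" and "lin h"
  shows "lin (tmap f h)"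
proof (rule linI)
  show "tmap f h (u + v) = tmap f h u + tmap f h v" for u v
    by (rule ext) (simp add: tmap_def lin_at(1)[OF assms(1)] lin_at(1)[OF assms(2)]
        split: label.split)
  show "tmap f h (scale c v) = scale c (tmap f h v)" for c v
    by (rule ext)
      (simp add: tmap_def scale_def lin_at(2)[OF assms(1)] lin_at(2)[OF assms(2)]
          split: label.split)
qed

lemma tmap_pure:
  assumes "lin f" and "lin h"
  shows "tmap f h (pure_tensor v w) = pure_tensor (f v) (h w)"
proof -
  have "f (\<lambda>p'. h (\<lambda>q'. v p' * w q') q) p = f v p * h w q" for p q
    unfolding lin_at(2)[OF assms(2)]
    by (subst mult.commute, subst lin_at(2)[OF assms(1)]) (rule mult.commute)
  then show ?thesis
    by (auto simp: tmap_def pure_tensor_def fun_eq_iff split: label.split)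
qed

lemma lin_slice: "lin (slice p)" and lin_slice': "lin (slice' p)"
  by (rule linI; simp add: slice_def slice'_def scale_def fun_eq_iff)+

lemma slice_pure: "slice p (pure_tensor v w) = scale (v p) w"
  and slice'_pure: "slice' p (pure_tensor v w) = scale (w p) v"
  by (auto simp: slice_def slice'_def pure_tensor_def scale_def)

lemma lin_reassoc: "lin reassoc" and lin_reassoc': "lin reassoc'"
  by (rule linI; auto simp: reassoc_def reassoc'_def scale_def fun_eq_iff split: label.split)+

lemma reassoc_pure: "reassoc (pure_tensor (pure_tensor u v) w) = pure_tensor u (pure_tensor v w)"
  and reassoc'_pure: "reassoc' (pure_tensor u (pure_tensor v w)) = pure_tensor (pure_tensor u v) w"
  by (auto simp: reassoc_def reassoc'_def pure_tensor_def fun_eq_iff split: label.split)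

lemma basis_vec_apply: "basis_vec i j = (if j = i then 1 else 0)"
  by (simp add: basis_vec_def)

lemma basis_vec_nonzero [simp]: "basis_vec i \<noteq> (0 :: ('g, 'k::field) vec)"
proof
  assume "basis_vec i = (0 :: ('g, 'k) vec)"
  from fun_cong[OF this, of i] show False
    by (simp add: basis_vec_apply)
qed

section \<open>Graded spaces and graded maps\<close>

lemma total_component: "x \<in> carrier G \<Longrightarrow> v \<in> V x \<Longrightarrow> v \<in> total G V"
  unfolding total_def by (rule vec.span_base) blast

lemma subspace_total: "vec.subspace (total G V)"
  unfolding total_def by (rule vec.subspace_span)

lemma total_lin_mem:
  assumes "v \<in> total G V" and "lin f" and "vec.subspace S"
    and "\<And>x u. x \<in> carrier G \<Longrightarrow> u \<in> V x \<Longrightarrow> f u \<in> S"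
  shows "f v \<in> S"
  using assms(1) unfolding total_def
  by (rule span_lin_mem[OF _ assms(2,3)]) (use assms(4) in blast)

lemma total_lin_eq:
  assumes "v \<in> total G V" and "lin f" and "lin h"
    and "\<And>x u. x \<in> carrier G \<Longrightarrow> u \<in> V x \<Longrightarrow> f u = h u"
  shows "f v = h v"
  using assms(1) unfolding total_def
  by (rule span_lin_eq[OF _ assms(2,3)]) (use assms(4) in blast)

lemma graded_spaceD:
  assumes "V \<in> graded_spaces G"
  shows "x \<in> carrier G \<Longrightarrow> vec.subspace (V x)" and "x \<notin> carrier G \<Longrightarrow> V x = {0}"
  using assms unfolding graded_spaces_def by auto

lemma graded_space_subspace: "V \<in> graded_spaces G \<Longrightarrow> vec.subspace (V x)"
  using graded_spaceD[of V G x] vec.subspace_single_0 by (cases "x \<in> carrier G") auto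

lemma graded_space_finite_span:
  assumes "V \<in> graded_spaces G"
  obtains B where "finite B" and "total G V = vec.span B"
  using assms unfolding graded_spaces_def by auto

text \<open>The vectors with such a decomposition form a subspace that contains every
  component.\<close>

lemma total_decompose:
  assumes V: "V \<in> graded_spaces G" and fin: "finite (carrier G)" and v: "v \<in> total G V"
  shows "\<exists>w. (\<forall>x\<in>carrier G. w x \<in> V x) \<and> (\<Sum>x\<in>carrier G. w x) = v"
proof -
  let ?S = "{v. \<exists>w. (\<forall>x\<in>carrier G. w x \<in> V x) \<and> (\<Sum>x\<in>carrier G. w x) = v}"
  note sub = graded_space_subspace[OF V]
  have "vec.span (\<Union>x\<in>carrier G. V x) \<subseteq> ?S"
  proof (rule vec.span_minimal)
    show "(\<Union>x\<in>carrier G. V x) \<subseteq> ?S"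
    proof clarify
      fix x u assume x: "x \<in> carrier G" and u: "u \<in> V x"
      show "\<exists>w. (\<forall>x\<in>carrier G. w x \<in> V x) \<and> (\<Sum>x\<in>carrier G. w x) = u"
        by (rule exI[of _ "\<lambda>y. if y = x then u else 0"])
          (use fin x u sub in \<open>simp add: vec.subspace_0\<close>)
    qed
    show "vec.subspace ?S"
    proof (rule vec.subspaceI)
      show "0 \<in> ?S"
        by (rule CollectI, rule exI[of _ "\<lambda>_. 0"]) (simp add: sub vec.subspace_0)
      show "u + u' \<in> ?S" if u: "u \<in> ?S" and u': "u' \<in> ?S" for u u'
      proof -
        from u obtain w where w: "\<forall>x\<in>carrier G. w x \<in> V x" "(\<Sum>x\<in>carrier G. w x) = u"
          by blast
        from u' obtain w' where w': "\<forall>x\<in>carrier G. w' x \<in> V x" "(\<Sum>x\<in>carrier G. w' x) = u'"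
          by blast
        show ?thesis
          by (rule CollectI, rule exI[of _ "\<lambda>x. w x + w' x"])
            (use w w' in \<open>simp add: sub vec.subspace_add sum.distrib\<close>)
      qed
      show "scale c u \<in> ?S" if u: "u \<in> ?S" for c u
      proof -
        from u obtain w where w: "\<forall>x\<in>carrier G. w x \<in> V x" "(\<Sum>x\<in>carrier G. w x) = u"
          by blast
        show ?thesis
          by (rule CollectI, rule exI[of _ "\<lambda>x. scale c (w x)"])
            (use w in \<open>simp add: sub vec.subspace_scale vec.scale_sum_right[symmetric]\<close>)
      qed
    qed
  qed
  with v show ?thesis
    unfolding total_def by auto
qed

lemma total_decompose_unique:
  assumes V: "V \<in> graded_spaces G"
    and w: "\<forall>x\<in>carrier G. w x \<in> V x" and w': "\<forall>x\<in>carrier G. w' x \<in> V x"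
    and eq: "(\<Sum>x\<in>carrier G. w x) = (\<Sum>x\<in>carrier G. w' x)" and x: "x \<in> carrier G"
  shows "w x = w' x"
proof -
  have ind: "(\<forall>x\<in>carrier G. u x \<in> V x) \<and> (\<Sum>x\<in>carrier G. u x) = 0 \<longrightarrow> (\<forall>x\<in>carrier G. u x = 0)" for u
    using V unfolding graded_spaces_def by blast
  have "(\<forall>x\<in>carrier G. w x - w' x \<in> V x) \<and> (\<Sum>x\<in>carrier G. w x - w' x) = 0"
    using w w' eq graded_space_subspace[OF V] by (simp add: vec.subspace_diff sum_subtractf)
  with ind[of "\<lambda>x. w x - w' x"] x have "w x - w' x = 0"
    by blast
  then show ?thesis by simp
qed

text \<open>Directness of the grading makes the component of degree \<open>x\<close> independent of
  the chosen decomposition, hence additive and homogeneous on the total space;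
  \<open>lin_extension\<close> then defines it everywhere.\<close>

lemma graded_projection_exists:
  assumes V: "V \<in> graded_spaces G" and fin: "finite (carrier G)" and x: "x \<in> carrier G"
  shows "\<exists>P. lin P \<and> (\<forall>y\<in>carrier G. \<forall>v\<in>V y. P v = (if y = x then v else 0))"
proof -
  note sub = graded_space_subspace[OF V]
  define dec where "dec v = (SOME w. (\<forall>x\<in>carrier G. w x \<in> V x) \<and> (\<Sum>x\<in>carrier G. w x) = v)" for v
  have dec1: "dec v y \<in> V y" if "v \<in> total G V" "y \<in> carrier G" for v y
    using someI_ex[OF total_decompose[OF V fin that(1)]] that(2) unfolding dec_def by blast
  have dec2: "(\<Sum>x\<in>carrier G. dec v x) = v" if "v \<in> total G V" for v
    using someI_ex[OF total_decompose[OF V fin that(1)]] unfolding dec_def by blast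
  have decI: "dec v x = w x"
    if "v \<in> total G V" "\<forall>x\<in>carrier G. w x \<in> V x" "(\<Sum>x\<in>carrier G. w x) = v" for v w
    by (rule total_decompose_unique[OF V _ that(2) _ x]) (use dec1 dec2 that in auto)
  have "\<exists>P. lin P \<and> (\<forall>v\<in>total G V. P v = dec v x)"
  proof (rule lin_extension[OF subspace_total[of G V], where f = "\<lambda>v. dec v x"])
    fix u v assume u: "u \<in> total G V" and v: "v \<in> total G V"
    have uv: "u + v \<in> total G V"
      by (rule vec.subspace_add[OF subspace_total u v])
    show "dec (u + v) x = dec u x + dec v x"
      by (rule decI[OF uv, where w = "\<lambda>y. dec u y + dec v y"])
          (simp_all add: dec1[OF u] dec1[OF v] dec2[OF u] dec2[OF v]
        sub vec.subspace_add sum.distrib)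
  next
    fix c v assume v: "v \<in> total G V"
    have cv: "scale c v \<in> total G V"
      by (rule vec.subspace_scale[OF subspace_total v])
    show "dec (scale c v) x = scale c (dec v x)"
      by (rule decI[OF cv, where w = "\<lambda>y. scale c (dec v y)"]) (simp_all add: dec1[OF v] dec2[OF v]
        sub vec.subspace_scale vec.scale_sum_right[symmetric])
  qed
  then obtain P where P: "lin P" "\<And>v. v \<in> total G V \<Longrightarrow> P v = dec v x"
    by blast
  have "P v = (if y = x then v else 0)" if y: "y \<in> carrier G" and v: "v \<in> V y" for y v
  proof -
    have tv: "v \<in> total G V"
      using y v by (rule total_component)
    have "dec v x = (if x = y then v else 0)"
      by (rule decI[OF tv, where w = "\<lambda>x. if x = y then v else 0"])
        (use y v fin sub in \<open>simp_all add: vec.subspace_0\<close>)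
    with P(2)[OF tv] show ?thesis by auto
  qed
  with P(1) show ?thesis by blast
qed

text \<open>Only the values on homogeneous vectors are prescribed; off the total space this is an
  arbitrary linear extension.\<close>

definition gproj :: "('g, 'z) monoid_scheme \<Rightarrow> ('g, 'k::field) graded \<Rightarrow> 'g \<Rightarrow> ('g, 'k) vec \<Rightarrow>
    ('g, 'k) vec" where
  "gproj G V x = (SOME P. lin P \<and> (\<forall>y\<in>carrier G. \<forall>v\<in>V y. P v = (if y = x then v else 0)))"

lemma gproj:
  assumes "V \<in> graded_spaces G" and "finite (carrier G)" and "x \<in> carrier G"
  shows lin_gproj: "lin (gproj G V x)"
    and gproj_component: "y \<in> carrier G \<Longrightarrow> v \<in> V y \<Longrightarrow> gproj G V x v = (if y = x then v else 0)"
  using someI_ex[OF graded_projection_exists[OF assms]] unfolding gproj_def by blast+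

text \<open>Directness of the sum follows from linear projections: applying \<open>P x\<close> to a
  vanishing sum leaves the summand of degree \<open>x\<close>. For tensor products such projections
  are easier to produce than uniqueness of decompositions.\<close>

lemma graded_spaceI:
  assumes "\<And>x. x \<in> carrier G \<Longrightarrow> vec.subspace (V x)" and "\<And>x. x \<notin> carrier G \<Longrightarrow> V x = {0}"
    and fin: "finite (carrier G)"
    and P: "\<And>x. x \<in> carrier G \<Longrightarrow> lin (P x)"
      "\<And>x y v. x \<in> carrier G \<Longrightarrow> y \<in> carrier G \<Longrightarrow> v \<in> V y \<Longrightarrow> P x v = (if y = x then v else 0)"
    and "finite B" and "total G V = vec.span B"
  shows "V \<in> graded_spaces G"
proof -
  have "v x = 0"
    if v: "\<forall>x\<in>carrier G. v x \<in> V x" "(\<Sum>x\<in>carrier G. v x) = 0" and x: "x \<in> carrier G" for v x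
  proof -
    have "(\<Sum>y\<in>carrier G. P x (v y)) = (\<Sum>y\<in>carrier G. if y = x then v y else 0)"
      by (rule sum.cong[OF refl]) (use P(2)[OF x] v(1) in blast)
    also have "\<dots> = v x"
      using fin x by simp
    finally show ?thesis
      unfolding lin_sum[OF P(1)[OF x], symmetric] v(2) lin_zero[OF P(1)[OF x]] by simp
  qed
  with assms show ?thesis
    unfolding graded_spaces_def by blast
qed

lemma graded_homD:
  assumes "f \<in> graded_hom G V W"
  shows "src f = V" and "trg f = W" and "V \<in> graded_spaces G" and "W \<in> graded_spaces G"
    and "fn f \<in> extensional (total G V)"
    and "v \<in> total G V \<Longrightarrow> fn f v \<in> total G W"
    and "x \<in> carrier G \<Longrightarrow> v \<in> V x \<Longrightarrow> fn f v \<in> W x"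
  using assms unfolding graded_hom_def graded_arrows_def
      by (auto simp: PiE_def Pi_def image_subset_iff)

lemma graded_hom_lin:
  assumes "f \<in> graded_hom G V W"
  shows "\<exists>F. lin F \<and> (\<forall>v\<in>total G V. fn f v = F v)"
proof -
  have f: "f \<in> graded_arrows G" "src f = V"
    using assms unfolding graded_hom_def by auto
  from f have *: "\<And>u v. u \<in> total G V \<Longrightarrow> v \<in> total G V \<Longrightarrow> fn f (u + v) = fn f u + fn f v"
    "\<And>c v. v \<in> total G V \<Longrightarrow> fn f (scale c v) = scale c (fn f v)"
    unfolding graded_arrows_def by auto
  have "\<exists>F. lin F \<and> (\<forall>v\<in>total G V. F v = fn f v)"
    by (rule lin_extension[OF subspace_total *])
  then show ?thesis
    by metis
qed

lemma graded_hom_add: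
  "f \<in> graded_hom G V W \<Longrightarrow> u \<in> total G V \<Longrightarrow> v \<in> total G V \<Longrightarrow> fn f (u + v) = fn f u + fn f v"
  and graded_hom_scale:
  "f \<in> graded_hom G V W \<Longrightarrow> v \<in> total G V \<Longrightarrow> fn f (scale c v) = scale c (fn f v)"
  unfolding graded_hom_def graded_arrows_def by auto

lemma graded_hom_zero: "f \<in> graded_hom G V W \<Longrightarrow> fn f 0 = 0"
  using graded_hom_scale[of f G V W 0 0] vec.subspace_0[OF subspace_total] by auto

text \<open>Homogeneous vectors span the total space, outside of which the function of an arrow is
  \<open>undefined\<close>.\<close>

lemma graded_hom_eqI:
  assumes f: "f \<in> graded_hom G V W" and h: "h \<in> graded_hom G V W"
    and "\<And>x v. x \<in> carrier G \<Longrightarrow> v \<in> V x \<Longrightarrow> fn f v = fn h v"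
  shows "f = h"
proof -
  obtain F where F: "lin F" "\<And>v. v \<in> total G V \<Longrightarrow> fn f v = F v"
    using graded_hom_lin[OF f] by blast
  obtain K where K: "lin K" "\<And>v. v \<in> total G V \<Longrightarrow> fn h v = K v"
    using graded_hom_lin[OF h] by blast
  have "F v = K v" if "v \<in> total G V" for v
  proof (rule total_lin_eq[OF that F(1) K(1)])
    fix x u assume "x \<in> carrier G" "u \<in> V x"
    with assms(3)[of x u] F(2)[of u] K(2)[of u] total_component[of x G u V]
    show "F u = K u" by simp
  qed
  then have "fn f v = fn h v" if "v \<in> total G V" for v
    using F(2) K(2) that by simp
  then have "fn f = fn h"
    using graded_homD(5)[OF f] graded_homD(5)[OF h] by (rule extensionalityI[rotated 2])
  with graded_homD(1,2)[OF f] graded_homD(1,2)[OF h] show ?thesis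
    by (simp add: arrow.expand)
qed

text \<open>The restriction is forced by extensionality of arrows; linear maps that agree on the
  total space of \<open>V\<close> give the same arrow.\<close>

definition lin_arrow ::
  "('g, 'z) monoid_scheme \<Rightarrow> ('g, 'k::field) graded \<Rightarrow> ('g, 'k) graded \<Rightarrow>
      (('g, 'k) vec \<Rightarrow> ('g, 'k) vec) \<Rightarrow> ('g, 'k) graded_arrow"
where
  "lin_arrow G V W f = Arrow V W (restrict f (total G V))"

lemma lin_arrow_hom:
  assumes V: "V \<in> graded_spaces G" and W: "W \<in> graded_spaces G" and f: "lin f"
    and fV: "\<And>x v. x \<in> carrier G \<Longrightarrow> v \<in> V x \<Longrightarrow> f v \<in> W x"
  shows "lin_arrow G V W f \<in> graded_hom G V W"
proof -
  have "f v \<in> total G W" if "v \<in> total G V" for v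
    by (rule total_lin_mem[OF that f subspace_total]) (blast intro: total_component fV)
  moreover have "f (u + v) = f u + f v" and "f (scale c v) = scale c (f v)" for u v c
    by (rule lin_add[OF f], rule lin_scale[OF f])
  ultimately show ?thesis
    unfolding graded_hom_def graded_arrows_def lin_arrow_def
    using V W fV
    by (auto simp: vec.subspace_add[OF subspace_total] vec.subspace_scale[OF subspace_total]
        total_component)
qed

lemma lin_arrow_apply: "v \<in> total G V \<Longrightarrow> fn (lin_arrow G V W f) v = f v"
  by (simp add: lin_arrow_def)

section \<open>Categories\<close>

text \<open>The record \<open>category\<close> carries no laws. Those needed for handling inverses
  and equivalences are assumed here and proved for \<open>vec_cat\<close> and \<open>M0\<close>
  below.\<close>

locale cat =
  fixes C :: "('o, 'm, 'z) category_scheme" (structure)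
  assumes dom_obj: "f \<in> Arr C \<Longrightarrow> Dom C f \<in> Obj C"
    and cod_obj: "f \<in> Arr C \<Longrightarrow> Cod C f \<in> Obj C"
    and ident_hom: "X \<in> Obj C \<Longrightarrow> Ident C X \<in> Hom C X X"
    and comp_hom: "f \<in> Hom C X Y \<Longrightarrow> h \<in> Hom C Y Z \<Longrightarrow> h \<cdot> f \<in> Hom C X Z"
    and comp_assoc: "f \<in> Hom C W X \<Longrightarrow> h \<in> Hom C X Y \<Longrightarrow> k \<in> Hom C Y Z \<Longrightarrow>
      (k \<cdot> h) \<cdot> f = k \<cdot> h \<cdot> f"
    and ident_left: "f \<in> Hom C X Y \<Longrightarrow> Ident C Y \<cdot> f = f"
    and ident_right: "f \<in> Hom C X Y \<Longrightarrow> f \<cdot> Ident C X = f"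
begin

lemma hom_obj: "f \<in> Hom C X Y \<Longrightarrow> X \<in> Obj C" "f \<in> Hom C X Y \<Longrightarrow> Y \<in> Obj C"
  using dom_obj cod_obj by (auto simp: Hom_def)

lemma inverse_arrows_unique:
  assumes "inverse_arrows C f h" and "inverse_arrows C f k"
  shows "h = k"
proof -
  have f: "f \<in> Hom C (Dom C f) (Cod C f)" and h: "h \<in> Hom C (Cod C f) (Dom C f)"
    and k: "k \<in> Hom C (Cod C f) (Dom C f)"
    using assms by (auto simp: inverse_arrows_def Hom_def)
  have "h = (h \<cdot> f) \<cdot> k"
    unfolding comp_assoc[OF k f h] using assms ident_right[OF h] by (simp add: inverse_arrows_def)
  also have "\<dots> = k"
    using assms ident_left[OF k] by (simp add: inverse_arrows_def)
  finally show ?thesis .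
qed

lemma inv_arrow_eq: "inverse_arrows C f h \<Longrightarrow> inv_arrow C f = h"
  unfolding inv_arrow_def by (blast intro: the_equality inverse_arrows_unique)

lemma inverse_arrowsI:
  assumes "f \<in> Hom C X Y" and "h \<in> Hom C Y X" and "h \<cdot> f = Ident C X" and "f \<cdot> h = Ident C Y"
  shows "inverse_arrows C f h"
  using assms by (simp add: inverse_arrows_def Hom_def)

lemma iso_arrow_inverse:
  assumes "iso_arrow C f" and "f \<in> Hom C X Y"
  obtains h where "h \<in> Hom C Y X" and "h \<cdot> f = Ident C X" and "f \<cdot> h = Ident C Y"
  using assms by (auto simp: iso_arrow_def inverse_arrows_def Hom_def)

lemma iso_cancel_right:
  assumes f: "iso_arrow C f" "f \<in> Hom C X Y" and h: "h \<in> Hom C Y Z" and k: "k \<in> Hom C Y Z"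
    and eq: "h \<cdot> f = k \<cdot> f"
  shows "h = k"
proof -
  obtain j where j: "j \<in> Hom C Y X" "f \<cdot> j = Ident C Y"
    using iso_arrow_inverse[OF f] by metis
  have "h = (h \<cdot> f) \<cdot> j"
    unfolding comp_assoc[OF j(1) f(2) h] j(2) ident_right[OF h] ..
  also have "\<dots> = k"
    unfolding eq comp_assoc[OF j(1) f(2) k] j(2) ident_right[OF k] ..
  finally show ?thesis .
qed

lemma iso_cancel_left:
  assumes f: "iso_arrow C f" "f \<in> Hom C X Y" and h: "h \<in> Hom C Z X" and k: "k \<in> Hom C Z X"
    and eq: "f \<cdot> h = f \<cdot> k"
  shows "h = k"
proof -
  obtain j where j: "j \<in> Hom C Y X" "j \<cdot> f = Ident C X"
    using iso_arrow_inverse[OF f] by metis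
  have "h = j \<cdot> f \<cdot> h"
    unfolding comp_assoc[OF h f(2) j(1), symmetric] j(2) ident_left[OF h] ..
  also have "\<dots> = k"
    unfolding eq comp_assoc[OF k f(2) j(1), symmetric] j(2) ident_left[OF k] ..
  finally show ?thesis .
qed

end

lemma functor_hom:
  "is_functor C D Fo Fa \<Longrightarrow> f \<in> Hom C X Y \<Longrightarrow> Fa f \<in> Hom D (Fo X) (Fo Y)"
  by (auto simp: is_functor_def Hom_def)

lemma functor_comp:
  "is_functor C D Fo Fa \<Longrightarrow> f \<in> Hom C X Y \<Longrightarrow> h \<in> Hom C Y Z \<Longrightarrow> Fa (h \<cdot>\<^bsub>C\<^esub> f) = Fa h \<cdot>\<^bsub>D\<^esub> Fa f"
  by (auto simp: is_functor_def Hom_def)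

lemma natural_iso_hom:
  "natural_iso C D Fo Fa Fo' Fa' \<eta> \<Longrightarrow> X \<in> Obj C \<Longrightarrow> \<eta> X \<in> Hom D (Fo X) (Fo' X)"
  "natural_iso C D Fo Fa Fo' Fa' \<eta> \<Longrightarrow> X \<in> Obj C \<Longrightarrow> iso_arrow D (\<eta> X)"
  "natural_iso C D Fo Fa Fo' Fa' \<eta> \<Longrightarrow> f \<in> Hom C X Y \<Longrightarrow> \<eta> Y \<cdot>\<^bsub>D\<^esub> Fa f = Fa' f \<cdot>\<^bsub>D\<^esub> \<eta> X"
  by (auto simp: natural_iso_def Hom_def)

text \<open>Naturality of the unit recovers \<open>f\<close> from \<open>Ka (Fa f)\<close>, because
  the unit is invertible and can be cancelled.\<close>

lemma equivalence_faithful: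
  assumes "cat C" and "cat D" and E: "is_equivalence C D Fo Fa"
    and f: "f \<in> Hom C X Y" and h: "h \<in> Hom C X Y" and eq: "Fa f = Fa h"
  shows "f = h"
proof -
  interpret C: cat C by fact
  from E obtain Ko Ka \<eta> where
    \<eta>: "natural_iso C C (\<lambda>X. X) (\<lambda>f. f) (\<lambda>X. Ko (Fo X)) (\<lambda>f. Ka (Fa f)) \<eta>"
    by (auto simp: is_equivalence_def)
  note XY = C.hom_obj[OF f]
  show ?thesis
    by (rule C.iso_cancel_left[OF natural_iso_hom(2)[OF \<eta> XY(2)] natural_iso_hom(1)[OF \<eta> XY(2)]
        f h])
      (simp add: natural_iso_hom(3)[OF \<eta> f] natural_iso_hom(3)[OF \<eta> h] eq)
qed

text \<open>The arrow conjugate to \<open>Ka h\<close> under the unit has the same image under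
  \<open>K\<close>, after applying \<open>F\<close>, as \<open>h\<close>; naturality of the counit,
  cancelled on the right, then identifies \<open>Fa f\<close> with \<open>h\<close>. No triangle
  identities are at hand, so faithfulness of \<open>K\<close> takes their place.\<close>

lemma equivalence_full:
  assumes "cat C" and "cat D" and E: "is_equivalence C D Fo Fa"
    and X: "X \<in> Obj C" and Y: "Y \<in> Obj C" and h: "h \<in> Hom D (Fo X) (Fo Y)"
  shows "\<exists>f\<in>Hom C X Y. Fa f = h"
proof -
  interpret C: cat C by fact
  interpret D: cat D by fact
  from E obtain Ko Ka \<eta> \<epsilon> where F: "is_functor C D Fo Fa" and K: "is_functor D C Ko Ka"
    and \<eta>: "natural_iso C C (\<lambda>X. X) (\<lambda>f. f) (\<lambda>X. Ko (Fo X)) (\<lambda>f. Ka (Fa f)) \<eta>"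
    and \<epsilon>: "natural_iso D D (\<lambda>Y. Fo (Ko Y)) (\<lambda>f. Fa (Ka f)) (\<lambda>Y. Y) (\<lambda>f. f) \<epsilon>"
    by (auto simp: is_equivalence_def)
  note \<eta>X = natural_iso_hom(1,2)[OF \<eta> X] and \<eta>Y = natural_iso_hom(1,2)[OF \<eta> Y]
  obtain j where j: "j \<in> Hom C (Ko (Fo Y)) Y" "\<eta> Y \<cdot>\<^bsub>C\<^esub> j = Ident C (Ko (Fo Y))"
    using C.iso_arrow_inverse[OF \<eta>Y(2,1)] by metis
  have Kh: "Ka h \<in> Hom C (Ko (Fo X)) (Ko (Fo Y))"
    by (rule functor_hom[OF K h])
  define f where "f = j \<cdot>\<^bsub>C\<^esub> Ka h \<cdot>\<^bsub>C\<^esub> \<eta> X"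
  have c: "Ka h \<cdot>\<^bsub>C\<^esub> \<eta> X \<in> Hom C X (Ko (Fo Y))"
    by (rule C.comp_hom[OF \<eta>X(1) Kh])
  have f: "f \<in> Hom C X Y"
    unfolding f_def by (rule C.comp_hom[OF c j(1)])
  have "\<eta> Y \<cdot>\<^bsub>C\<^esub> f = Ka h \<cdot>\<^bsub>C\<^esub> \<eta> X"
    unfolding f_def C.comp_assoc[OF c j(1) \<eta>Y(1), symmetric] j(2) C.ident_left[OF c] ..
  then have "Ka (Fa f) \<cdot>\<^bsub>C\<^esub> \<eta> X = Ka h \<cdot>\<^bsub>C\<^esub> \<eta> X"
    unfolding natural_iso_hom(3)[OF \<eta> f] .
  then have K_eq: "Ka (Fa f) = Ka h"
    using C.iso_cancel_right[OF \<eta>X(2,1) functor_hom[OF K functor_hom[OF F f]] Kh] by blast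
  have obj: "Fo X \<in> Obj D"
    by (rule D.hom_obj(1)[OF h])
  have "Fa f = h"
    by (rule D.iso_cancel_right[OF natural_iso_hom(2)[OF \<epsilon> obj] natural_iso_hom(1)[OF \<epsilon> obj]
        functor_hom[OF F f] h])
      (simp add: natural_iso_hom(3)[OF \<epsilon> functor_hom[OF F f], symmetric]
        natural_iso_hom(3)[OF \<epsilon> h, symmetric] K_eq)
  with f show ?thesis by blast
qed

section \<open>The monoidal category of graded spaces\<close>

locale pointed = group G for G :: "('g, 'z) monoid_scheme" (structure) +
  fixes \<omega> :: "'g \<Rightarrow> 'g \<Rightarrow> 'g \<Rightarrow> 'k::field"
  assumes finite_carrier: "finite (carrier G)" and cocycle: "\<omega> \<in> Z3 G"
begin

abbreviation tensor (infixl "\<boxtimes>" 60) where "V \<boxtimes> W \<equiv> graded_tensor G V W"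
abbreviation spaces where "spaces \<equiv> graded_spaces G :: ('g, 'k) graded set"
abbreviation hom where "hom \<equiv> graded_hom G :: ('g, 'k) graded \<Rightarrow> ('g, 'k) graded \<Rightarrow> _"
abbreviation cc (infixr "\<odot>" 55) where "h \<odot> f \<equiv> Comp (vec_cat G \<omega>) h f"
abbreviation tens_map (infixl "\<otimes>\<otimes>" 60) where "f \<otimes>\<otimes> h \<equiv> tens_arr (vec_cat G \<omega>) f h"
abbreviation idn where "idn V \<equiv> Ident (vec_cat G \<omega>) V"
abbreviation asc where "asc U V W \<equiv> assoc (vec_cat G \<omega>) U V W"
abbreviation asc' where "asc' U V W \<equiv> inv_arrow (vec_cat G \<omega>) (asc U V W)"

lemma omega_nonzero:
  "a \<in> carrier G \<Longrightarrow> b \<in> carrier G \<Longrightarrow> c \<in> carrier G \<Longrightarrow> \<omega> a b c \<noteq> 0"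
  using cocycle by (auto simp: Z3_def C3_def)

lemma omega_one [simp]:
  "a \<in> carrier G \<Longrightarrow> b \<in> carrier G \<Longrightarrow> \<omega> \<one> a b = 1"
  "a \<in> carrier G \<Longrightarrow> b \<in> carrier G \<Longrightarrow> \<omega> a \<one> b = 1"
  "a \<in> carrier G \<Longrightarrow> b \<in> carrier G \<Longrightarrow> \<omega> a b \<one> = 1"
  using cocycle by (auto simp: Z3_def C3_def)

text \<open>Without denominators the cocycle condition serves for all coherence conditions: each
  comparison of rebracketings is an instance at the four degrees involved.\<close>

lemma pentagon:
  assumes "a \<in> carrier G" and "b \<in> carrier G" and "c \<in> carrier G" and "d \<in> carrier G"
  shows "\<omega> b c d * \<omega> a (b \<otimes> c) d * \<omega> a b c = \<omega> (a \<otimes> b) c d * \<omega> a b (c \<otimes> d)"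
proof -
  have "d3 G \<omega> a b c d = 1"
    using cocycle assms by (auto simp: Z3_def)
  then show ?thesis
    using assms by (simp add: d3_def omega_nonzero field_simps)
qed

lemmas gproj_lin [simp, intro] = lin_gproj[OF _ finite_carrier]
lemmas gproj_comp = gproj_component[OF _ finite_carrier]

lemma tensor_component:
  assumes "x \<in> carrier G" and "y \<in> carrier G" and "v \<in> V x" and "w \<in> W y"
  shows "pure_tensor v w \<in> (V \<boxtimes> W) (x \<otimes> y)"
  unfolding graded_tensor_def by (rule vec.span_base) (use assms in blast)

text \<open>Claims about a component of a product are reduced to pure tensors through linear maps on
  the whole ambient space, which replaces the universal property of the tensor product.\<close>

lemma tensor_lin_mem:
  assumes t: "t \<in> (V \<boxtimes> W) z" and f: "lin f" and S: "vec.subspace S"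
    and m: "\<And>x y v w. x \<in> carrier G \<Longrightarrow> y \<in> carrier G \<Longrightarrow> x \<otimes> y = z \<Longrightarrow> v \<in> V x \<Longrightarrow> w \<in> W y \<Longrightarrow>
      f (pure_tensor v w) \<in> S"
  shows "f t \<in> S"
  using t unfolding graded_tensor_def by (rule span_lin_mem[OF _ f S]) (use m in blast)

lemma tensor_lin_eq:
  assumes t: "t \<in> (V \<boxtimes> W) z" and f: "lin f" and h: "lin h"
    and m: "\<And>x y v w. x \<in> carrier G \<Longrightarrow> y \<in> carrier G \<Longrightarrow> x \<otimes> y = z \<Longrightarrow> v \<in> V x \<Longrightarrow> w \<in> W y \<Longrightarrow>
      f (pure_tensor v w) = h (pure_tensor v w)"
  shows "f t = h t"
  using t unfolding graded_tensor_def by (rule span_lin_eq[OF _ f h]) (use m in blast)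

lemma tensor_outside: "z \<notin> carrier G \<Longrightarrow> (V \<boxtimes> W) z = {0}"
proof -
  assume "z \<notin> carrier G"
  then have no_pure: "{pure_tensor v w | v w x y.
        x \<in> carrier G \<and> y \<in> carrier G \<and> x \<otimes> y = z \<and> v \<in> V x \<and> w \<in> W y} = {}"
    by auto
  show ?thesis
    unfolding graded_tensor_def no_pure by (rule vec.span_empty)
qed

lemma pure_total:
  assumes "v \<in> total G V" and "w \<in> total G W"
  shows "pure_tensor v w \<in> total G (V \<boxtimes> W)"
proof (rule total_lin_mem[OF assms(1) lin_pure_left subspace_total])
  fix x u assume u: "x \<in> carrier G" "u \<in> V x"
  show "pure_tensor u w \<in> total G (V \<boxtimes> W)"
  proof (rule total_lin_mem[OF assms(2) lin_pure_right subspace_total])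
    fix y t assume t: "y \<in> carrier G" "t \<in> W y"
    show "pure_tensor u t \<in> total G (V \<boxtimes> W)"
      by (rule total_component[of "x \<otimes> y"]) (use u t in \<open>auto intro: tensor_component\<close>)
  qed
qed

text \<open>The component of degree \<open>z\<close> is the sum over \<open>x\<close> of the
  products of components of degrees \<open>x\<close> and \<open>inv x \<otimes> z\<close>, so the
  sum of the corresponding products of projections is its projection. Pure tensors of spanning
  vectors give a finite spanning set.\<close>

lemma tensor_space:
  assumes V: "V \<in> spaces" and W: "W \<in> spaces"
  shows "V \<boxtimes> W \<in> spaces"
proof -
  define P where "P z t = (\<Sum>x\<in>carrier G. tmap (gproj G V x) (gproj G W (inv x \<otimes> z)) t)" for z t
  have P: "lin (P z)" if "z \<in> carrier G" for z
    unfolding P_def by (intro lin_sum_fun lin_tmap gproj_lin V W) (use that in auto)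
  have Pt: "P z t = (if y = z then t else 0)"
    if z: "z \<in> carrier G" and y: "y \<in> carrier G" and t: "t \<in> (V \<boxtimes> W) y" for y z t
  proof -
    have "lin (\<lambda>t. if y = z then t else (0 :: ('g, 'k) vec))"
      by (rule linI) auto
    with t P[OF z] show ?thesis
    proof (rule tensor_lin_eq)
      fix a b v w assume ab: "a \<in> carrier G" "b \<in> carrier G" "a \<otimes> b = y" and v: "v \<in> V a"
          and w: "w \<in> W b"
      have "P z (pure_tensor v w) = (\<Sum>x\<in>carrier G. if x = a then
          (if b = inv a \<otimes> z then pure_tensor v w else 0) else 0)"
        unfolding P_def
        by (rule sum.cong[OF refl])
          (use z ab v w in \<open>auto simp: tmap_pure V W gproj_comp\<close>)
      also have "\<dots> = (if b = inv a \<otimes> z then pure_tensor v w else 0)"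
        using ab finite_carrier by simp
      also have "b = inv a \<otimes> z \<longleftrightarrow> y = z"
        using ab z by (metis inv_solve_left)
      finally show "P z (pure_tensor v w) = (if y = z then pure_tensor v w else 0)" .
    qed
  qed
  obtain B where B: "finite B" "total G V = vec.span B"
    using V by (rule graded_space_finite_span)
  obtain B' where B': "finite B'" "total G W = vec.span B'"
    using W by (rule graded_space_finite_span)
  let ?B = "case_prod pure_tensor ` (B \<times> B')"
  have "pure_tensor v w \<in> vec.span ?B" if "v \<in> vec.span B" "w \<in> vec.span B'" for v w
  proof (rule span_lin_mem[OF that(1) lin_pure_left vec.subspace_span])
    fix b assume b: "b \<in> B"
    show "pure_tensor b w \<in> vec.span ?B"
      by (rule span_lin_mem[OF that(2) lin_pure_right vec.subspace_span])
        (use b in \<open>auto intro!: vec.span_base\<close>)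
  qed
  then have "t \<in> vec.span ?B" if "z \<in> carrier G" "t \<in> (V \<boxtimes> W) z" for t z
    using that(2)
    by (rule_tac tensor_lin_mem[OF _ lin_id vec.subspace_span])
      (auto simp: B(2)[symmetric] B'(2)[symmetric] intro: total_component)
  then have "total G (V \<boxtimes> W) \<subseteq> vec.span ?B"
    unfolding total_def by (intro vec.span_minimal vec.subspace_span) blast
  moreover have "vec.span ?B \<subseteq> total G (V \<boxtimes> W)"
    by (intro vec.span_minimal subspace_total)
      (auto intro!: pure_total simp: B B' vec.span_base)
  ultimately have "total G (V \<boxtimes> W) = vec.span ?B"
    by blast
  then show ?thesis
    by (intro graded_spaceI[where P = P and B = ?B] finite_carrier P Pt tensor_outside)
      (simp_all add: graded_tensor_def B B')
qed

lemma tensor_hom_eqI: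
  assumes f: "f \<in> hom (V \<boxtimes> W) U" and h: "h \<in> hom (V \<boxtimes> W) U"
    and eq: "\<And>x y v w. x \<in> carrier G \<Longrightarrow> y \<in> carrier G \<Longrightarrow> v \<in> V x \<Longrightarrow> w \<in> W y \<Longrightarrow>
      fn f (pure_tensor v w) = fn h (pure_tensor v w)"
  shows "f = h"
proof (rule graded_hom_eqI[OF f h])
  fix z t assume z: "z \<in> carrier G" and t: "t \<in> (V \<boxtimes> W) z"
  obtain F where F: "lin F" "\<And>v. v \<in> total G (V \<boxtimes> W) \<Longrightarrow> fn f v = F v"
    using graded_hom_lin[OF f] by blast
  obtain K where K: "lin K" "\<And>v. v \<in> total G (V \<boxtimes> W) \<Longrightarrow> fn h v = K v"
    using graded_hom_lin[OF h] by blast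
  have "F t = K t"
    using t F(1) K(1)
  proof (rule tensor_lin_eq)
    fix x y v w assume *: "x \<in> carrier G" "y \<in> carrier G" "x \<otimes> y = z" "v \<in> V x" "w \<in> W y"
    then have "pure_tensor v w \<in> total G (V \<boxtimes> W)"
      by (blast intro: pure_total total_component)
    with eq[OF *(1,2,4,5)] F(2) K(2) show "F (pure_tensor v w) = K (pure_tensor v w)"
      by simp
  qed
  moreover have "t \<in> total G (V \<boxtimes> W)"
    using z t by (rule total_component)
  ultimately show "fn f t = fn h t"
    using F(2) K(2) by simp
qed

text \<open>Linearity is used twice, for the outer and then for the inner product. A version for the
  other bracketing follows, since the associator and its inverse have different sources.\<close>

lemma tensor3_hom_eqI:
  assumes f: "f \<in> hom (V \<boxtimes> W \<boxtimes> U) T" and h: "h \<in> hom (V \<boxtimes> W \<boxtimes> U) T"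
    and eq: "\<And>x y z v w u. x \<in> carrier G \<Longrightarrow> y \<in> carrier G \<Longrightarrow> z \<in> carrier G \<Longrightarrow>
      v \<in> V x \<Longrightarrow> w \<in> W y \<Longrightarrow> u \<in> U z \<Longrightarrow>
      fn f (pure_tensor (pure_tensor v w) u) = fn h (pure_tensor (pure_tensor v w) u)"
  shows "f = h"
proof (rule tensor_hom_eqI[OF f h])
  fix c z t u assume c: "c \<in> carrier G" "t \<in> (V \<boxtimes> W) c" and z: "z \<in> carrier G" "u \<in> U z"
  obtain F where F: "lin F" "\<And>v. v \<in> total G (V \<boxtimes> W \<boxtimes> U) \<Longrightarrow> fn f v = F v"
    using graded_hom_lin[OF f] by blast
  obtain K where K: "lin K" "\<And>v. v \<in> total G (V \<boxtimes> W \<boxtimes> U) \<Longrightarrow> fn h v = K v"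
    using graded_hom_lin[OF h] by blast
  have "F (pure_tensor t u) = K (pure_tensor t u)"
    using c(2) lin_comp[OF lin_pure_left F(1)] lin_comp[OF lin_pure_left K(1)]
  proof (rule tensor_lin_eq)
    fix x y v w assume *: "x \<in> carrier G" "y \<in> carrier G" "x \<otimes> y = c" "v \<in> V x" "w \<in> W y"
    then have "pure_tensor (pure_tensor v w) u \<in> total G (V \<boxtimes> W \<boxtimes> U)"
      using z by (blast intro: pure_total total_component)
    with eq[OF *(1,2) z(1) *(4,5) z(2)] F(2) K(2)
    show "F (pure_tensor (pure_tensor v w) u) = K (pure_tensor (pure_tensor v w) u)"
      by simp
  qed
  moreover have "pure_tensor t u \<in> total G (V \<boxtimes> W \<boxtimes> U)"
    using c z by (blast intro: pure_total total_component)
  ultimately show "fn f (pure_tensor t u) = fn h (pure_tensor t u)"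
    using F(2) K(2) by simp
qed

lemma tensor3_hom_eqI':
  assumes f: "f \<in> hom (V \<boxtimes> (W \<boxtimes> U)) T" and h: "h \<in> hom (V \<boxtimes> (W \<boxtimes> U)) T"
    and eq: "\<And>x y z v w u. x \<in> carrier G \<Longrightarrow> y \<in> carrier G \<Longrightarrow> z \<in> carrier G \<Longrightarrow>
      v \<in> V x \<Longrightarrow> w \<in> W y \<Longrightarrow> u \<in> U z \<Longrightarrow>
      fn f (pure_tensor v (pure_tensor w u)) = fn h (pure_tensor v (pure_tensor w u))"
  shows "f = h"
proof (rule tensor_hom_eqI[OF f h])
  fix x c v t assume x: "x \<in> carrier G" "v \<in> V x" and c: "c \<in> carrier G" "t \<in> (W \<boxtimes> U) c"
  obtain F where F: "lin F" "\<And>v. v \<in> total G (V \<boxtimes> (W \<boxtimes> U)) \<Longrightarrow> fn f v = F v"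
    using graded_hom_lin[OF f] by blast
  obtain K where K: "lin K" "\<And>v. v \<in> total G (V \<boxtimes> (W \<boxtimes> U)) \<Longrightarrow> fn h v = K v"
    using graded_hom_lin[OF h] by blast
  have "F (pure_tensor v t) = K (pure_tensor v t)"
    using c(2) lin_comp[OF lin_pure_right F(1)] lin_comp[OF lin_pure_right K(1)]
  proof (rule tensor_lin_eq)
    fix y z w u assume *: "y \<in> carrier G" "z \<in> carrier G" "y \<otimes> z = c" "w \<in> W y" "u \<in> U z"
    then have "pure_tensor v (pure_tensor w u) \<in> total G (V \<boxtimes> (W \<boxtimes> U))"
      using x by (blast intro: pure_total total_component)
    with eq[OF x(1) *(1,2) x(2) *(4,5)] F(2) K(2)
    show "F (pure_tensor v (pure_tensor w u)) = K (pure_tensor v (pure_tensor w u))"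
      by simp
  qed
  moreover have "pure_tensor v t \<in> total G (V \<boxtimes> (W \<boxtimes> U))"
    using c x by (blast intro: pure_total total_component)
  ultimately show "fn f (pure_tensor v t) = fn h (pure_tensor v t)"
    using F(2) K(2) by simp
qed

lemma tensor_lin_arrow:
  assumes V: "V \<in> spaces" and W: "W \<in> spaces" and U: "U \<in> spaces" and f: "lin f"
    and m: "\<And>x y v w. x \<in> carrier G \<Longrightarrow> y \<in> carrier G \<Longrightarrow> v \<in> V x \<Longrightarrow> w \<in> W y \<Longrightarrow>
      f (pure_tensor v w) \<in> U (x \<otimes> y)"
  shows "lin_arrow G (V \<boxtimes> W) U f \<in> hom (V \<boxtimes> W) U"
proof (rule lin_arrow_hom[OF tensor_space[OF V W] U f])
  fix z t assume "z \<in> carrier G" "t \<in> (V \<boxtimes> W) z"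
  then show "f t \<in> U z"
    by (rule_tac tensor_lin_mem[OF _ f graded_space_subspace[OF U]]) (auto dest: m)
qed

lemma vec_cat_simps [simp]:
  "Obj (vec_cat G \<omega>) = spaces" "Arr (vec_cat G \<omega>) = graded_arrows G"
  "Dom (vec_cat G \<omega>) = src" "Cod (vec_cat G \<omega>) = trg"
  "tens_obj (vec_cat G \<omega>) = graded_tensor G" "unit_obj (vec_cat G \<omega>) = graded_unit G"
  by (simp_all add: vec_cat_def)

lemma vec_cat_Hom [simp]: "Hom (vec_cat G \<omega>) = hom"
  by (auto simp: Hom_def graded_hom_def fun_eq_iff)

lemma hom_arrow: "f \<in> graded_arrows G \<Longrightarrow> f \<in> hom (src f) (trg f)"
  by (simp add: graded_hom_def)

lemma idn_hom: "V \<in> spaces \<Longrightarrow> idn V \<in> hom V V"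
  using lin_arrow_hom[OF _ _ lin_id, of V G V] by (simp add: vec_cat_def lin_arrow_def)

lemma idn_apply: "v \<in> total G V \<Longrightarrow> fn (idn V) v = v"
  by (simp add: vec_cat_def)

lemma cc_hom:
  assumes f: "f \<in> hom U V" and h: "h \<in> hom V W"
  shows "h \<odot> f \<in> hom U W"
proof -
  have "fn h (fn f v) \<in> total G W" if "v \<in> total G U" for v
    using graded_homD(6)[OF h] graded_homD(6)[OF f] that by blast
  then show ?thesis
    using graded_homD(1-4)[OF f] graded_homD(1-4)[OF h] graded_homD(6)[OF f]
      graded_homD(7)[OF f] graded_homD(7)[OF h]
    unfolding graded_hom_def graded_arrows_def
    by (auto simp: vec_cat_def compose_def graded_hom_add[OF f] graded_hom_add[OF h]
        graded_hom_scale[OF f] graded_hom_scale[OF h] vec.subspace_add[OF subspace_total]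
        vec.subspace_scale[OF subspace_total] total_component)
qed

lemma cc_apply: "f \<in> hom U V \<Longrightarrow> v \<in> total G U \<Longrightarrow> fn (h \<odot> f) v = fn h (fn f v)"
  by (simp add: vec_cat_def compose_def graded_homD(1))

lemma cat_vec_cat: "cat (vec_cat G \<omega>)"
proof (unfold_locales, unfold vec_cat_simps vec_cat_Hom)
  fix f X Y assume f: "f \<in> hom X Y"
  show "idn Y \<odot> f = f"
    by (rule graded_hom_eqI[OF cc_hom[OF f idn_hom] f])
      (use f in \<open>auto simp: graded_homD cc_apply idn_apply total_component\<close>)
  show "f \<odot> idn X = f"
    by (rule graded_hom_eqI[OF cc_hom[OF idn_hom f] f])
      (use f in \<open>auto simp: graded_homD cc_apply[OF idn_hom] idn_apply total_component\<close>)
next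
  fix f W X h Y k Z assume f: "f \<in> hom W X" and h: "h \<in> hom X Y" and k: "k \<in> hom Y Z"
  show "(k \<odot> h) \<odot> f = k \<odot> h \<odot> f"
    by (rule graded_hom_eqI[OF cc_hom[OF f cc_hom[OF h k]] cc_hom[OF cc_hom[OF f h] k]])
      (simp add: total_component cc_apply[OF f] cc_apply[OF h] cc_apply[OF cc_hom[OF f h]]
          graded_homD(6)[OF f])
qed (auto simp: graded_arrows_def intro: idn_hom cc_hom)

end

section \<open>Explicit form of tensor products of maps, associator and unit constraints\<close>

abbreviation ev :: "'g \<Rightarrow> ('g, 'k::field) vec" where
  "ev h \<equiv> basis_vec (Elem_label h)"

abbreviation uv :: "('g, 'k::field) vec" where
  "uv \<equiv> basis_vec Unit_label"

text \<open>Since the vectors \<open>ev h\<close> span the algebra, an action map is determined by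
  these operators; the module axioms are restated in terms of them.\<close>

definition mact ::
  "('g, 'k::field) graded_arrow \<Rightarrow> 'g \<Rightarrow> ('g, 'k) vec \<Rightarrow> ('g, 'k) vec" where
  "mact a h v = fn a (pure_tensor (ev h) v)"

context pointed
begin

text \<open>The definite description is met by \<open>tmap\<close> of linear extensions of the two
  maps; it has at most one solution because pure tensors span the product.\<close>

lemma tens:
  assumes f: "f \<in> hom V V'" and h: "h \<in> hom W W'"
  shows tens_hom: "f \<otimes>\<otimes> h \<in> hom (V \<boxtimes> W) (V' \<boxtimes> W')" (is ?thesis1)
    and tens_apply: "\<And>v w. v \<in> total G V \<Longrightarrow> w \<in> total G W \<Longrightarrow>
      fn (f \<otimes>\<otimes> h) (pure_tensor v w) = pure_tensor (fn f v) (fn h w)"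
proof -
  note f' = graded_homD[OF f] and h' = graded_homD[OF h]
  let ?P = "\<lambda>t. t \<in> hom (src f \<boxtimes> src h) (trg f \<boxtimes> trg h) \<and>
       (\<forall>v\<in>total G (src f). \<forall>w\<in>total G (src h).
          fn t (pure_tensor v w) = pure_tensor (fn f v) (fn h w))"
  obtain F where F: "lin F" "\<And>v. v \<in> total G V \<Longrightarrow> fn f v = F v"
    using graded_hom_lin[OF f] by blast
  obtain K where K: "lin K" "\<And>v. v \<in> total G W \<Longrightarrow> fn h v = K v"
    using graded_hom_lin[OF h] by blast
  let ?t = "lin_arrow G (V \<boxtimes> W) (V' \<boxtimes> W') (tmap F K)"
  have "?t \<in> hom (V \<boxtimes> W) (V' \<boxtimes> W')"
  proof (rule tensor_lin_arrow[OF f'(3) h'(3) tensor_space[OF f'(4) h'(4)] lin_tmap[OF F(1) K(1)]])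
    fix x y v w assume *: "x \<in> carrier G" "y \<in> carrier G" "v \<in> V x" "w \<in> W y"
    show "tmap F K (pure_tensor v w) \<in> (V' \<boxtimes> W') (x \<otimes> y)"
      unfolding tmap_pure[OF F(1) K(1)]
      using tensor_component[where V = V' and W = W', OF *(1,2) f'(7)[OF *(1,3)] h'(7)[OF *(2,4)]]
        F(2)[OF total_component[where V = V, OF *(1,3)]]
            K(2)[OF total_component[where V = W, OF *(2,4)]]
      by simp
  qed
  then have P: "?P ?t"
    using f' h' F K by (simp add: lin_arrow_apply pure_total tmap_pure)
  have eq: "f \<otimes>\<otimes> h = (THE t. ?P t)"
    by (simp add: vec_cat_def)
  have the: "?P (THE t. ?P t)"
  proof (rule theI[of ?P, OF P])
    fix t assume t: "?P t"
    show "t = ?t"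
      by (rule tensor_hom_eqI[of t "src f" "src h" "trg f \<boxtimes> trg h"])
        (use t P in \<open>auto simp: total_component\<close>)
  qed
  have "?P (f \<otimes>\<otimes> h)"
    by (rule ssubst[where P = ?P, OF eq the])
  with f'(1,2) h'(1,2) show ?thesis1 and
    "\<And>v w. v \<in> total G V \<Longrightarrow> w \<in> total G W \<Longrightarrow>
      fn (f \<otimes>\<otimes> h) (pure_tensor v w) = pure_tensor (fn f v) (fn h w)"
    by simp_all
qed

lemma sum_triple_delta:
  assumes "x \<in> carrier G" and "y \<in> carrier G" and "z \<in> carrier G"
    and "\<And>p. p \<in> carrier G \<times> carrier G \<times> carrier G \<Longrightarrow> F p = (if p = (x, y, z) then c else 0)"
  shows "(\<Sum>p\<in>carrier G \<times> carrier G \<times> carrier G. F p) = (c :: 'b :: comm_monoid_add)"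
proof -
  have "(\<Sum>p\<in>carrier G \<times> carrier G \<times> carrier G. F p)
      = (\<Sum>p\<in>carrier G \<times> carrier G \<times> carrier G. if p = (x, y, z) then c else 0)"
    by (rule sum.cong[OF refl assms(4)])
  also have "\<dots> = c"
    using assms finite_carrier by simp
  finally show ?thesis .
qed

text \<open>The scalar of the associator depends on the three degrees, so the map is a sum over
  triples of degrees of rebracketings after projections, weighted by that scalar. The same
  construction with reciprocal scalars and the opposite rebracketing is a two-sided inverse, which
  evaluates \<open>inv_arrow\<close>.\<close>

lemma asc:
  assumes U: "U \<in> spaces" and V: "V \<in> spaces" and W: "W \<in> spaces"
  shows asc_hom: "asc U V W \<in> hom (U \<boxtimes> V \<boxtimes> W) (U \<boxtimes> (V \<boxtimes> W))" (is ?thesis1)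
    and asc_apply: "\<And>x y z u v w. x \<in> carrier G \<Longrightarrow> y \<in> carrier G \<Longrightarrow> z \<in> carrier G \<Longrightarrow>
      u \<in> U x \<Longrightarrow> v \<in> V y \<Longrightarrow> w \<in> W z \<Longrightarrow>
      fn (asc U V W) (pure_tensor (pure_tensor u v) w) =
        scale (inverse (\<omega> x y z)) (pure_tensor u (pure_tensor v w))"
    and asc'_hom: "asc' U V W \<in> hom (U \<boxtimes> (V \<boxtimes> W)) (U \<boxtimes> V \<boxtimes> W)" (is ?thesis2)
    and asc'_apply: "\<And>x y z u v w. x \<in> carrier G \<Longrightarrow> y \<in> carrier G \<Longrightarrow> z \<in> carrier G \<Longrightarrow>
      u \<in> U x \<Longrightarrow> v \<in> V y \<Longrightarrow> w \<in> W z \<Longrightarrow>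
      fn (asc' U V W) (pure_tensor u (pure_tensor v w)) =
        scale (\<omega> x y z) (pure_tensor (pure_tensor u v) w)"
    and asc_inverse: "inverse_arrows (vec_cat G \<omega>) (asc U V W) (asc' U V W)" (is ?thesis3)
proof -
  interpret cat "vec_cat G \<omega>" by (rule cat_vec_cat)
  let ?C = "carrier G \<times> carrier G \<times> carrier G"
  let ?L = "U \<boxtimes> V \<boxtimes> W" and ?R = "U \<boxtimes> (V \<boxtimes> W)"
  note UV = tensor_space[OF U V] and VW = tensor_space[OF V W]
  note L = tensor_space[OF UV W] and R = tensor_space[OF U VW]
  define F where "F t = (\<Sum>p\<in>?C. scale (inverse (\<omega> (fst p) (fst (snd p)) (snd (snd p))))
    (reassoc (tmap (tmap (gproj G U (fst p)) (gproj G V (fst (snd p)))) (gproj G W (snd (snd p)))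
        t)))" for t
  define K where "K t = (\<Sum>p\<in>?C. scale (\<omega> (fst p) (fst (snd p)) (snd (snd p)))
    (reassoc' (tmap (gproj G U (fst p)) (tmap (gproj G V (fst (snd p))) (gproj G W (snd (snd p))))
        t)))" for t
  have linF: "lin F" unfolding F_def
    by (intro lin_sum_fun lin_scale_fun lin_comp[OF _ lin_reassoc] lin_tmap gproj_lin U V W) auto
  have linK: "lin K" unfolding K_def
    by (intro lin_sum_fun lin_scale_fun lin_comp[OF _ lin_reassoc'] lin_tmap gproj_lin U V W) auto
  have Fp: "F (pure_tensor (pure_tensor u v) w) =
      scale (inverse (\<omega> x y z)) (pure_tensor u (pure_tensor v w))"
    if "x \<in> carrier G" "y \<in> carrier G" "z \<in> carrier G" "u \<in> U x" "v \<in> V y" "w \<in> W z" for x y z u v w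
    unfolding F_def
    by (rule sum_triple_delta[OF that(1-3)])
      (use that U V W in \<open>auto simp: tmap_pure lin_tmap reassoc_pure gproj_comp
          lin_zero[OF lin_reassoc]\<close>)
  have Kp: "K (pure_tensor u (pure_tensor v w)) =
      scale (\<omega> x y z) (pure_tensor (pure_tensor u v) w)"
    if "x \<in> carrier G" "y \<in> carrier G" "z \<in> carrier G" "u \<in> U x" "v \<in> V y" "w \<in> W z" for x y z u v w
    unfolding K_def
    by (rule sum_triple_delta[OF that(1-3)])
      (use that U V W in \<open>auto simp: tmap_pure lin_tmap reassoc'_pure gproj_comp
          lin_zero[OF lin_reassoc']\<close>)
  have F_comp: "F t \<in> ?R c" if "c \<in> carrier G" "t \<in> ?L c" for c t
  proof (rule tensor_lin_mem[OF that(2) linF graded_space_subspace[OF R]])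
    fix d z s w assume d: "d \<in> carrier G" "z \<in> carrier G" "d \<otimes> z = c" "s \<in> (U \<boxtimes> V) d" "w \<in> W z"
    show "F (pure_tensor s w) \<in> ?R c"
    proof (rule tensor_lin_mem[OF d(4) lin_comp[OF lin_pure_left linF] graded_space_subspace[OF R]])
      fix x y u v assume *: "x \<in> carrier G" "y \<in> carrier G" "x \<otimes> y = d" "u \<in> U x" "v \<in> V y"
      have "pure_tensor u (pure_tensor v w) \<in> ?R (x \<otimes> (y \<otimes> z))"
        using * d by (intro tensor_component) auto
      moreover have "x \<otimes> (y \<otimes> z) = c"
        using * d by (simp add: m_assoc[symmetric])
      ultimately show "F (pure_tensor (pure_tensor u v) w) \<in> ?R c"
        using Fp[of x y z u v w] * d graded_space_subspace[OF R] by (simp add: vec.subspace_scale)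
    qed
  qed
  have K_comp: "K t \<in> ?L c" if "c \<in> carrier G" "t \<in> ?R c" for c t
  proof (rule tensor_lin_mem[OF that(2) linK graded_space_subspace[OF L]])
    fix x d u s assume d: "x \<in> carrier G" "d \<in> carrier G" "x \<otimes> d = c" "u \<in> U x" "s \<in> (V \<boxtimes> W) d"
    show "K (pure_tensor u s) \<in> ?L c"
    proof (rule tensor_lin_mem[OF d(5) lin_comp[OF lin_pure_right linK]
        graded_space_subspace[OF L]])
      fix y z v w assume *: "y \<in> carrier G" "z \<in> carrier G" "y \<otimes> z = d" "v \<in> V y" "w \<in> W z"
      have "pure_tensor (pure_tensor u v) w \<in> ?L (x \<otimes> y \<otimes> z)"
        using * d by (intro tensor_component) auto
      moreover have "x \<otimes> y \<otimes> z = c"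
        using * d by (simp add: m_assoc)
      ultimately show "K (pure_tensor u (pure_tensor v w)) \<in> ?L c"
        using Kp[of x y z u v w] * d graded_space_subspace[OF L] by (simp add: vec.subspace_scale)
    qed
  qed
  let ?P = "\<lambda>t. t \<in> hom ?L ?R \<and> (\<forall>x\<in>carrier G. \<forall>y\<in>carrier G. \<forall>z\<in>carrier G.
      \<forall>u\<in>U x. \<forall>v\<in>V y. \<forall>w\<in>W z. fn t (pure_tensor (pure_tensor u v) w) =
        scale (inverse (\<omega> x y z)) (pure_tensor u (pure_tensor v w)))"
  let ?t = "lin_arrow G ?L ?R F" and ?k = "lin_arrow G ?R ?L K"
  have t: "?t \<in> hom ?L ?R"
    by (rule lin_arrow_hom[OF L R linF F_comp])
  have k: "?k \<in> hom ?R ?L"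
    by (rule lin_arrow_hom[OF R L linK K_comp])
  have totL: "pure_tensor (pure_tensor u v) w \<in> total G ?L"
    and totR: "pure_tensor u (pure_tensor v w) \<in> total G ?R"
    if "x \<in> carrier G" "y \<in> carrier G" "z \<in> carrier G" "u \<in> U x" "v \<in> V y" "w \<in> W z" for x y z u v w
    using that by (auto intro!: pure_total intro: total_component)
  have P: "?P ?t"
    using t by (auto simp: lin_arrow_apply totL Fp)
  have the: "?P (THE t. ?P t)"
  proof (rule theI[of ?P, OF P])
    fix s assume s: "?P s"
    show "s = ?t"
      by (rule tensor3_hom_eqI[of s U V W ?R]) (use s P in auto)
  qed
  have eq: "asc U V W = (THE t. ?P t)"
    by (simp add: vec_cat_def)
  have Pa: "?P (asc U V W)"
    by (rule ssubst[where P = ?P, OF eq the])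
  then show 1: ?thesis1 and 2: "\<And>x y z u v w. x \<in> carrier G \<Longrightarrow> y \<in> carrier G \<Longrightarrow> z \<in> carrier G \<Longrightarrow>
      u \<in> U x \<Longrightarrow> v \<in> V y \<Longrightarrow> w \<in> W z \<Longrightarrow>
      fn (asc U V W) (pure_tensor (pure_tensor u v) w) =
        scale (inverse (\<omega> x y z)) (pure_tensor u (pure_tensor v w))"
    by blast+
  have kt: "?k \<odot> asc U V W = idn ?L"
  proof (rule tensor3_hom_eqI[OF cc_hom[OF 1 k] idn_hom[OF L]])
    fix x y z u v w
    assume *: "x \<in> carrier G" "y \<in> carrier G" "z \<in> carrier G" "u \<in> U x" "v \<in> V y" "w \<in> W z"
    show "fn (?k \<odot> asc U V W) (pure_tensor (pure_tensor u v) w)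
        = fn (idn ?L) (pure_tensor (pure_tensor u v) w)"
      using * by (simp add: cc_apply[OF 1 totL[OF *]] idn_apply[OF totL[OF *]] 2[OF *]
        graded_hom_scale[OF k totR[OF *]] lin_arrow_apply[OF totR[OF *]] Kp omega_nonzero)
  qed
  have tk: "asc U V W \<odot> ?k = idn ?R"
  proof (rule tensor3_hom_eqI'[OF cc_hom[OF k 1] idn_hom[OF R]])
    fix x y z u v w
    assume *: "x \<in> carrier G" "y \<in> carrier G" "z \<in> carrier G" "u \<in> U x" "v \<in> V y" "w \<in> W z"
    show "fn (asc U V W \<odot> ?k) (pure_tensor u (pure_tensor v w))
        = fn (idn ?R) (pure_tensor u (pure_tensor v w))"
      using * by (simp add: cc_apply[OF k totR[OF *]] idn_apply[OF totR[OF *]] 2[OF *]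
        graded_hom_scale[OF 1 totL[OF *]] lin_arrow_apply[OF totR[OF *]] Kp omega_nonzero)
  qed
  have inv: "inverse_arrows (vec_cat G \<omega>) (asc U V W) ?k"
    by (rule inverse_arrowsI[of _ ?L ?R]) (use 1 k kt tk in simp_all)
  have asc': "asc' U V W = ?k"
    by (rule inv_arrow_eq[OF inv])
  show ?thesis2 ?thesis3
    unfolding asc' by (fact k inv)+
  show "\<And>x y z u v w. x \<in> carrier G \<Longrightarrow> y \<in> carrier G \<Longrightarrow> z \<in> carrier G \<Longrightarrow>
      u \<in> U x \<Longrightarrow> v \<in> V y \<Longrightarrow> w \<in> W z \<Longrightarrow>
      fn (asc' U V W) (pure_tensor u (pure_tensor v w)) =
        scale (\<omega> x y z) (pure_tensor (pure_tensor u v) w)"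
    unfolding asc' using lin_arrow_apply[OF totR] Kp by simp
qed

lemma unit_space: "graded_unit G \<in> spaces"
proof (rule graded_spaceI[where B = "{uv}" and P = "\<lambda>x v. if x = \<one> then v else 0"])
  show "total G (graded_unit G) = vec.span {uv}"
  proof
    show "total G (graded_unit G) \<subseteq> vec.span {uv}"
      unfolding total_def
      by (intro vec.span_minimal vec.subspace_span) (auto simp: graded_unit_def vec.span_zero)
    show "vec.span {uv} \<subseteq> total G (graded_unit G)"
      unfolding total_def by (rule vec.span_mono) (auto simp: graded_unit_def vec.span_base)
  qed
  show "lin (\<lambda>v. if x = \<one> then v else (0 :: ('g, 'k) vec))" for x
    by (rule linI) auto
qed (auto simp: graded_unit_def finite_carrier vec.subspace_single_0)

lemma uv_total: "uv \<in> total G (graded_unit G)"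
  by (rule total_component[of \<one>]) (simp_all add: graded_unit_def vec.span_base)

lemma graded_unitE:
  assumes "u \<in> graded_unit G x"
  obtains c where "u = scale c uv" and "c = 0 \<or> x = \<one>"
proof (cases "x = \<one>")
  case True
  with assms that show ?thesis
    by (auto simp: graded_unit_def span_singleton_iff)
next
  case False
  with assms that[of 0] show ?thesis
    by (simp add: graded_unit_def)
qed

lemma lunit:
  assumes V: "V \<in> spaces"
  shows lunit_hom: "lunit (vec_cat G \<omega>) V \<in> hom (graded_unit G \<boxtimes> V) V" (is ?thesis1)
    and lunit_apply: "\<And>v. v \<in> total G V \<Longrightarrow> fn (lunit (vec_cat G \<omega>) V) (pure_tensor uv v) = v"
proof -
  let ?P = "\<lambda>t. t \<in> hom (graded_unit G \<boxtimes> V) V \<and> (\<forall>v\<in>total G V. fn t (pure_tensor uv v) = v)"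
  \<comment> \<open>Evaluation at \<open>Unit_label\<close> is the coefficient of \<open>uv\<close>
    in the left factor.\<close>
  let ?t = "lin_arrow G (graded_unit G \<boxtimes> V) V (slice Unit_label)"
  have "?t \<in> hom (graded_unit G \<boxtimes> V) V"
  proof (rule tensor_lin_arrow[OF unit_space V V lin_slice])
    fix x y and u v :: "('g, 'k) vec"
    assume *: "x \<in> carrier G" "y \<in> carrier G" "u \<in> graded_unit G x" "v \<in> V y"
    then show "slice Unit_label (pure_tensor u v) \<in> V (x \<otimes> y)"
      using graded_space_subspace[OF V]
      by (cases "x = \<one>") (auto simp: graded_unit_def slice_pure vec.subspace_scale vec.subspace_0
          lin_zero[OF lin_slice])
  qed
  then have P: "?P ?t"
    by (simp add: lin_arrow_apply pure_total uv_total slice_pure basis_vec_apply)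
  have the: "?P (THE t. ?P t)"
  proof (rule theI[of ?P, OF P])
    fix s assume s: "?P s"
    show "s = ?t"
    proof (rule tensor_hom_eqI[of s "graded_unit G" V V])
      fix x y and u v :: "('g, 'k) vec"
    assume *: "x \<in> carrier G" "y \<in> carrier G" "u \<in> graded_unit G x" "v \<in> V y"
      obtain c where c: "u = scale c uv"
        using *(3) by (rule graded_unitE)
      have v: "v \<in> total G V"
        using *(2,4) by (rule total_component)
      show "fn s (pure_tensor u v) = fn ?t (pure_tensor u v)"
        unfolding c pure_scale_left using s P v pure_total[OF uv_total v]
        by (simp add: graded_hom_scale[where G = G and V = "graded_unit G \<boxtimes> V" and W = V])
    qed (use s P in auto)
  qed
  have eq: "lunit (vec_cat G \<omega>) V = (THE t. ?P t)"
    by (simp add: vec_cat_def)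
  have "?P (lunit (vec_cat G \<omega>) V)"
    by (rule ssubst[where P = ?P, OF eq the])
  then show ?thesis1 and "\<And>v. v \<in> total G V \<Longrightarrow> fn (lunit (vec_cat G \<omega>) V) (pure_tensor uv v) = v"
    by blast+
qed

lemma runit:
  assumes V: "V \<in> spaces"
  shows runit_hom: "runit (vec_cat G \<omega>) V \<in> hom (V \<boxtimes> graded_unit G) V" (is ?thesis1)
    and runit_apply: "\<And>v. v \<in> total G V \<Longrightarrow> fn (runit (vec_cat G \<omega>) V) (pure_tensor v uv) = v"
proof -
  let ?P = "\<lambda>t. t \<in> hom (V \<boxtimes> graded_unit G) V \<and> (\<forall>v\<in>total G V. fn t (pure_tensor v uv) = v)"
  let ?t = "lin_arrow G (V \<boxtimes> graded_unit G) V (slice' Unit_label)"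
  have "?t \<in> hom (V \<boxtimes> graded_unit G) V"
  proof (rule tensor_lin_arrow[OF V unit_space V lin_slice'])
    fix y x and v u :: "('g, 'k) vec"
    assume *: "y \<in> carrier G" "x \<in> carrier G" "v \<in> V y" "u \<in> graded_unit G x"
    then show "slice' Unit_label (pure_tensor v u) \<in> V (y \<otimes> x)"
      using graded_space_subspace[OF V]
      by (cases "x = \<one>") (auto simp: graded_unit_def slice'_pure vec.subspace_scale vec.subspace_0
          lin_zero[OF lin_slice'])
  qed
  then have P: "?P ?t"
    by (simp add: lin_arrow_apply pure_total uv_total slice'_pure basis_vec_apply)
  have the: "?P (THE t. ?P t)"
  proof (rule theI[of ?P, OF P])
    fix s assume s: "?P s"
    show "s = ?t"
    proof (rule tensor_hom_eqI[of s V "graded_unit G" V])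
      fix y x and v u :: "('g, 'k) vec"
    assume *: "y \<in> carrier G" "x \<in> carrier G" "v \<in> V y" "u \<in> graded_unit G x"
      obtain c where c: "u = scale c uv"
        using *(4) by (rule graded_unitE)
      have v: "v \<in> total G V"
        using *(1,3) by (rule total_component)
      show "fn s (pure_tensor v u) = fn ?t (pure_tensor v u)"
        unfolding c pure_scale_right using s P v pure_total[OF v uv_total]
        by (simp add: graded_hom_scale[where G = G and V = "V \<boxtimes> graded_unit G" and W = V])
    qed (use s P in auto)
  qed
  have eq: "runit (vec_cat G \<omega>) V = (THE t. ?P t)"
    by (simp add: vec_cat_def)
  have "?P (runit (vec_cat G \<omega>) V)"
    by (rule ssubst[where P = ?P, OF eq the])
  then show ?thesis1 and "\<And>v. v \<in> total G V \<Longrightarrow> fn (runit (vec_cat G \<omega>) V) (pure_tensor v uv) = v"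
    by blast+
qed

end

section \<open>Modules over twisted group algebras\<close>

context pointed
begin

lemma twistedE:
  assumes "u \<in> twisted_space H x"
  obtains c where "u = scale c (ev x)" and "x \<in> H" | "u = 0" and "x \<notin> H"
  using assms by (cases "x \<in> H") (auto simp: twisted_space_def span_singleton_iff)

lemma ev_mem: "h \<in> H \<Longrightarrow> ev h \<in> twisted_space H h"
  by (simp add: twisted_space_def vec.span_base)

lemma ev_scale_mem: "h \<in> H \<Longrightarrow> scale c (ev h) \<in> twisted_space H h"
  by (simp add: twisted_space_def vec.span_base vec.span_scale)

lemma twisted_space:
  assumes H: "H \<subseteq> carrier G"
  shows "twisted_space H \<in> spaces"
proof (rule graded_spaceI[where B = "ev ` H" and P = "\<lambda>x v. scale (v (Elem_label x)) (ev x)"])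
  show "total G (twisted_space H) = vec.span (ev ` H :: ('g, 'k) vec set)"
  proof
    have "twisted_space H x \<subseteq> vec.span (ev ` H :: ('g, 'k) vec set)" for x
    proof
      fix v :: "('g, 'k) vec" assume "v \<in> twisted_space H x"
      then show "v \<in> vec.span (ev ` H)"
      proof (cases rule: twistedE)
        case (1 c)
        then show ?thesis
          by (simp add: vec.span_scale vec.span_base)
      next
        case 2
        then show ?thesis
          by (simp add: vec.span_zero)
      qed
    qed
    then show "total G (twisted_space H) \<subseteq> vec.span (ev ` H :: ('g, 'k) vec set)"
      unfolding total_def by (intro vec.span_minimal vec.subspace_span UN_least)
    show "vec.span (ev ` H :: ('g, 'k) vec set) \<subseteq> total G (twisted_space H)"
      unfolding total_def
    proof (rule vec.span_mono, rule image_subsetI)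
      fix h assume h: "h \<in> H"
      show "ev h \<in> (\<Union>x\<in>carrier G. twisted_space H x)"
        by (rule UN_I[of h]) (use h H ev_mem[OF h] in auto)
    qed
  qed
  show "finite (ev ` H :: ('g, 'k) vec set)"
    using H finite_carrier finite_subset by blast
  show "lin (\<lambda>v :: ('g, 'k) vec. scale (v (Elem_label x)) (ev x))" for x
    by (rule lin_scale_left) (simp_all add: scale_def)
  show "scale (v (Elem_label x)) (ev x) = (if y = x then v else 0)"
    if "v \<in> twisted_space H y" for x y and v :: "('g, 'k) vec"
    using that
  proof (cases rule: twistedE)
    case (1 c)
    then show ?thesis
      by (auto simp: scale_def basis_vec_def fun_eq_iff)
  next
    case 2
    then show ?thesis
      by simp
  qed
  show "vec.subspace (twisted_space H x :: ('g, 'k) vec set)" for x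
    by (simp add: twisted_space_def)
qed (use H in \<open>auto simp: twisted_space_def finite_carrier\<close>)

lemma ev_total: "H \<subseteq> carrier G \<Longrightarrow> h \<in> H \<Longrightarrow> ev h \<in> total G (twisted_space H)"
  by (rule total_component[of h]) (auto simp: ev_mem)

lemma twisted_hom_eqI:
  assumes f: "f \<in> hom (twisted_space H) W" and k: "k \<in> hom (twisted_space H) W"
    and H: "H \<subseteq> carrier G" and eq: "\<And>h. h \<in> H \<Longrightarrow> fn f (ev h) = fn k (ev h)"
  shows "f = k"
proof (rule graded_hom_eqI[OF f k])
  fix x and v :: "('g, 'k) vec" assume "v \<in> twisted_space H x"
  then show "fn f v = fn k v"
    by (cases rule: twistedE)
      (auto simp: graded_hom_zero[OF f] graded_hom_zero[OF k] graded_hom_scale[OF f]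
        graded_hom_scale[OF k] ev_total[OF H] eq)
qed

lemma action_eqI:
  assumes f: "f \<in> hom (twisted_space H \<boxtimes> M) W" and k: "k \<in> hom (twisted_space H \<boxtimes> M) W"
    and H: "H \<subseteq> carrier G"
    and eq: "\<And>h x v. h \<in> H \<Longrightarrow> x \<in> carrier G \<Longrightarrow> v \<in> M x \<Longrightarrow> mact f h v = mact k h v"
  shows "f = k"
proof (rule tensor_hom_eqI[OF f k])
  fix x y and u v :: "('g, 'k) vec"
  assume *: "x \<in> carrier G" "y \<in> carrier G" "u \<in> twisted_space H x" "v \<in> M y"
  have v: "v \<in> total G M"
    using *(2,4) by (rule total_component)
  from *(3) show "fn f (pure_tensor u v) = fn k (pure_tensor u v)"
  proof (cases rule: twistedE)
    case (1 c)
    have "pure_tensor (ev x) v \<in> total G (twisted_space H \<boxtimes> M)"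
      by (rule pure_total[OF ev_total[OF H 1(2)] v])
    then show ?thesis
      unfolding 1(1) pure_scale_left
      using eq[OF 1(2) *(2,4)] by (simp add: graded_hom_scale[OF f] graded_hom_scale[OF k] mact_def)
  qed (simp add: graded_hom_zero[OF f] graded_hom_zero[OF k])
qed

lemma twisted3_hom_eqI:
  assumes f: "f \<in> hom (twisted_space H \<boxtimes> twisted_space H \<boxtimes> M) W"
    and k: "k \<in> hom (twisted_space H \<boxtimes> twisted_space H \<boxtimes> M) W"
    and H: "H \<subseteq> carrier G"
    and eq: "\<And>h h' x v. h \<in> H \<Longrightarrow> h' \<in> H \<Longrightarrow> x \<in> carrier G \<Longrightarrow> v \<in> M x \<Longrightarrow>
      fn f (pure_tensor (pure_tensor (ev h) (ev h')) v)
          = fn k (pure_tensor (pure_tensor (ev h) (ev h')) v)"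
  shows "f = k"
proof (rule tensor3_hom_eqI[OF f k])
  fix x y z and u w v :: "('g, 'k) vec"
  assume *: "x \<in> carrier G" "y \<in> carrier G" "z \<in> carrier G"
    "u \<in> twisted_space H x" "w \<in> twisted_space H y" "v \<in> M z"
  have v: "v \<in> total G M"
    using *(3,6) by (rule total_component)
  from *(4) show "fn f (pure_tensor (pure_tensor u w) v) = fn k (pure_tensor (pure_tensor u w) v)"
  proof (cases rule: twistedE)
    case u: (1 c)
    from *(5) show ?thesis
    proof (cases rule: twistedE)
      case w: (1 d)
      have "pure_tensor (pure_tensor (ev x) (ev y)) v
          \<in> total G (twisted_space H \<boxtimes> twisted_space H \<boxtimes> M)"
        by (intro pure_total ev_total[OF H] v u w)
      then show ?thesis
        unfolding u(1) w(1) pure_scale_left pure_scale_right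
        using eq[OF u(2) w(2) *(3,6)] by (simp add: graded_hom_scale[OF f] graded_hom_scale[OF k])
    qed (simp add: graded_hom_zero[OF f] graded_hom_zero[OF k])
  qed (simp add: graded_hom_zero[OF f] graded_hom_zero[OF k])
qed

text \<open>Extracting the coefficient of \<open>ev h\<close> and applying \<open>\<rho> h\<close>
  makes sense on all tensors, so the sum over \<open>h\<close> is the required map. The construction
  of an action becomes that of one operator for each group element.\<close>

lemma action_exists:
  assumes H: "H \<subseteq> carrier G" and M: "M \<in> spaces" and W: "W \<in> spaces"
    and \<rho>: "\<And>h. h \<in> H \<Longrightarrow> lin (\<rho> h)"
      "\<And>h x v. h \<in> H \<Longrightarrow> x \<in> carrier G \<Longrightarrow> v \<in> M x \<Longrightarrow> \<rho> h v \<in> W (h \<otimes> x)"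
  shows "\<exists>a\<in>hom (twisted_space H \<boxtimes> M) W. \<forall>h\<in>H. \<forall>v\<in>total G M. mact a h v = \<rho> h v"
proof -
  define f where "f t = (\<Sum>h\<in>H. \<rho> h (slice (Elem_label h) t))" for t
  have fin: "finite H"
    using H finite_carrier finite_subset by blast
  have f: "lin f"
    unfolding f_def by (intro lin_sum_fun lin_comp[OF lin_slice] \<rho>)
  have fp: "f (pure_tensor (ev h) v) = \<rho> h v" if "h \<in> H" for h v
  proof -
    have "f (pure_tensor (ev h) v) = (\<Sum>k\<in>H. if k = h then \<rho> h v else 0)"
      unfolding f_def by (rule sum.cong[OF refl])
        (auto simp: slice_pure basis_vec_apply lin_zero[OF \<rho>(1)])
    then show ?thesis
      using that fin by simp
  qed
  have "lin_arrow G (twisted_space H \<boxtimes> M) W f \<in> hom (twisted_space H \<boxtimes> M) W"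
  proof (rule tensor_lin_arrow[OF twisted_space[OF H] M W f])
    fix x y and u v :: "('g, 'k) vec"
    assume *: "x \<in> carrier G" "y \<in> carrier G" "u \<in> twisted_space H x" "v \<in> M y"
    from *(3) show "f (pure_tensor u v) \<in> W (x \<otimes> y)"
    proof (cases rule: twistedE)
      case (1 c)
      show ?thesis
        unfolding 1(1) pure_scale_left lin_scale[OF f] fp[OF 1(2)]
        by (rule vec.subspace_scale[OF graded_space_subspace[OF W] \<rho>(2)[OF 1(2) *(2,4)]])
    qed (simp add: lin_zero[OF f] vec.subspace_0[OF graded_space_subspace[OF W]])
  qed
  then show ?thesis
    by (rule bexI[rotated]) (auto simp: mact_def lin_arrow_apply pure_total ev_total[OF H] fp)
qed

lemma subgroup_carrier: "subgroup H G \<Longrightarrow> H \<subseteq> carrier G"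
  by (rule subgroup.subset)

lemma alg_obj [simp]: "alg_obj (twisted_algebra G H \<psi>) = twisted_space H"
  by (simp add: twisted_algebra_def)

lemma alg_mult:
  fixes \<psi> :: "'g \<Rightarrow> 'g \<Rightarrow> 'k"
  assumes H: "subgroup H G"
  shows alg_mult_hom: "alg_mult (twisted_algebra G H \<psi>) \<in>
      hom (twisted_space H \<boxtimes> twisted_space H) (twisted_space H)" (is ?thesis1)
    and alg_mult_apply: "\<And>h h'. h \<in> H \<Longrightarrow> h' \<in> H \<Longrightarrow>
      fn (alg_mult (twisted_algebra G H \<psi>)) (pure_tensor (ev h) (ev h'))
          = scale (\<psi> h h') (ev (h \<otimes> h'))"
proof -
  note Hc = subgroup_carrier[OF H]
  have fin: "finite H"
    using Hc finite_carrier finite_subset by blast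
  let ?A = "twisted_space H :: ('g, 'k) graded"
  let ?P = "\<lambda>t. t \<in> hom (?A \<boxtimes> ?A) ?A \<and>
    (\<forall>h\<in>H. \<forall>h'\<in>H. fn t (pure_tensor (ev h) (ev h')) = scale (\<psi> h h') (ev (h \<otimes> h')))"
  \<comment> \<open>Left multiplication by the basis vector of degree \<open>h\<close>, so that the
    product is obtained as an action of the algebra on itself.\<close>
  define \<rho> :: "'g \<Rightarrow> ('g, 'k) vec \<Rightarrow> ('g, 'k) vec"
    where "\<rho> h v = (\<Sum>k\<in>H. scale (\<psi> h k * v (Elem_label k)) (ev (h \<otimes> k)))" for h v
  have \<rho>1: "lin (\<rho> h)" for h
    unfolding \<rho>_def by (intro lin_sum_fun lin_scale_left) (simp_all add: scale_def distrib_left)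
  have \<rho>2: "\<rho> h (ev k) = scale (\<psi> h k) (ev (h \<otimes> k))" if "k \<in> H" for h k
  proof -
    have "\<rho> h (ev k) = (\<Sum>j\<in>H. if j = k then scale (\<psi> h k) (ev (h \<otimes> k)) else 0)"
      unfolding \<rho>_def by (rule sum.cong) (auto simp: basis_vec_apply)
    then show ?thesis
      using that fin by simp
  qed
  have \<rho>3: "\<rho> h v \<in> ?A (h \<otimes> x)" if "h \<in> H" "x \<in> carrier G" "v \<in> ?A x" for h x v
    using that(3)
  proof (cases rule: twistedE)
    case (1 c)
    have hx: "h \<otimes> x \<in> H"
      using H that(1) 1(2) by (rule subgroup.m_closed)
    show ?thesis
      unfolding 1(1) lin_scale[OF \<rho>1] \<rho>2[OF 1(2)] vec.scale_scale by (rule ev_scale_mem[OF hx])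
  next
    case 2
    then show ?thesis
      using vec.subspace_0[OF graded_space_subspace[OF twisted_space[OF Hc]]] lin_zero[OF \<rho>1]
          by simp
  qed
  obtain t where t: "t \<in> hom (?A \<boxtimes> ?A) ?A" "\<forall>h\<in>H. \<forall>v\<in>total G ?A. mact t h v = \<rho> h v"
    using action_exists[OF Hc twisted_space[OF Hc] twisted_space[OF Hc] \<rho>1 \<rho>3] by blast
  then have P: "?P t"
    by (auto simp: mact_def ev_total[OF Hc] \<rho>2)
  have the: "?P (THE t. ?P t)"
  proof (rule theI[of ?P, OF P])
    fix s assume s: "?P s"
    have s': "s \<in> hom (?A \<boxtimes> ?A) ?A" using s by blast
    show "s = t"
    proof (rule action_eqI[OF s' t(1) Hc])
      fix h x v assume h: "h \<in> H" and v: "v \<in> ?A x"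
      from v show "mact s h v = mact t h v"
      proof (cases rule: twistedE)
        case (1 c)
        have tot: "pure_tensor (ev h) (ev x) \<in> total G (?A \<boxtimes> ?A)"
          by (intro pure_total ev_total[OF Hc] h 1)
        show ?thesis
          unfolding 1(1) mact_def pure_scale_right graded_hom_scale[OF s' tot]
              graded_hom_scale[OF t(1) tot]
          using s P h 1(2) by simp
      qed (simp add: mact_def graded_hom_zero[OF s'] graded_hom_zero[OF t(1)])
    qed
  qed
  have eq: "alg_mult (twisted_algebra G H \<psi>) = (THE t. ?P t)"
    by (simp add: twisted_algebra_def)
  have "?P (alg_mult (twisted_algebra G H \<psi>))"
    by (rule ssubst[where P = ?P, OF eq the])
  then show ?thesis1 and "\<And>h h'. h \<in> H \<Longrightarrow> h' \<in> H \<Longrightarrow>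
      fn (alg_mult (twisted_algebra G H \<psi>)) (pure_tensor (ev h) (ev h'))
          = scale (\<psi> h h') (ev (h \<otimes> h'))"
    by blast+
qed

lemma alg_unit:
  fixes \<psi> :: "'g \<Rightarrow> 'g \<Rightarrow> 'k"
  assumes H: "subgroup H G"
  shows alg_unit_hom: "alg_unit (twisted_algebra G H \<psi>) \<in> hom (graded_unit G) (twisted_space H)"
      (is ?thesis1)
    and alg_unit_apply: "fn (alg_unit (twisted_algebra G H \<psi>)) uv = ev \<one>" (is ?thesis2)
proof -
  note Hc = subgroup_carrier[OF H] and H1 = subgroup.one_closed[OF H]
  let ?A = "twisted_space H :: ('g, 'k) graded"
  let ?P = "\<lambda>t. t \<in> hom (graded_unit G) ?A \<and> fn t uv = ev \<one>"
  define f :: "('g, 'k) vec \<Rightarrow> ('g, 'k) vec" where "f v = scale (v Unit_label) (ev \<one>)" for v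
  have f: "lin f"
    unfolding f_def by (rule lin_scale_left) (simp_all add: scale_def)
  have fu: "f uv = ev \<one>"
    by (simp add: f_def basis_vec_apply)
  let ?t = "lin_arrow G (graded_unit G) ?A f"
  have t: "?t \<in> hom (graded_unit G) ?A"
  proof (rule lin_arrow_hom[OF unit_space twisted_space[OF Hc] f])
    fix x and v :: "('g, 'k) vec" assume "v \<in> graded_unit G x"
    then obtain c where c: "v = scale c uv" "c = 0 \<or> x = \<one>"
      by (rule graded_unitE)
    have fv: "f v = scale c (ev \<one>)"
      unfolding c(1) lin_scale[OF f] fu ..
    show "f v \<in> ?A x"
      using c(2) ev_scale_mem[OF H1, of c]
          vec.subspace_0[OF graded_space_subspace[OF twisted_space[OF Hc]]]
      unfolding fv by (cases "c = 0") auto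
  qed
  have P: "?P ?t"
    using t by (simp add: lin_arrow_apply uv_total fu)
  have the: "?P (THE t. ?P t)"
  proof (rule theI[of ?P, OF P])
    fix s assume s: "?P s"
    show "s = ?t"
    proof (rule graded_hom_eqI[where f = s and V = "graded_unit G" and W = ?A])
      fix x and v :: "('g, 'k) vec" assume "v \<in> graded_unit G x"
      then obtain c where c: "v = scale c uv"
        by (rule graded_unitE)
      from s have s': "s \<in> hom (graded_unit G) ?A" by blast
      show "fn s v = fn ?t v"
        unfolding c graded_hom_scale[OF s' uv_total] graded_hom_scale[OF t uv_total] using s P
            by simp
    qed (use s P in auto)
  qed
  have eq: "alg_unit (twisted_algebra G H \<psi>) = (THE t. ?P t)"
    by (simp add: twisted_algebra_def)
  have "?P (alg_unit (twisted_algebra G H \<psi>))"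
    by (rule ssubst[where P = ?P, OF eq the])
  then show ?thesis1 ?thesis2
    by blast+
qed

section \<open>Module axioms as laws for the operators of group elements\<close>

abbreviation modules where
  "modules H \<psi> \<equiv> left_modules (vec_cat G \<omega>) (twisted_algebra G H \<psi>)"

lemma mact_mem:
  assumes a: "a \<in> hom (twisted_space H \<boxtimes> M) W" and H: "H \<subseteq> carrier G"
    and h: "h \<in> H" and x: "x \<in> carrier G" "v \<in> M x"
  shows "mact a h v \<in> W (h \<otimes> x)"
  unfolding mact_def
  by (rule graded_homD(7)[OF a]) (use assms in \<open>auto intro!: tensor_component ev_mem\<close>)

text \<open>An operator is linear only on the total space of \<open>M\<close>; the extension in
  \<open>mact_extend\<close> makes it accessible to arguments on spanning sets of tensor
  products.\<close>

lemma mact_lin: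
  assumes a: "a \<in> hom (twisted_space H \<boxtimes> M) W" and H: "H \<subseteq> carrier G" and h: "h \<in> H"
  shows mact_total: "v \<in> total G M \<Longrightarrow> mact a h v \<in> total G W"
    and mact_scale: "v \<in> total G M \<Longrightarrow> mact a h (scale c v) = scale c (mact a h v)"
    and mact_zero: "mact a h 0 = 0"
    and mact_extend: "\<exists>\<rho>. lin \<rho> \<and> (\<forall>v\<in>total G M. mact a h v = \<rho> v)"
proof -
  obtain F where F: "lin F" "\<And>v. v \<in> total G (twisted_space H \<boxtimes> M) \<Longrightarrow> fn a v = F v"
    using graded_hom_lin[OF a] by blast
  have p: "pure_tensor (ev h) v \<in> total G (twisted_space H \<boxtimes> M)" if "v \<in> total G M" for v
    by (rule pure_total[OF ev_total[OF H h] that])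
  show "mact a h v \<in> total G W" if "v \<in> total G M"
    unfolding mact_def by (rule graded_homD(6)[OF a p[OF that]])
  show "mact a h (scale c v) = scale c (mact a h v)" if "v \<in> total G M"
    unfolding mact_def pure_scale_right by (rule graded_hom_scale[OF a p[OF that]])
  show "mact a h 0 = 0"
    by (simp add: mact_def graded_hom_zero[OF a])
  show "\<exists>\<rho>. lin \<rho> \<and> (\<forall>v\<in>total G M. mact a h v = \<rho> v)"
    using F p lin_comp[OF lin_pure_right F(1)]
    by (intro exI[of _ "\<lambda>v. F (pure_tensor (ev h) v)"]) (auto simp: mact_def)
qed

text \<open>Evaluated at basis vectors and a homogeneous \<open>v\<close>, the associativity square
  compares \<open>\<psi> h h'\<close> with the inverse of \<open>\<omega> h h' x\<close> that comes
  from the associator; moving the latter across gives the twisted law. Linearity gives the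
  converse.\<close>

lemma modules_iff:
  assumes H: "subgroup H G"
  shows "(M, a) \<in> modules H \<psi> \<longleftrightarrow>
    M \<in> spaces \<and> a \<in> hom (twisted_space H \<boxtimes> M) M \<and>
    (\<forall>h\<in>H. \<forall>h'\<in>H. \<forall>x\<in>carrier G. \<forall>v\<in>M x.
      mact a h (mact a h' v) = scale (\<omega> h h' x * \<psi> h h') (mact a (h \<otimes> h') v)) \<and>
    (\<forall>x\<in>carrier G. \<forall>v\<in>M x. mact a \<one> v = v)"
proof (cases "M \<in> spaces \<and> a \<in> hom (twisted_space H \<boxtimes> M) M")
  case False
  then show ?thesis
    unfolding left_modules_def by auto
next
  case True
  note Hc = subgroup_carrier[OF H]
  let ?A = "twisted_algebra G H \<psi>" and ?T = "twisted_space H :: ('g, 'k) graded"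
  from True have M: "M \<in> spaces" and a: "a \<in> hom (?T \<boxtimes> M) M"
    by auto
  note T = twisted_space[OF Hc]
  note m = alg_mult[OF H, where \<psi> = \<psi>] and u = alg_unit[OF H, where \<psi> = \<psi>]
  note mM = tens_hom[OF m(1) idn_hom[OF M]] and Ta = tens_hom[OF idn_hom[OF T] a]
    and uM = tens_hom[OF u(1) idn_hom[OF M]]
  have l: "a \<odot> (alg_mult ?A \<otimes>\<otimes> idn M) \<in> hom (?T \<boxtimes> ?T \<boxtimes> M) M"
    by (rule cc_hom[OF mM a])
  have r1: "idn ?T \<otimes>\<otimes> a \<odot> asc ?T ?T M \<in> hom (?T \<boxtimes> ?T \<boxtimes> M) (?T \<boxtimes> M)"
    by (rule cc_hom[OF asc_hom[OF T T M] Ta])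
  have r: "a \<odot> idn ?T \<otimes>\<otimes> a \<odot> asc ?T ?T M \<in> hom (?T \<boxtimes> ?T \<boxtimes> M) M"
    by (rule cc_hom[OF r1 a])
  have lv: "fn (a \<odot> (alg_mult ?A \<otimes>\<otimes> idn M)) (pure_tensor (pure_tensor (ev h) (ev h')) v)
      = scale (\<psi> h h') (mact a (h \<otimes> h') v)"
    and rv: "fn (a \<odot> idn ?T \<otimes>\<otimes> a \<odot> asc ?T ?T M) (pure_tensor (pure_tensor (ev h) (ev h')) v)
      = scale (inverse (\<omega> h h' x)) (mact a h (mact a h' v))"
    if h: "h \<in> H" "h' \<in> H" and x: "x \<in> carrier G" "v \<in> M x" for h h' x v
  proof -
    have v: "v \<in> total G M"
      using x by (rule total_component)
    note e = ev_total[OF Hc h(1)] ev_total[OF Hc h(2)]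
    have hh: "h \<otimes> h' \<in> H"
      using H h by (rule subgroup.m_closed)
    have t: "pure_tensor (pure_tensor (ev h) (ev h')) v \<in> total G (?T \<boxtimes> ?T \<boxtimes> M)"
      by (intro pure_total e v)
    have t': "pure_tensor (ev h) (pure_tensor (ev h') v) \<in> total G (?T \<boxtimes> (?T \<boxtimes> M))"
      by (intro pure_total e v)
    have t'': "pure_tensor (ev h) (mact a h' v) \<in> total G (?T \<boxtimes> M)"
      by (intro pure_total e mact_total[OF a Hc h(2) v])
    have p: "pure_tensor (ev h) (ev h') \<in> total G (?T \<boxtimes> ?T)"
      by (intro pure_total e)
    have p': "pure_tensor (ev (h \<otimes> h')) v \<in> total G (?T \<boxtimes> M)"
      by (intro pure_total ev_total[OF Hc hh] v)
    have p'': "pure_tensor (ev h') v \<in> total G (?T \<boxtimes> M)"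
      by (intro pure_total e v)
    show "fn (a \<odot> (alg_mult ?A \<otimes>\<otimes> idn M)) (pure_tensor (pure_tensor (ev h) (ev h')) v)
      = scale (\<psi> h h') (mact a (h \<otimes> h') v)"
      unfolding cc_apply[OF mM t] tens_apply[OF m(1) idn_hom[OF M] p v] m(2)[OF h] idn_apply[OF v]
        pure_scale_left graded_hom_scale[OF a p'] mact_def ..
    have hc: "h \<in> carrier G" "h' \<in> carrier G"
      using h Hc by auto
    show "fn (a \<odot> idn ?T \<otimes>\<otimes> a \<odot> asc ?T ?T M) (pure_tensor (pure_tensor (ev h) (ev h')) v)
      = scale (inverse (\<omega> h h' x)) (mact a h (mact a h' v))"
      unfolding cc_apply[OF r1 t] cc_apply[OF asc_hom[OF T T M] t]
        asc_apply[OF T T M hc x(1) ev_mem[OF h(1)] ev_mem[OF h(2)] x(2)]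
        graded_hom_scale[OF Ta t'] tens_apply[OF idn_hom[OF T] a e(1) p''] idn_apply[OF e(1)]
        mact_def[of a h' v, symmetric] graded_hom_scale[OF a t''] mact_def[of a h, symmetric] ..
  qed
  have iff1: "a \<odot> (alg_mult ?A \<otimes>\<otimes> idn M) = a \<odot> idn ?T \<otimes>\<otimes> a \<odot> asc ?T ?T M \<longleftrightarrow>
    (\<forall>h\<in>H. \<forall>h'\<in>H. \<forall>x\<in>carrier G. \<forall>v\<in>M x.
      mact a h (mact a h' v) = scale (\<omega> h h' x * \<psi> h h') (mact a (h \<otimes> h') v))" (is "?l = ?r \<longleftrightarrow> ?R")
  proof
    assume eq: "?l = ?r"
    show ?R
    proof (intro ballI)
      fix h h' x v assume *: "h \<in> H" "h' \<in> H" "x \<in> carrier G" "v \<in> M x"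
      have nz: "\<omega> h h' x \<noteq> 0"
        using * Hc by (intro omega_nonzero) auto
      have "scale (\<psi> h h') (mact a (h \<otimes> h') v)
          = scale (inverse (\<omega> h h' x)) (mact a h (mact a h' v))"
        using lv[OF *] rv[OF *] eq by simp
      then have "scale (\<omega> h h' x) (scale (\<psi> h h') (mact a (h \<otimes> h') v))
          = scale (\<omega> h h' x) (scale (inverse (\<omega> h h' x)) (mact a h (mact a h' v)))"
        by simp
      with nz show "mact a h (mact a h' v) = scale (\<omega> h h' x * \<psi> h h') (mact a (h \<otimes> h') v)"
        by simp
    qed
  next
    assume R: ?R
    show "?l = ?r"
    proof (rule twisted3_hom_eqI[OF l r Hc])
      fix h h' x v assume *: "h \<in> H" "h' \<in> H" "x \<in> carrier G" "v \<in> M x"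
      have nz: "\<omega> h h' x \<noteq> 0"
        using * Hc by (intro omega_nonzero) auto
      have "mact a h (mact a h' v) = scale (\<omega> h h' x * \<psi> h h') (mact a (h \<otimes> h') v)"
        using R * by blast
      with nz show "fn ?l (pure_tensor (pure_tensor (ev h) (ev h')) v)
          = fn ?r (pure_tensor (pure_tensor (ev h) (ev h')) v)"
        unfolding lv[OF *] rv[OF *] by (simp add: mult.assoc[symmetric])
    qed
  qed
  have uv_eq: "fn (a \<odot> (alg_unit ?A \<otimes>\<otimes> idn M)) (pure_tensor uv v) = mact a \<one> v"
      if v: "v \<in> total G M" for v
    unfolding cc_apply[OF uM pure_total[OF uv_total v]] tens_apply[OF u(1) idn_hom[OF M] uv_total v]
      u(2) idn_apply[OF v] mact_def ..
  have iff2: "a \<odot> (alg_unit ?A \<otimes>\<otimes> idn M) = lunit (vec_cat G \<omega>) M \<longleftrightarrow>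
    (\<forall>x\<in>carrier G. \<forall>v\<in>M x. mact a \<one> v = v)" (is "?l = ?r \<longleftrightarrow> ?R")
  proof
    assume eq: "?l = ?r"
    show ?R
    proof (intro ballI)
      fix x v assume "x \<in> carrier G" "v \<in> M x"
      then have v: "v \<in> total G M"
        by (rule total_component)
      show "mact a \<one> v = v"
        using uv_eq[OF v] lunit_apply[OF M v] unfolding eq by simp
    qed
  next
    assume R: ?R
    show "?l = ?r"
    proof (rule tensor_hom_eqI[OF cc_hom[OF uM a] lunit_hom[OF M]])
      fix x y and s v :: "('g, 'k) vec"
      assume *: "x \<in> carrier G" "y \<in> carrier G" "s \<in> graded_unit G x" "v \<in> M y"
      obtain c where c: "s = scale c uv"
        using *(3) by (rule graded_unitE)
      have v: "v \<in> total G M"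
        using *(2,4) by (rule total_component)
      note p = pure_total[OF uv_total v]
      show "fn ?l (pure_tensor s v) = fn ?r (pure_tensor s v)"
        unfolding c pure_scale_left graded_hom_scale[OF cc_hom[OF uM a] p]
          graded_hom_scale[OF lunit_hom[OF M] p] uv_eq[OF v] lunit_apply[OF M v]
        using R *(2,4) by simp
    qed
  qed
  show ?thesis
    unfolding left_modules_def mem_Collect_eq prod.case alg_obj vec_cat_simps vec_cat_Hom iff1
        iff2 ..
qed

lemma modulesD:
  assumes H: "subgroup H G" and Ma: "(M, a) \<in> modules H \<psi>"
  shows "M \<in> spaces" and "a \<in> hom (twisted_space H \<boxtimes> M) M"
    and "\<And>h h' x v. h \<in> H \<Longrightarrow> h' \<in> H \<Longrightarrow> x \<in> carrier G \<Longrightarrow> v \<in> M x \<Longrightarrow>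
      mact a h (mact a h' v) = scale (\<omega> h h' x * \<psi> h h') (mact a (h \<otimes> h') v)"
    and "\<And>x v. x \<in> carrier G \<Longrightarrow> v \<in> M x \<Longrightarrow> mact a \<one> v = v"
  using Ma unfolding modules_iff[OF H] by blast+

lemma module_arrows_iff:
  assumes H: "subgroup H G"
  shows "f \<in> left_module_arrows (vec_cat G \<omega>) (twisted_algebra G H \<psi>) \<longleftrightarrow>
    src f \<in> modules H \<psi> \<and> trg f \<in> modules H \<psi> \<and> fn f \<in> hom (fst (src f)) (fst (trg f)) \<and>
    (\<forall>h\<in>H. \<forall>x\<in>carrier G. \<forall>v\<in>fst (src f) x.
      fn (fn f) (mact (snd (src f)) h v) = mact (snd (trg f)) h (fn (fn f) v))"
proof (cases "src f \<in> modules H \<psi> \<and> trg f \<in> modules H \<psi> \<and> fn f \<in> hom (fst (src f)) (fst (trg f))")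
  case False
  then show ?thesis
    unfolding left_module_arrows_def by auto
next
  case True
  note Hc = subgroup_carrier[OF H]
  let ?T = "twisted_space H :: ('g, 'k) graded"
  obtain M a where Ma: "src f = (M, a)" by (cases "src f")
  obtain N b where Nb: "trg f = (N, b)" by (cases "trg f")
  from True have f: "fn f \<in> hom M N" and M: "(M, a) \<in> modules H \<psi>" and N: "(N, b) \<in> modules H \<psi>"
    by (simp_all add: Ma Nb)
  note a = modulesD(2)[OF H M] and b = modulesD(2)[OF H N]
  note Tf = tens_hom[OF idn_hom[OF twisted_space[OF Hc]] f]
  have lv: "mact (fn f \<odot> a) h v = fn (fn f) (mact a h v)"
    and rv: "mact (b \<odot> idn ?T \<otimes>\<otimes> fn f) h v = mact b h (fn (fn f) v)"
    if "h \<in> H" "x \<in> carrier G" "v \<in> M x" for h x v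
  proof -
    have v: "v \<in> total G M"
      using that(2,3) by (rule total_component)
    note e = ev_total[OF Hc that(1)] note p = pure_total[OF e v]
    show "mact (fn f \<odot> a) h v = fn (fn f) (mact a h v)"
      unfolding mact_def cc_apply[OF a p] ..
    show "mact (b \<odot> idn ?T \<otimes>\<otimes> fn f) h v = mact b h (fn (fn f) v)"
      unfolding mact_def cc_apply[OF Tf p] tens_apply[OF idn_hom[OF twisted_space[OF Hc]] f e v]
          idn_apply[OF e] ..
  qed
  have "fn f \<odot> a = b \<odot> idn ?T \<otimes>\<otimes> fn f \<longleftrightarrow>
      (\<forall>h\<in>H. \<forall>x\<in>carrier G. \<forall>v\<in>M x. fn (fn f) (mact a h v) = mact b h (fn (fn f) v))"
    (is "?l = ?r \<longleftrightarrow> ?R")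
  proof
    assume eq: "?l = ?r"
    then show ?R
      using lv rv by metis
  next
    assume R: ?R
    show "?l = ?r"
      by (rule action_eqI[OF cc_hom[OF a f] cc_hom[OF Tf b] Hc]) (use R lv rv in auto)
  qed
  with True show ?thesis
    unfolding left_module_arrows_def by (auto simp: Ma Nb)
qed

section \<open>The right action of graded spaces on modules\<close>

abbreviation mod_act where
  "mod_act H \<psi> \<equiv> left_module_act (vec_cat G \<omega>) (twisted_algebra G H \<psi>)"

lemma fst_mod_act [simp]: "fst (mod_act H \<psi> U X) = fst U \<boxtimes> X"
  by (simp add: left_module_act_def)

text \<open>The inverse associator in the action on the product contributes
  \<open>\<omega> h x y\<close>. The module law for the product is then the pentagon at
  \<open>h\<close>, \<open>h'\<close>, \<open>x\<close>, \<open>y\<close>, which trades the factor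
  for degree \<open>x\<close> against the one for degree \<open>x \<otimes> y\<close>.\<close>

lemma mod_act:
  assumes H: "subgroup H G" and U: "U \<in> modules H \<psi>" and X: "X \<in> spaces"
  shows mod_act_modules: "mod_act H \<psi> U X \<in> modules H \<psi>" (is ?thesis1)
    and mod_act_apply: "\<And>h x y v w. h \<in> H \<Longrightarrow> x \<in> carrier G \<Longrightarrow> y \<in> carrier G \<Longrightarrow> v \<in> fst U x \<Longrightarrow> w \<in> X y \<Longrightarrow>
      mact (snd (mod_act H \<psi> U X)) h (pure_tensor v w)
          = scale (\<omega> h x y) (pure_tensor (mact (snd U) h v) w)"
proof -
  obtain M a where Ma: "U = (M, a)" by (cases U)
  note m = modulesD[OF H U[unfolded Ma]]
  note Hc = subgroup_carrier[OF H]
  let ?T = "twisted_space H :: ('g, 'k) graded"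
  define b where "b = snd (mod_act H \<psi> U X)"
  have b_eq: "b = (a \<otimes>\<otimes> idn X) \<odot> asc' ?T M X"
    by (simp add: b_def left_module_act_def Ma)
  note T = twisted_space[OF Hc] and MX = tensor_space[OF m(1) X]
  note aX = tens_hom[OF m(2) idn_hom[OF X]] and as = asc'_hom[OF T m(1) X]
  have b: "b \<in> hom (?T \<boxtimes> (M \<boxtimes> X)) (M \<boxtimes> X)"
    unfolding b_eq by (rule cc_hom[OF as aX])
  have bv: "mact b h (pure_tensor v w) = scale (\<omega> h x y) (pure_tensor (mact a h v) w)"
    if *: "h \<in> H" "x \<in> carrier G" "y \<in> carrier G" "v \<in> M x" "w \<in> X y" for h x y v w
  proof -
    have v: "v \<in> total G M"
      using *(2,4) by (rule total_component)
    have w: "w \<in> total G X"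
      using *(3,5) by (rule total_component)
    note e = ev_total[OF Hc *(1)]
    have hc: "h \<in> carrier G" using * Hc by auto
    show ?thesis
      unfolding b_eq mact_def cc_apply[OF as pure_total[OF e pure_total[OF v w]]]
        asc'_apply[OF T m(1) X hc *(2,3) ev_mem[OF *(1)] *(4,5)]
        graded_hom_scale[OF aX pure_total[OF pure_total[OF e v] w]]
        tens_apply[OF m(2) idn_hom[OF X] pure_total[OF e v] w] idn_apply[OF w] ..
  qed
  then show "\<And>h x y v w. h \<in> H \<Longrightarrow> x \<in> carrier G \<Longrightarrow> y \<in> carrier G \<Longrightarrow> v \<in> fst U x \<Longrightarrow> w \<in> X y \<Longrightarrow>
      mact (snd (mod_act H \<psi> U X)) h (pure_tensor v w)
          = scale (\<omega> h x y) (pure_tensor (mact (snd U) h v) w)"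
    unfolding b_def[symmetric] by (simp add: Ma)
  have bb: "mact b h (mact b h' t) = scale (\<omega> h h' z * \<psi> h h') (mact b (h \<otimes> h') t)"
    if h: "h \<in> H" "h' \<in> H" and z: "z \<in> carrier G" and t: "t \<in> (M \<boxtimes> X) z" for h h' z t
  proof -
    have hc: "h \<in> carrier G" "h' \<in> carrier G" using h Hc by auto
    have hh: "h \<otimes> h' \<in> H"
      using H h by (rule subgroup.m_closed)
    obtain \<rho> where \<rho>: "lin \<rho>" "\<And>v. v \<in> total G (M \<boxtimes> X) \<Longrightarrow> mact b h v = \<rho> v"
      using mact_extend[OF b Hc h(1)] by blast
    obtain \<rho>' where \<rho>': "lin \<rho>'" "\<And>v. v \<in> total G (M \<boxtimes> X) \<Longrightarrow> mact b h' v = \<rho>' v"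
      using mact_extend[OF b Hc h(2)] by blast
    obtain \<tau> where \<tau>: "lin \<tau>" "\<And>v. v \<in> total G (M \<boxtimes> X) \<Longrightarrow> mact b (h \<otimes> h') v = \<tau> v"
      using mact_extend[OF b Hc hh] by blast
    have "\<rho> (\<rho>' t) = scale (\<omega> h h' z * \<psi> h h') (\<tau> t)"
      using t lin_comp[OF \<rho>'(1) \<rho>(1)] lin_scale_fun[OF \<tau>(1)]
    proof (rule tensor_lin_eq)
      fix x y v w assume *: "x \<in> carrier G" "y \<in> carrier G" "x \<otimes> y = z" "v \<in> M x" "w \<in> X y"
      have v: "v \<in> total G M"
        using *(1,4) by (rule total_component)
      have w: "w \<in> total G X"
        using *(2,5) by (rule total_component)
      note p = pure_total[OF v w]
      have h'v: "mact a h' v \<in> M (h' \<otimes> x)"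
        by (rule mact_mem[OF m(2) Hc h(2) *(1,4)])
      have p': "pure_tensor (mact a h' v) w \<in> total G (M \<boxtimes> X)"
        by (rule pure_total[OF mact_total[OF m(2) Hc h(2) v] w])
      have h'x: "h' \<otimes> x \<in> carrier G" using hc * by auto
      have "\<rho> (\<rho>' (pure_tensor v w)) = mact b h (mact b h' (pure_tensor v w))"
        using \<rho>(2)[OF mact_total[OF b Hc h(2) p]] \<rho>'(2)[OF p] by simp
      also have "\<dots> = scale (\<omega> h' x y * \<omega> h (h' \<otimes> x) y) (pure_tensor (mact a h (mact a h' v)) w)"
        unfolding bv[OF h(2) *(1,2,4,5)] mact_scale[OF b Hc h(1) p']
          bv[OF h(1) h'x *(2) h'v *(5)] vec.scale_scale ..
      also have "\<dots> = scale (\<omega> h' x y * \<omega> h (h' \<otimes> x) y * \<omega> h h' x * \<psi> h h')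
          (pure_tensor (mact a (h \<otimes> h') v) w)"
        unfolding m(3)[OF h *(1,4)] pure_scale_left vec.scale_scale by (simp add: mult.assoc)
      also have "\<dots> = scale (\<omega> (h \<otimes> h') x y * \<omega> h h' z * \<psi> h h') (pure_tensor (mact a (h \<otimes> h') v) w)"
        using pentagon[OF hc *(1,2)] *(3) by simp
      also have "\<dots> = scale (\<omega> h h' z * \<psi> h h') (\<tau> (pure_tensor v w))"
        unfolding \<tau>(2)[OF p, symmetric] bv[OF hh *(1,2,4,5)] vec.scale_scale by (simp add: ac_simps)
      finally show "\<rho> (\<rho>' (pure_tensor v w)) = scale (\<omega> h h' z * \<psi> h h') (\<tau> (pure_tensor v w))" .
    qed
    moreover have tt: "t \<in> total G (M \<boxtimes> X)"
      using z t by (rule total_component)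
    ultimately show ?thesis
      using \<rho>(2)[OF mact_total[OF b Hc h(2) tt]] \<rho>'(2)[OF tt] \<tau>(2)[OF tt] by simp
  qed
  have b1: "mact b \<one> t = t" if z: "z \<in> carrier G" and t: "t \<in> (M \<boxtimes> X) z" for z t
  proof -
    note H1 = subgroup.one_closed[OF H]
    obtain \<rho> where \<rho>: "lin \<rho>" "\<And>v. v \<in> total G (M \<boxtimes> X) \<Longrightarrow> mact b \<one> v = \<rho> v"
      using mact_extend[OF b Hc H1] by blast
    have "\<rho> t = t"
      using t \<rho>(1) lin_id
    proof (rule tensor_lin_eq)
      fix x y v w assume *: "x \<in> carrier G" "y \<in> carrier G" "x \<otimes> y = z" "v \<in> M x" "w \<in> X y"
      have "pure_tensor v w \<in> total G (M \<boxtimes> X)"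
        using * by (blast intro: pure_total total_component)
      then show "\<rho> (pure_tensor v w) = pure_tensor v w"
        using \<rho>(2) bv[OF H1 *(1,2,4,5)] m(4)[OF *(1,4)] * by simp
    qed
    moreover have "t \<in> total G (M \<boxtimes> X)"
      using z t by (rule total_component)
    ultimately show ?thesis
      using \<rho>(2) by simp
  qed
  have "(M \<boxtimes> X, b) \<in> modules H \<psi>"
    unfolding modules_iff[OF H] using MX b bb b1 by blast
  moreover have "mod_act H \<psi> U X = (M \<boxtimes> X, b)"
    by (rule prod_eqI) (simp_all add: Ma b_def)
  ultimately show ?thesis1
    by simp
qed

end

lemma arrow_eqI: "src f = src h \<Longrightarrow> trg f = trg h \<Longrightarrow> fn f = fn h \<Longrightarrow> f = h"
  by (simp add: arrow.expand)

text \<open>Identity arrows serve as unit and counit.\<close>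

lemma strict_equivalence:
  assumes "cat C" and "cat D" and F: "is_functor C D Fo Fa" and K: "is_functor D C Ko Ka"
    and KF: "\<And>X. X \<in> Obj C \<Longrightarrow> Ko (Fo X) = X" "\<And>f. f \<in> Arr C \<Longrightarrow> Ka (Fa f) = f"
    and FK: "\<And>X. X \<in> Obj D \<Longrightarrow> Fo (Ko X) = X" "\<And>f. f \<in> Arr D \<Longrightarrow> Fa (Ka f) = f"
  shows "is_equivalence C D Fo Fa"
proof -
  interpret C: cat C by fact
  interpret D: cat D by fact
  have isoC: "iso_arrow C (Ident C X)" if "X \<in> Obj C" for X
    unfolding iso_arrow_def
    using C.inverse_arrowsI[OF C.ident_hom[OF that] C.ident_hom[OF that]]
        C.ident_left[OF C.ident_hom[OF that]]
    by blast
  have isoD: "iso_arrow D (Ident D X)" if "X \<in> Obj D" for X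
    unfolding iso_arrow_def
    using D.inverse_arrowsI[OF D.ident_hom[OF that] D.ident_hom[OF that]]
        D.ident_left[OF D.ident_hom[OF that]]
    by blast
  have "natural_iso C C (\<lambda>X. X) (\<lambda>f. f) (\<lambda>X. Ko (Fo X)) (\<lambda>f. Ka (Fa f)) (Ident C)"
    unfolding natural_iso_def
  proof (intro conjI ballI)
    fix f assume f: "f \<in> Arr C"
    then have "f \<in> Hom C (Dom C f) (Cod C f)" by (simp add: Hom_def)
    then show "Ident C (Cod C f) \<cdot>\<^bsub>C\<^esub> f = Ka (Fa f) \<cdot>\<^bsub>C\<^esub> Ident C (Dom C f)"
      using C.ident_left C.ident_right KF(2)[OF f] by simp
  qed (simp_all add: KF C.ident_hom isoC)
  moreover have "natural_iso D D (\<lambda>Y. Fo (Ko Y)) (\<lambda>f. Fa (Ka f)) (\<lambda>Y. Y) (\<lambda>f. f) (Ident D)"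
    unfolding natural_iso_def
  proof (intro conjI ballI)
    fix f assume f: "f \<in> Arr D"
    then have "f \<in> Hom D (Dom D f) (Cod D f)" by (simp add: Hom_def)
    then show "Ident D (Cod D f) \<cdot>\<^bsub>D\<^esub> Fa (Ka f) = f \<cdot>\<^bsub>D\<^esub> Ident D (Dom D f)"
      using D.ident_left D.ident_right FK(2)[OF f] by simp
  qed (simp_all add: FK D.ident_hom isoD)
  ultimately show ?thesis
    unfolding is_equivalence_def using F K by blast
qed

context pointed
begin

section \<open>The categories of modules and their isomorphisms\<close>

abbreviation MC where "MC H \<psi> \<equiv> M0 G \<omega> H \<psi>"

lemma M0_simps [simp]:
  "Obj (MC H \<psi>) = modules H \<psi>"
  "Arr (MC H \<psi>) = left_module_arrows (vec_cat G \<omega>) (twisted_algebra G H \<psi>)"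
  "Dom (MC H \<psi>) = src" "Cod (MC H \<psi>) = trg"
  "Ident (MC H \<psi>) U = Arrow U U (idn (fst U))"
  "Comp (MC H \<psi>) k f = Arrow (src f) (trg k) (fn k \<odot> fn f)"
  "act_obj (MC H \<psi>) = mod_act H \<psi>"
  "act_arr (MC H \<psi>) f t = Arrow (mod_act H \<psi> (src f) (src t)) (mod_act H \<psi> (trg f) (trg t))
      (fn f \<otimes>\<otimes> t)"
  "act_assoc (MC H \<psi>) U X Y = Arrow (mod_act H \<psi> U (X \<boxtimes> Y)) (mod_act H \<psi> (mod_act H \<psi> U X) Y)
      (asc' (fst U) X Y)"
  "act_unit (MC H \<psi>) U = Arrow (mod_act H \<psi> U (graded_unit G)) U (runit (vec_cat G \<omega>) (fst U))"
  by (simp_all add: M0_def left_module_category_def)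

lemma M0_Hom:
  assumes "subgroup H G"
  shows "f \<in> Hom (MC H \<psi>) U V \<longleftrightarrow>
    U \<in> modules H \<psi> \<and> V \<in> modules H \<psi> \<and> src f = U \<and> trg f = V \<and> fn f \<in> hom (fst U) (fst V) \<and>
    (\<forall>h\<in>H. \<forall>x\<in>carrier G. \<forall>v\<in>fst U x. fn (fn f) (mact (snd U) h v) = mact (snd V) h (fn (fn f) v))"
  unfolding Hom_def M0_simps module_arrows_iff[OF assms] by auto

lemma M0_HomD:
  assumes "subgroup H G" and "f \<in> Hom (MC H \<psi>) U V"
  shows "U \<in> modules H \<psi>" and "V \<in> modules H \<psi>" and "src f = U" and "trg f = V"
    and "fn f \<in> hom (fst U) (fst V)"
    and "\<And>h x v. h \<in> H \<Longrightarrow> x \<in> carrier G \<Longrightarrow> v \<in> fst U x \<Longrightarrow>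
      fn (fn f) (mact (snd U) h v) = mact (snd V) h (fn (fn f) v)"
  using assms(2) unfolding M0_Hom[OF assms(1)] by blast+

lemma M0_HomI:
  assumes "subgroup H G" and "U \<in> modules H \<psi>" and "V \<in> modules H \<psi>" and "f \<in> hom (fst U) (fst V)"
    and "\<And>h x v. h \<in> H \<Longrightarrow> x \<in> carrier G \<Longrightarrow> v \<in> fst U x \<Longrightarrow>
      fn f (mact (snd U) h v) = mact (snd V) h (fn f v)"
  shows "Arrow U V f \<in> Hom (MC H \<psi>) U V"
  using assms unfolding M0_Hom[OF assms(1)] by simp

lemma moduleD:
  assumes "subgroup H G" and "U \<in> modules H \<psi>"
  shows "fst U \<in> spaces" and "snd U \<in> hom (twisted_space H \<boxtimes> fst U) (fst U)"
    and "\<And>h h' x v. h \<in> H \<Longrightarrow> h' \<in> H \<Longrightarrow> x \<in> carrier G \<Longrightarrow> v \<in> fst U x \<Longrightarrow>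
      mact (snd U) h (mact (snd U) h' v) = scale (\<omega> h h' x * \<psi> h h') (mact (snd U) (h \<otimes> h') v)"
    and "\<And>x v. x \<in> carrier G \<Longrightarrow> v \<in> fst U x \<Longrightarrow> mact (snd U) \<one> v = v"
    and "\<And>h x v. h \<in> H \<Longrightarrow> x \<in> carrier G \<Longrightarrow> v \<in> fst U x \<Longrightarrow> mact (snd U) h v \<in> fst U (h \<otimes> x)"
    and "\<And>h v. h \<in> H \<Longrightarrow> v \<in> total G (fst U) \<Longrightarrow> mact (snd U) h v \<in> total G (fst U)"
    and "\<And>h c v. h \<in> H \<Longrightarrow> v \<in> total G (fst U) \<Longrightarrow>
        mact (snd U) h (scale c v) = scale c (mact (snd U) h v)"
proof -
  have "(fst U, snd U) \<in> modules H \<psi>"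
    using assms(2) by simp
  note m = modulesD[OF assms(1) this]
  show "fst U \<in> spaces" and a: "snd U \<in> hom (twisted_space H \<boxtimes> fst U) (fst U)"
    by (fact m(1,2))+
  show "\<And>h h' x v. h \<in> H \<Longrightarrow> h' \<in> H \<Longrightarrow> x \<in> carrier G \<Longrightarrow> v \<in> fst U x \<Longrightarrow>
      mact (snd U) h (mact (snd U) h' v) = scale (\<omega> h h' x * \<psi> h h') (mact (snd U) (h \<otimes> h') v)"
    and "\<And>x v. x \<in> carrier G \<Longrightarrow> v \<in> fst U x \<Longrightarrow> mact (snd U) \<one> v = v"
    by (fact m(3,4))+
  show "\<And>h x v. h \<in> H \<Longrightarrow> x \<in> carrier G \<Longrightarrow> v \<in> fst U x \<Longrightarrow> mact (snd U) h v \<in> fst U (h \<otimes> x)"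
    by (rule mact_mem[OF a subgroup_carrier[OF assms(1)]])
  show "\<And>h v. h \<in> H \<Longrightarrow> v \<in> total G (fst U) \<Longrightarrow> mact (snd U) h v \<in> total G (fst U)"
    by (rule mact_total[OF a subgroup_carrier[OF assms(1)]])
  show "\<And>h c v. h \<in> H \<Longrightarrow> v \<in> total G (fst U) \<Longrightarrow>
      mact (snd U) h (scale c v) = scale c (mact (snd U) h v)"
    by (rule mact_scale[OF a subgroup_carrier[OF assms(1)]])
qed

lemma cat_M0:
  assumes H: "subgroup H G"
  shows "cat (MC H \<psi>)"
proof -
  interpret V: cat "vec_cat G \<omega>" by (rule cat_vec_cat)
  show ?thesis
  proof
    fix f assume "f \<in> Arr (MC H \<psi>)"
    then show "Dom (MC H \<psi>) f \<in> Obj (MC H \<psi>)" "Cod (MC H \<psi>) f \<in> Obj (MC H \<psi>)"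
      by (auto simp: left_module_arrows_def)
  next
    fix U assume "U \<in> Obj (MC H \<psi>)"
    then have U: "U \<in> modules H \<psi>" by simp
    note m = moduleD[OF H U]
    show "Ident (MC H \<psi>) U \<in> Hom (MC H \<psi>) U U"
      unfolding M0_simps
    proof (rule M0_HomI[OF H U U idn_hom[OF m(1)]])
      fix h x v assume h: "h \<in> H" and "x \<in> carrier G" "v \<in> fst U x"
      then have v: "v \<in> total G (fst U)" by (intro total_component)
      show "fn (idn (fst U)) (mact (snd U) h v) = mact (snd U) h (fn (idn (fst U)) v)"
        unfolding idn_apply[OF v] idn_apply[OF m(6)[OF h v]] ..
    qed
  next
    fix f U V k W assume f: "f \<in> Hom (MC H \<psi>) U V" and k: "k \<in> Hom (MC H \<psi>) V W"
    note f' = M0_HomD[OF H f] and k' = M0_HomD[OF H k]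
    show "Comp (MC H \<psi>) k f \<in> Hom (MC H \<psi>) U W"
      unfolding M0_simps f'(3) k'(4)
    proof (rule M0_HomI[OF H f'(1) k'(2) cc_hom[OF f'(5) k'(5)]])
      fix h x v assume *: "h \<in> H" "x \<in> carrier G" "v \<in> fst U x"
      then have v: "v \<in> total G (fst U)" by (intro total_component)
      have "fn (fn f) v \<in> fst V x"
        by (rule graded_homD(7)[OF f'(5) *(2,3)])
      then show "fn (fn k \<odot> fn f) (mact (snd U) h v) = mact (snd W) h (fn (fn k \<odot> fn f) v)"
        unfolding cc_apply[OF f'(5) v] cc_apply[OF f'(5) moduleD(6)[OF H f'(1) *(1) v]] f'(6)[OF *]
        by (rule k'(6)[OF *(1,2)])
    qed
  next
    fix f T U k V j W
    assume f: "f \<in> Hom (MC H \<psi>) T U" and k: "k \<in> Hom (MC H \<psi>) U V" and j: "j \<in> Hom (MC H \<psi>) V W"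
    note f' = M0_HomD[OF H f] and k' = M0_HomD[OF H k] and j' = M0_HomD[OF H j]
    show "Comp (MC H \<psi>) (Comp (MC H \<psi>) j k) f = Comp (MC H \<psi>) j (Comp (MC H \<psi>) k f)"
      using V.comp_assoc[of "fn f" "fst T" "fst U" "fn k" "fst V" "fn j" "fst W"]
          f'(5) k'(5) j'(5) by simp
  next
    fix f U V assume f: "f \<in> Hom (MC H \<psi>) U V"
    note f' = M0_HomD[OF H f]
    show "Comp (MC H \<psi>) (Ident (MC H \<psi>) V) f = f" "Comp (MC H \<psi>) f (Ident (MC H \<psi>) U) = f"
      using V.ident_left[of "fn f" "fst U" "fst V"] V.ident_right[of "fn f" "fst U" "fst V"] f'(3-5)
      by (auto intro!: arrow_eqI)
  qed
qed

text \<open>The inverse of an equivariant bijection is equivariant, so it suffices to invert the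
  underlying graded map.\<close>

lemma M0_iso:
  assumes H: "subgroup H G" and f: "f \<in> Hom (MC H \<psi>) U V" and k: "k \<in> hom (fst V) (fst U)"
    and kf: "k \<odot> fn f = idn (fst U)" and fk: "fn f \<odot> k = idn (fst V)"
  shows "iso_arrow (MC H \<psi>) f"
proof -
  interpret cat "MC H \<psi>" by (rule cat_M0[OF H])
  note f' = M0_HomD[OF H f]
  have kfv: "fn k (fn (fn f) u) = u" if "u \<in> total G (fst U)" for u
    using cc_apply[OF f'(5) that, of k] unfolding kf idn_apply[OF that] by simp
  have fkv: "fn (fn f) (fn k u) = u" if "u \<in> total G (fst V)" for u
    using cc_apply[OF k that, of "fn f"] unfolding fk idn_apply[OF that] by simp
  have "Arrow V U k \<in> Hom (MC H \<psi>) V U"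
  proof (rule M0_HomI[OF H f'(2,1) k])
    fix h x v assume *: "h \<in> H" "x \<in> carrier G" "v \<in> fst V x"
    then have v: "v \<in> total G (fst V)" by (intro total_component)
    note kv = graded_homD(7)[OF k *(2,3)] and kvt = graded_homD(6)[OF k v]
    have "fn k (mact (snd V) h v) = fn k (mact (snd V) h (fn (fn f) (fn k v)))"
      unfolding fkv[OF v] ..
    also have "\<dots> = fn k (fn (fn f) (mact (snd U) h (fn k v)))"
      unfolding f'(6)[OF *(1,2) kv] ..
    also have "\<dots> = mact (snd U) h (fn k v)"
      by (rule kfv[OF moduleD(6)[OF H f'(1) *(1) kvt]])
    finally show "fn k (mact (snd V) h v) = mact (snd U) h (fn k v)" .
  qed
  then have "inverse_arrows (MC H \<psi>) f (Arrow V U k)"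
    by (intro inverse_arrowsI[OF f]) (simp_all add: f'(3,4) kf fk)
  then show ?thesis
    unfolding iso_arrow_def by blast
qed

text \<open>Both sides are restrictions of linear maps in \<open>t\<close>, and pure tensors of
  homogeneous vectors span the component.\<close>

lemma equivariant_tensorI:
  assumes H: "subgroup H G" and U: "U \<in> modules H \<psi>" and V: "V \<in> modules H \<psi>"
    and UM: "fst U = M \<boxtimes> X" and f: "f \<in> hom (M \<boxtimes> X) (fst V)" and h: "h \<in> H"
    and eq: "\<And>x y v w. x \<in> carrier G \<Longrightarrow> y \<in> carrier G \<Longrightarrow> v \<in> M x \<Longrightarrow> w \<in> X y \<Longrightarrow>
      fn f (mact (snd U) h (pure_tensor v w)) = mact (snd V) h (fn f (pure_tensor v w))"
    and z: "z \<in> carrier G" and t: "t \<in> (M \<boxtimes> X) z"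
  shows "fn f (mact (snd U) h t) = mact (snd V) h (fn f t)"
proof -
  note Hc = subgroup_carrier[OF H] and u = moduleD[OF H U, unfolded UM] and v = moduleD[OF H V]
  obtain F where F: "lin F" "\<And>v. v \<in> total G (M \<boxtimes> X) \<Longrightarrow> fn f v = F v"
    using graded_hom_lin[OF f] by blast
  obtain \<rho> where \<rho>: "lin \<rho>" "\<And>v. v \<in> total G (M \<boxtimes> X) \<Longrightarrow> mact (snd U) h v = \<rho> v"
    using mact_extend[OF u(2) Hc h] by blast
  obtain \<rho>' where \<rho>': "lin \<rho>'" "\<And>v. v \<in> total G (fst V) \<Longrightarrow> mact (snd V) h v = \<rho>' v"
    using mact_extend[OF v(2) Hc h] by blast
  have l: "fn f (mact (snd U) h s) = F (\<rho> s)" "mact (snd V) h (fn f s) = \<rho>' (F s)"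
    if s: "s \<in> total G (M \<boxtimes> X)" for s
    using F(2)[OF u(6)[OF h s]] \<rho>(2)[OF s] \<rho>'(2)[OF graded_homD(6)[OF f s]] F(2)[OF s] by simp_all
  have "F (\<rho> t) = \<rho>' (F t)"
    using t lin_comp[OF \<rho>(1) F(1)] lin_comp[OF F(1) \<rho>'(1)]
  proof (rule tensor_lin_eq)
    fix x y v w assume *: "x \<in> carrier G" "y \<in> carrier G" "v \<in> M x" "w \<in> X y"
    then have "pure_tensor v w \<in> total G (M \<boxtimes> X)"
      by (blast intro: pure_total total_component)
    from eq[OF *] l[OF this] show "F (\<rho> (pure_tensor v w)) = \<rho>' (F (pure_tensor v w))"
      by simp
  qed
  moreover have "t \<in> total G (M \<boxtimes> X)"
    using z t by (rule total_component)
  ultimately show ?thesis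
    using l by simp
qed

section \<open>Scalar automorphisms and shifted gradings\<close>

text \<open>The shape of the module constraint constructed below: a scalar on each product of
  homogeneous components.\<close>

definition diag :: "('g, 'k) graded \<Rightarrow> ('g, 'k) graded \<Rightarrow> ('g \<Rightarrow> 'g \<Rightarrow> 'k) \<Rightarrow> ('g, 'k) graded_arrow"
    where
  "diag M X c = lin_arrow G (M \<boxtimes> X) (M \<boxtimes> X) (\<lambda>t. \<Sum>p\<in>carrier G \<times> carrier G.
     scale (c (fst p) (snd p)) (tmap (gproj G M (fst p)) (gproj G X (snd p)) t))"

lemma diag:
  assumes M: "M \<in> spaces" and X: "X \<in> spaces"
  shows diag_hom: "diag M X c \<in> hom (M \<boxtimes> X) (M \<boxtimes> X)" (is ?thesis1)
    and diag_apply: "\<And>x y v w. x \<in> carrier G \<Longrightarrow> y \<in> carrier G \<Longrightarrow> v \<in> M x \<Longrightarrow> w \<in> X y \<Longrightarrow>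
      fn (diag M X c) (pure_tensor v w) = scale (c x y) (pure_tensor v w)"
proof -
  define D where "D t = (\<Sum>p\<in>carrier G \<times> carrier G.
     scale (c (fst p) (snd p)) (tmap (gproj G M (fst p)) (gproj G X (snd p)) t))" for t
  have D: "lin D"
    unfolding D_def by (intro lin_sum_fun lin_scale_fun lin_tmap gproj_lin M X) auto
  have Dp: "D (pure_tensor v w) = scale (c x y) (pure_tensor v w)"
    if "x \<in> carrier G" "y \<in> carrier G" "v \<in> M x" "w \<in> X y" for x y v w
  proof -
    have "D (pure_tensor v w) = (\<Sum>p\<in>carrier G \<times> carrier G.
        if p = (x, y) then scale (c x y) (pure_tensor v w) else 0)"
      unfolding D_def
      by (rule sum.cong[OF refl]) (use that M X in \<open>auto simp: tmap_pure gproj_comp\<close>)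
    also have "\<dots> = scale (c x y) (pure_tensor v w)"
      using that finite_carrier by simp
    finally show ?thesis .
  qed
  have d: "diag M X c = lin_arrow G (M \<boxtimes> X) (M \<boxtimes> X) D"
    unfolding diag_def D_def ..
  show ?thesis1
    unfolding d
  proof (rule tensor_lin_arrow[OF M X tensor_space[OF M X] D])
    fix x y v w assume *: "x \<in> carrier G" "y \<in> carrier G" "v \<in> M x" "w \<in> X y"
    then have "pure_tensor v w \<in> (M \<boxtimes> X) (x \<otimes> y)"
      by (intro tensor_component)
    then show "D (pure_tensor v w) \<in> (M \<boxtimes> X) (x \<otimes> y)"
      unfolding Dp[OF *] by (rule vec.subspace_scale[OF
          graded_space_subspace[OF tensor_space[OF M X]]])
  qed
  fix x y v w assume *: "x \<in> carrier G" "y \<in> carrier G" "v \<in> M x" "w \<in> X y"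
  then have "pure_tensor v w \<in> total G (M \<boxtimes> X)"
    by (blast intro: pure_total total_component)
  then show "fn (diag M X c) (pure_tensor v w) = scale (c x y) (pure_tensor v w)"
    unfolding d by (simp add: lin_arrow_apply Dp[OF *])
qed

lemma diag_inverse:
  assumes M: "M \<in> spaces" and X: "X \<in> spaces"
    and c: "\<And>x y. x \<in> carrier G \<Longrightarrow> y \<in> carrier G \<Longrightarrow> c x y * d x y = 1"
  shows "diag M X c \<odot> diag M X d = idn (M \<boxtimes> X)"
proof (rule tensor_hom_eqI[OF cc_hom[OF diag_hom[OF M X] diag_hom[OF M X]]
    idn_hom[OF tensor_space[OF M X]]])
  fix x y v w assume *: "x \<in> carrier G" "y \<in> carrier G" "v \<in> M x" "w \<in> X y"
  then have p: "pure_tensor v w \<in> total G (M \<boxtimes> X)"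
    by (blast intro: pure_total total_component)
  show "fn (diag M X c \<odot> diag M X d) (pure_tensor v w) = fn (idn (M \<boxtimes> X)) (pure_tensor v w)"
    unfolding cc_apply[OF diag_hom[OF M X] p] diag_apply[OF M X *] idn_apply[OF p]
      graded_hom_scale[OF diag_hom[OF M X] p] using c[OF *(1,2)] by (simp add: mult.commute)
qed

text \<open>Up to isomorphism this is the left tensor product with a simple object of degree
  \<open>inv g\<close>, realised by relabelling degrees so that the vectors themselves do not
  change. The value \<open>{0}\<close> off the carrier is what \<open>graded_spaces\<close>
  demands.\<close>

definition shift :: "'g \<Rightarrow> ('g, 'k) graded \<Rightarrow> ('g, 'k) graded" where
  "shift g M = (\<lambda>x. if x \<in> carrier G then M (g \<otimes> x) else {0})"

lemma shift_apply [simp]: "x \<in> carrier G \<Longrightarrow> shift g M x = M (g \<otimes> x)"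
  by (simp add: shift_def)

lemma total_shift: "g \<in> carrier G \<Longrightarrow> total G (shift g M) = total G M"
proof -
  assume g: "g \<in> carrier G"
  have "(\<Union>x\<in>carrier G. shift g M x) = (\<Union>x\<in>carrier G. M x)"
  proof
    show "(\<Union>x\<in>carrier G. shift g M x) \<subseteq> (\<Union>x\<in>carrier G. M x)"
      using g by auto
    have "M x = shift g M (inv g \<otimes> x)" if "x \<in> carrier G" for x
      using g that by (simp add: m_assoc[symmetric])
    with g show "(\<Union>x\<in>carrier G. M x) \<subseteq> (\<Union>x\<in>carrier G. shift g M x)"
      by (intro UN_least) (metis UN_upper inv_closed m_closed)
  qed
  then show ?thesis
    unfolding total_def by simp
qed

lemma shift_space:
  assumes g: "g \<in> carrier G" and M: "M \<in> spaces"
  shows "shift g M \<in> spaces"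
proof -
  obtain B where B: "finite B" "total G M = vec.span B"
    using M by (rule graded_space_finite_span)
  show ?thesis
  proof (rule graded_spaceI[where P = "\<lambda>x. gproj G M (g \<otimes> x)", OF _ _ finite_carrier _ _ B(1)])
    show "total G (shift g M) = vec.span B"
      using total_shift[OF g] B by simp
    fix x y v assume *: "x \<in> carrier G" "y \<in> carrier G" "v \<in> shift g M y"
    then show "gproj G M (g \<otimes> x) v = (if y = x then v else 0)"
      using gproj_comp[OF M, where x = "g \<otimes> x" and y = "g \<otimes> y" and v = v] g by simp
  qed (use g M in \<open>auto simp: shift_def graded_space_subspace\<close>)
qed

lemma shift_inverse:
  assumes g: "g \<in> carrier G" "g' \<in> carrier G" "g \<otimes> g' = \<one>" and M: "M \<in> spaces"
  shows "shift g' (shift g M) = M"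
proof
  fix x
  show "shift g' (shift g M) x = M x"
    using g graded_spaceD(2)[OF M, of x]
        by (cases "x \<in> carrier G") (auto simp: shift_def m_assoc[symmetric])
qed

text \<open>Left translation of degrees only affects the first factor and does not touch the pure
  tensors, so the two sides are equal and not just isomorphic.\<close>

lemma shift_tensor:
  assumes g: "g \<in> carrier G"
  shows "shift g (M \<boxtimes> X) = shift g M \<boxtimes> X"
proof
  fix z
  show "shift g (M \<boxtimes> X) z = (shift g M \<boxtimes> X) z"
  proof (cases "z \<in> carrier G")
    case z: True
    have "{pure_tensor v w | v w x y. x \<in> carrier G \<and> y \<in> carrier G \<and> x \<otimes> y = g \<otimes> z \<and> v \<in> M x \<and>
        w \<in> X y} =
      {pure_tensor v w | v w x y. x \<in> carrier G \<and> y \<in> carrier G \<and> x \<otimes> y = z \<and> v \<in> shift g M x \<and>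
          w \<in> X y}"
      (is "?L = ?R")
    proof
      show "?L \<subseteq> ?R"
      proof clarify
        fix v w x y assume *: "x \<in> carrier G" "y \<in> carrier G" "x \<otimes> y = g \<otimes> z" "v \<in> M x" "w \<in> X y"
        have "inv g \<otimes> x \<otimes> y = z"
          using * g z by (simp add: m_assoc inv_solve_left')
        moreover have "v \<in> shift g M (inv g \<otimes> x)"
          using * g by (simp add: m_assoc[symmetric])
        ultimately show "\<exists>v' w' x y. pure_tensor v w = pure_tensor v' w' \<and> x \<in> carrier G \<and>
            y \<in> carrier G \<and>
            x \<otimes> y = z \<and> v' \<in> shift g M x \<and> w' \<in> X y"
          using * g by (intro exI[of _ v] exI[of _ w] exI[of _ "inv g \<otimes> x"] exI[of _ y]) auto
      qed
      show "?R \<subseteq> ?L"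
      proof clarify
        fix v w x y assume *: "x \<in> carrier G" "y \<in> carrier G" "v \<in> shift g M x" "w \<in> X y" "z
            = x \<otimes> y"
        then show "\<exists>v' w' x' y'. pure_tensor v w = pure_tensor v' w' \<and> x' \<in> carrier G \<and>
            y' \<in> carrier G \<and>
            x' \<otimes> y' = g \<otimes> (x \<otimes> y) \<and> v' \<in> M x' \<and> w' \<in> X y'"
          using g by (intro exI[of _ v] exI[of _ w] exI[of _ "g \<otimes> x"] exI[of _ y])
              (auto simp: m_assoc)
      qed
    qed
    then show ?thesis
      using z by (simp add: graded_tensor_def)
  next
    case False
    then show ?thesis
      by (simp add: shift_def tensor_outside)
  qed
qed

definition shift_arrow :: "'g \<Rightarrow> ('g, 'k) graded_arrow \<Rightarrow> ('g, 'k) graded_arrow" where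
  "shift_arrow g f = Arrow (shift g (src f)) (shift g (trg f)) (fn f)"

lemma shift_arrow_simps [simp]:
  "src (shift_arrow g f) = shift g (src f)" "trg (shift_arrow g f) = shift g (trg f)"
  "fn (shift_arrow g f) = fn f"
  by (simp_all add: shift_arrow_def)

lemma shift_arrow_hom:
  assumes g: "g \<in> carrier G" and f: "f \<in> hom M N"
  shows "shift_arrow g f \<in> hom (shift g M) (shift g N)"
proof -
  note f' = graded_homD[OF f]
  show ?thesis
    using f g shift_space[OF g f'(3)] shift_space[OF g f'(4)]
    unfolding graded_hom_def graded_arrows_def
    by (auto simp: total_shift[OF g] image_subset_iff)
qed

end

section \<open>Twisting a module along a conjugation\<close>

context group
begin

lemma conj_by_closed [simp, intro]: "g \<in> carrier G \<Longrightarrow> x \<in> carrier G \<Longrightarrow> conj_by G g x \<in> carrier G"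
  by (simp add: conj_by_def)

lemma conj_by_one [simp]: "g \<in> carrier G \<Longrightarrow> conj_by G g \<one> = \<one>"
  by (simp add: conj_by_def)

lemma inv_cancel_left [simp]:
  assumes "g \<in> carrier G" and "x \<in> carrier G"
  shows "inv g \<otimes> (g \<otimes> x) = x" and "g \<otimes> (inv g \<otimes> x) = x"
  using assms by (simp_all add: m_assoc[symmetric])

lemma conj_by_mult:
  "g \<in> carrier G \<Longrightarrow> x \<in> carrier G \<Longrightarrow> y \<in> carrier G \<Longrightarrow>
    conj_by G g (x \<otimes> y) = conj_by G g x \<otimes> conj_by G g y"
  by (simp add: conj_by_def m_assoc)

lemma conj_by_shift:
  "g \<in> carrier G \<Longrightarrow> x \<in> carrier G \<Longrightarrow> conj_by G g x \<otimes> g = g \<otimes> x"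
  by (simp add: conj_by_def m_assoc)

lemma conj_by_cancel:
  assumes "g \<in> carrier G" and "g' \<in> carrier G" and "g \<otimes> g' = \<one>" and "x \<in> carrier G"
  shows "conj_by G g (conj_by G g' x) = x"
proof -
  have "g' = inv g"
    using assms by (metis inv_equality inv_inv)
  with assms show ?thesis
    by (simp add: conj_by_def m_assoc)
qed

end

context pointed
begin

text \<open>
  A module over the algebra of \<open>H\<close> becomes a module over that of \<open>L\<close> by letting \<open>l\<close> act as the
  conjugate of \<open>l\<close>, rescaled by \<open>s l x\<close> on the component of degree \<open>x\<close> of the shifted grading.
  The equation says that this respects the two twisted associativity laws.
\<close>

definition twist ::
  "'g \<Rightarrow> ('g \<Rightarrow> 'g \<Rightarrow> 'k) \<Rightarrow> 'g set \<Rightarrow> ('g \<Rightarrow> 'g \<Rightarrow> 'k) \<Rightarrow> 'g set \<Rightarrow> ('g \<Rightarrow> 'g \<Rightarrow> 'k) \<Rightarrow> bool" where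
  "twist g s H \<psi> L \<xi> \<longleftrightarrow> g \<in> carrier G \<and> subgroup H G \<and> subgroup L G \<and> conj_by G g ` L \<subseteq> H \<and>
     (\<forall>x\<in>carrier G. s \<one> x = 1) \<and>
     (\<forall>l\<in>L. \<forall>m\<in>L. \<forall>x\<in>carrier G.
        s m x * s l (m \<otimes> x) * \<omega> (conj_by G g l) (conj_by G g m) (g \<otimes> x) * conj_cochain G \<psi> g l m
        = \<omega> l m x * \<xi> l m * s (l \<otimes> m) x)"

lemma twistD:
  assumes "twist g s H \<psi> L \<xi>"
  shows "g \<in> carrier G" and "subgroup H G" and "subgroup L G"
    and "\<And>l. l \<in> L \<Longrightarrow> conj_by G g l \<in> H" and "\<And>x. x \<in> carrier G \<Longrightarrow> s \<one> x = 1"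
    and "\<And>l m x. l \<in> L \<Longrightarrow> m \<in> L \<Longrightarrow> x \<in> carrier G \<Longrightarrow>
      s m x * s l (m \<otimes> x) * \<omega> (conj_by G g l) (conj_by G g m) (g \<otimes> x) * \<psi> (conj_by G g l)
          (conj_by G g m)
        = \<omega> l m x * \<xi> l m * s (l \<otimes> m) x"
  using assms unfolding twist_def conj_cochain_def by blast+

text \<open>The rescaling depends on the degree, so the operators are prescribed on homogeneous
  vectors only; these determine the action.\<close>

definition twist_action :: "'g \<Rightarrow> ('g \<Rightarrow> 'g \<Rightarrow> 'k) \<Rightarrow> 'g set \<Rightarrow>
    ('g, 'k) graded \<times> ('g, 'k) graded_arrow \<Rightarrow> ('g, 'k) graded_arrow" where
  "twist_action g s L U = (SOME b. b \<in> hom (twisted_space L \<boxtimes> shift g (fst U)) (shift g (fst U)) \<and>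
     (\<forall>l\<in>L. \<forall>x\<in>carrier G. \<forall>v\<in>fst U (g \<otimes> x). mact b l v
         = scale (s l x) (mact (snd U) (conj_by G g l) v)))"

definition twist_obj where
  "twist_obj g s L U = (shift g (fst U), twist_action g s L U)"

definition twist_arr where
  "twist_arr g s L f = Arrow (twist_obj g s L (src f)) (twist_obj g s L (trg f))
      (shift_arrow g (fn f))"

lemma fst_twist_obj [simp]: "fst (twist_obj g s L U) = shift g (fst U)"
  by (simp add: twist_obj_def)

lemma twist_action:
  assumes t: "twist g s H \<psi> L \<xi>" and U: "U \<in> modules H \<psi>"
  shows twist_action_hom: "snd (twist_obj g s L U) \<in> hom (twisted_space L \<boxtimes> shift g (fst U))
      (shift g (fst U))"
    and twist_action_apply: "\<And>l x v. l \<in> L \<Longrightarrow> x \<in> carrier G \<Longrightarrow> v \<in> fst U (g \<otimes> x) \<Longrightarrow>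
      mact (snd (twist_obj g s L U)) l v = scale (s l x) (mact (snd U) (conj_by G g l) v)"
proof -
  note t' = twistD[OF t] and u = moduleD[OF twistD(2)[OF t] U]
  note Hc = subgroup_carrier[OF t'(2)] and Lc = subgroup_carrier[OF t'(3)]
  let ?M = "fst U" and ?S = "shift g (fst U)"
  have S: "?S \<in> spaces"
    by (rule shift_space[OF t'(1) u(1)])
  have "\<forall>l\<in>L. \<exists>\<rho>. lin \<rho> \<and> (\<forall>v\<in>total G ?M. mact (snd U) (conj_by G g l) v = \<rho> v)"
    using mact_extend[OF u(2) Hc] t'(4) by blast
  then obtain \<rho> where \<rho>: "\<And>l. l \<in> L \<Longrightarrow> lin (\<rho> l)"
    "\<And>l v. l \<in> L \<Longrightarrow> v \<in> total G ?M \<Longrightarrow> mact (snd U) (conj_by G g l) v = \<rho> l v"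
    by metis
  \<comment> \<open>A vector is split into homogeneous components, which are rescaled separately
    because \<open>s l x\<close> depends on the degree.\<close>
  define \<sigma> where "\<sigma> l v = (\<Sum>x\<in>carrier G. scale (s l x) (\<rho> l (gproj G ?S x v)))" for l v
  have \<sigma>: "lin (\<sigma> l)" if "l \<in> L" for l
    unfolding \<sigma>_def by (intro lin_sum_fun lin_scale_fun lin_comp[OF _ \<rho>(1)[OF that]] gproj_lin S)
  have \<sigma>v: "\<sigma> l v = scale (s l x) (mact (snd U) (conj_by G g l) v)"
    if "l \<in> L" "x \<in> carrier G" "v \<in> ?M (g \<otimes> x)" for l x v
  proof -
    have v: "v \<in> total G ?M"
      by (rule total_component[of "g \<otimes> x"]) (use that t'(1) in auto)
    have vS: "v \<in> ?S x"
      using that by simp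
    have "\<sigma> l v = (\<Sum>y\<in>carrier G. if y = x then scale (s l x) (\<rho> l v) else 0)"
      unfolding \<sigma>_def
    proof (rule sum.cong[OF refl])
      fix y assume y: "y \<in> carrier G"
      show "scale (s l y) (\<rho> l (gproj G ?S y v)) = (if y = x then scale (s l x) (\<rho> l v) else 0)"
        using gproj_comp[where V = ?S, OF S y that(2) vS] lin_zero[OF \<rho>(1)[OF that(1)]] by auto
    qed
    also have "\<dots> = scale (s l x) (mact (snd U) (conj_by G g l) v)"
      using that finite_carrier \<rho>(2)[OF that(1) v] by simp
    finally show ?thesis .
  qed
  have \<sigma>S: "\<sigma> l v \<in> ?S (l \<otimes> x)" if "l \<in> L" "x \<in> carrier G" "v \<in> ?S x" for l x v
  proof -
    have l: "l \<in> carrier G" using that(1) Lc by auto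
    have v: "v \<in> ?M (g \<otimes> x)" using that by simp
    have gx: "g \<otimes> x \<in> carrier G" using that t'(1) by simp
    have "mact (snd U) (conj_by G g l) v \<in> ?M (conj_by G g l \<otimes> (g \<otimes> x))"
      by (rule u(5)[OF t'(4)[OF that(1)] gx v])
    also have "conj_by G g l \<otimes> (g \<otimes> x) = g \<otimes> (l \<otimes> x)"
      using conj_by_shift[OF t'(1) l] t'(1) l that(2) by (simp add: m_assoc[symmetric])
    finally show ?thesis
      unfolding \<sigma>v[OF that(1,2) v] using l that(2)
      by (simp add: vec.subspace_scale[OF graded_space_subspace[OF u(1)]])
  qed
  let ?P = "\<lambda>b. b \<in> hom (twisted_space L \<boxtimes> ?S) ?S \<and>
     (\<forall>l\<in>L. \<forall>x\<in>carrier G. \<forall>v\<in>?M (g \<otimes> x). mact b l v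
         = scale (s l x) (mact (snd U) (conj_by G g l) v))"
  obtain b where b: "b \<in> hom (twisted_space L \<boxtimes> ?S) ?S" "\<forall>l\<in>L. \<forall>v\<in>total G ?S. mact b l v = \<sigma> l v"
    using action_exists[OF Lc S S \<sigma> \<sigma>S] by blast
  have "?P b"
  proof (intro conjI b(1) ballI)
    fix l x v assume *: "l \<in> L" "x \<in> carrier G" "v \<in> ?M (g \<otimes> x)"
    have "v \<in> total G ?S"
      by (rule total_component[of x]) (use * in simp_all)
    then show "mact b l v = scale (s l x) (mact (snd U) (conj_by G g l) v)"
      using b(2) \<sigma>v[OF *] *(1) by simp
  qed
  then have "?P (SOME b. ?P b)"
    by (rule someI)
  moreover have "snd (twist_obj g s L U) = (SOME b. ?P b)"
    by (simp add: twist_obj_def twist_action_def)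
  ultimately have P: "?P (snd (twist_obj g s L U))"
    by (rule_tac ssubst[where P = ?P])
  show "snd (twist_obj g s L U) \<in> hom (twisted_space L \<boxtimes> ?S) ?S"
    using P by (rule conjunct1)
  show "\<And>l x v. l \<in> L \<Longrightarrow> x \<in> carrier G \<Longrightarrow> v \<in> ?M (g \<otimes> x) \<Longrightarrow>
      mact (snd (twist_obj g s L U)) l v = scale (s l x) (mact (snd U) (conj_by G g l) v)"
    using conjunct2[OF P] by blast
qed

text \<open>The conjugate of \<open>l\<close> times \<open>g\<close> is \<open>g\<close> times
  \<open>l\<close>, so the conjugate moves degrees of the original grading just as \<open>l\<close>
  moves those of the shifted one.\<close>

lemma twist_degree:
  assumes t: "twist g s H \<psi> L \<xi>" and l: "l \<in> L" and x: "x \<in> carrier G"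
  shows "conj_by G g l \<otimes> (g \<otimes> x) = g \<otimes> (l \<otimes> x)"
proof -
  have lc: "l \<in> carrier G"
    using l subgroup_carrier[OF twistD(3)[OF t]] by blast
  show ?thesis
    using conj_by_shift[OF twistD(1)[OF t] lc] twistD(1)[OF t] lc x
        by (simp add: m_assoc[symmetric])
qed

text \<open>The operators of \<open>m\<close> and then \<open>l\<close> contribute
  \<open>s m x\<close> and \<open>s l (m \<otimes> x)\<close>, as \<open>m\<close> changes the
  degree before \<open>l\<close> acts; the equation in \<open>twist\<close> is what makes the
  product of these factors fit the law for \<open>L\<close>.\<close>

lemma twist_obj_modules:
  assumes t: "twist g s H \<psi> L \<xi>" and U: "U \<in> modules H \<psi>"
  shows "twist_obj g s L U \<in> modules L \<xi>"
proof -
  note t' = twistD[OF t] and u = moduleD[OF twistD(2)[OF t] U]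
  note Lc = subgroup_carrier[OF t'(3)]
  note b = twist_action[OF t U]
  let ?b = "snd (twist_obj g s L U)"
  have S: "shift g (fst U) \<in> spaces"
    by (rule shift_space[OF t'(1) u(1)])
  have bb: "mact ?b l (mact ?b m v) = scale (\<omega> l m x * \<xi> l m) (mact ?b (l \<otimes> m) v)"
    if l: "l \<in> L" "m \<in> L" and x: "x \<in> carrier G" and v: "v \<in> shift g (fst U) x" for l m x v
  proof -
    have v': "v \<in> fst U (g \<otimes> x)" using x v by simp
    have lc: "l \<in> carrier G" "m \<in> carrier G" using l Lc by auto
    have lm: "l \<otimes> m \<in> L" using t'(3) l by (rule subgroup.m_closed)
    have gx: "g \<otimes> x \<in> carrier G" and mx: "m \<otimes> x \<in> carrier G" using t'(1) x lc by simp_all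
    let ?l = "conj_by G g l" and ?m = "conj_by G g m" and ?a = "snd U"
    have mv: "mact ?a ?m v \<in> fst U (g \<otimes> (m \<otimes> x))"
      using u(5)[OF t'(4)[OF l(2)] gx v'] unfolding twist_degree[OF t l(2) x] .
    have mvt: "mact ?a ?m v \<in> total G (fst U)"
      by (rule total_component[where V = "fst U", OF _ mv]) (use t'(1) mx in simp)
    have smv: "scale (s m x) (mact ?a ?m v) \<in> fst U (g \<otimes> (m \<otimes> x))"
      by (rule vec.subspace_scale[OF graded_space_subspace[OF u(1)] mv])
    have "mact ?b l (mact ?b m v) = scale (s l (m \<otimes> x)) (mact ?a ?l (scale (s m x) (mact ?a ?m v)))"
      unfolding b(2)[OF l(2) x v'] b(2)[OF l(1) mx smv] ..
    also have "\<dots> = scale (s m x * s l (m \<otimes> x) * \<omega> ?l ?m (g \<otimes> x) * \<psi> ?l ?m) (mact ?a (?l \<otimes> ?m) v)"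
      unfolding u(7)[OF t'(4)[OF l(1)] mvt] u(3)[OF t'(4)[OF l(1)] t'(4)[OF l(2)] gx v']
          vec.scale_scale
      by (simp add: ac_simps)
    also have "\<dots> = scale (\<omega> l m x * \<xi> l m) (scale (s (l \<otimes> m) x) (mact ?a (conj_by G g (l \<otimes> m)) v))"
      unfolding t'(6)[OF l x] conj_by_mult[OF t'(1) lc] vec.scale_scale ..
    also have "\<dots> = scale (\<omega> l m x * \<xi> l m) (mact ?b (l \<otimes> m) v)"
      unfolding b(2)[OF lm x v'] ..
    finally show ?thesis .
  qed
  have b1: "mact ?b \<one> v = v" if x: "x \<in> carrier G" and v: "v \<in> shift g (fst U) x" for x v
  proof -
    have v': "v \<in> fst U (g \<otimes> x)" using x v by simp
    have gx: "g \<otimes> x \<in> carrier G" using t'(1) x by simp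
    show ?thesis
      unfolding b(2)[OF subgroup.one_closed[OF t'(3)] x v'] t'(5)[OF x] conj_by_one[OF t'(1)]
          u(4)[OF gx v'] by simp
  qed
  have "(shift g (fst U), ?b) \<in> modules L \<xi>"
    unfolding modules_iff[OF t'(3)] using S b(1) bb b1 by blast
  then show ?thesis
    by (simp add: twist_obj_def)
qed

lemma twist_arr_hom:
  assumes t: "twist g s H \<psi> L \<xi>" and f: "f \<in> Hom (MC H \<psi>) U V"
  shows "twist_arr g s L f \<in> Hom (MC L \<xi>) (twist_obj g s L U) (twist_obj g s L V)"
proof -
  note t' = twistD[OF t] and f' = M0_HomD[OF twistD(2)[OF t] f]
  note U = twist_action[OF t f'(1)] and V = twist_action[OF t f'(2)]
  note u = moduleD[OF t'(2) f'(1)]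
  show ?thesis
    unfolding twist_arr_def f'(3,4)
  proof (rule M0_HomI[OF t'(3) twist_obj_modules[OF t f'(1)] twist_obj_modules[OF t f'(2)]])
    show "shift_arrow g (fn f) \<in> hom (fst (twist_obj g s L U)) (fst (twist_obj g s L V))"
      unfolding fst_twist_obj by (rule shift_arrow_hom[OF t'(1) f'(5)])
    fix l x v assume l: "l \<in> L" and x: "x \<in> carrier G" and "v \<in> fst (twist_obj g s L U) x"
    then have v: "v \<in> fst U (g \<otimes> x)" by simp
    have gx: "g \<otimes> x \<in> carrier G" using t'(1) x by simp
    have vt: "v \<in> total G (fst U)" using gx v by (rule total_component)
    note fv = graded_homD(7)[OF f'(5) gx v]
    show "fn (shift_arrow g (fn f)) (mact (snd (twist_obj g s L U)) l v)
        = mact (snd (twist_obj g s L V)) l (fn (shift_arrow g (fn f)) v)"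
      unfolding shift_arrow_simps U(2)[OF l x v] V(2)[OF l x fv]
        graded_hom_scale[OF f'(5) u(6)[OF t'(4)[OF l] vt]] f'(6)[OF t'(4)[OF l] gx v] ..
  qed
qed

lemma twist_functor:
  assumes t: "twist g s H \<psi> L \<xi>"
  shows "is_functor (MC H \<psi>) (MC L \<xi>) (twist_obj g s L) (twist_arr g s L)"
proof -
  note t' = twistD[OF t]
  have arr: "f \<in> Hom (MC H \<psi>) (src f) (trg f)" if "f \<in> Arr (MC H \<psi>)" for f
    using that by (simp add: Hom_def)
  show ?thesis
    unfolding is_functor_def
  proof (intro conjI ballI impI)
    fix U assume "U \<in> Obj (MC H \<psi>)"
    then show "twist_obj g s L U \<in> Obj (MC L \<xi>)"
      using twist_obj_modules[OF t] by simp
  next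
    fix f assume "f \<in> Arr (MC H \<psi>)"
    from twist_arr_hom[OF t arr[OF this]]
    show "twist_arr g s L f \<in> Hom (MC L \<xi>) (twist_obj g s L (Dom (MC H \<psi>) f))
        (twist_obj g s L (Cod (MC H \<psi>) f))"
      by simp
  next
    fix U assume U: "U \<in> Obj (MC H \<psi>)"
    have "shift_arrow g (idn (fst U)) = idn (shift g (fst U))"
      by (rule arrow_eqI) (simp_all add: shift_arrow_def vec_cat_def total_shift[OF t'(1)])
    then show "twist_arr g s L (Ident (MC H \<psi>) U) = Ident (MC L \<xi>) (twist_obj g s L U)"
      by (simp add: twist_arr_def)
  next
    fix f k assume f: "f \<in> Arr (MC H \<psi>)" and k: "k \<in> Arr (MC H \<psi>)"
        and "Dom (MC H \<psi>) k = Cod (MC H \<psi>) f"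
    note f' = M0_HomD[OF t'(2) arr[OF f]] and k' = M0_HomD[OF t'(2) arr[OF k]]
    have "shift_arrow g (fn k \<odot> fn f) = shift_arrow g (fn k) \<odot> shift_arrow g (fn f)"
      by (rule arrow_eqI) (simp_all add: shift_arrow_def vec_cat_def total_shift[OF t'(1)])
    then show "twist_arr g s L (Comp (MC H \<psi>) k f)
        = Comp (MC L \<xi>) (twist_arr g s L k) (twist_arr g s L f)"
      by (simp add: twist_arr_def)
  qed
qed

text \<open>Shifting back restores the very same spaces, conjugating back restores the group
  element, and \<open>ss\<close> cancels the scalars; hence an equality of objects.\<close>

lemma twist_obj_inverse:
  assumes t: "twist g s H \<psi> L \<xi>" and t2: "twist g' s' L \<xi> H \<psi>" and gg: "g \<otimes> g' = \<one>"
    and ss: "\<And>h x. h \<in> H \<Longrightarrow> x \<in> carrier G \<Longrightarrow> s' h x * s (conj_by G g' h) (g' \<otimes> x) = 1"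
    and U: "U \<in> modules H \<psi>"
  shows "twist_obj g' s' H (twist_obj g s L U) = U"
proof -
  note t' = twistD[OF t] and t2' = twistD[OF t2]
  note u = moduleD[OF t'(2) U] and Hc = subgroup_carrier[OF t'(2)]
  let ?U1 = "twist_obj g s L U"
  let ?U2 = "twist_obj g' s' H ?U1"
  note U1 = twist_obj_modules[OF t U]
  note b = twist_action[OF t U] and c = twist_action[OF t2 U1]
  note v = moduleD[OF t'(3) U1]
  have sh: "shift g' (shift g (fst U)) = fst U"
    by (rule shift_inverse[OF t'(1) t2'(1) gg u(1)])
  then have fst: "fst ?U2 = fst U" by simp
  have "snd ?U2 = snd U"
  proof (rule action_eqI[OF _ u(2) Hc])
    show "snd ?U2 \<in> hom (twisted_space H \<boxtimes> fst U) (fst U)"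
      using c(1) unfolding fst_twist_obj sh .
    fix h x v assume h: "h \<in> H" and x: "x \<in> carrier G" and v: "v \<in> fst U x"
    have hc: "h \<in> carrier G" using h Hc by auto
    have g'x: "g' \<otimes> x \<in> carrier G" using t2'(1) x by simp
    have ggx: "g \<otimes> (g' \<otimes> x) = x" using gg t'(1) t2'(1) x by (simp add: m_assoc[symmetric])
    have v1: "v \<in> fst ?U1 (g' \<otimes> x)" using v g'x ggx by simp
    have v2: "v \<in> fst U (g \<otimes> (g' \<otimes> x))" using v ggx by simp
    show "mact (snd ?U2) h v = mact (snd U) h v"
      unfolding c(2)[OF h x v1] b(2)[OF t2'(4)[OF h] g'x v2]
        conj_by_cancel[OF t'(1) t2'(1) gg hc] vec.scale_scale ss[OF h x] by simp
  qed
  with fst show ?thesis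
    by (simp add: prod_eq_iff)
qed

lemma twist_arr_inverse:
  assumes t: "twist g s H \<psi> L \<xi>" and t2: "twist g' s' L \<xi> H \<psi>" and gg: "g \<otimes> g' = \<one>"
    and ss: "\<And>h x. h \<in> H \<Longrightarrow> x \<in> carrier G \<Longrightarrow> s' h x * s (conj_by G g' h) (g' \<otimes> x) = 1"
    and f: "f \<in> Arr (MC H \<psi>)"
  shows "twist_arr g' s' H (twist_arr g s L f) = f"
proof -
  have "f \<in> Hom (MC H \<psi>) (src f) (trg f)"
    using f by (simp add: Hom_def)
  note f' = M0_HomD[OF twistD(2)[OF t] this]
  have obj: "twist_obj g' s' H (twist_obj g s L U) = U" if "U \<in> modules H \<psi>" for U
    by (rule twist_obj_inverse[OF t t2 gg ss that])
  note sh = shift_inverse[OF twistD(1)[OF t] twistD(1)[OF t2] gg]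
  have "shift_arrow g' (shift_arrow g (fn f)) = fn f"
    using sh[OF graded_homD(3)[OF f'(5)]] sh[OF graded_homD(4)[OF f'(5)]] graded_homD(1,2)[OF f'(5)]
    by (auto intro!: arrow_eqI)
  then show ?thesis
    using obj[OF f'(1)] obj[OF f'(2)] by (auto intro!: arrow_eqI simp: twist_arr_def)
qed

lemma twist_equivalence:
  assumes t: "twist g s H \<psi> L \<xi>" and t2: "twist g' s' L \<xi> H \<psi>"
    and gg: "g \<otimes> g' = \<one>" "g' \<otimes> g = \<one>"
    and ss: "\<And>h x. h \<in> H \<Longrightarrow> x \<in> carrier G \<Longrightarrow> s' h x * s (conj_by G g' h) (g' \<otimes> x) = 1"
      "\<And>l x. l \<in> L \<Longrightarrow> x \<in> carrier G \<Longrightarrow> s l x * s' (conj_by G g l) (g \<otimes> x) = 1"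
  shows "is_equivalence (MC H \<psi>) (MC L \<xi>) (twist_obj g s L) (twist_arr g s L)"
  by (rule strict_equivalence[OF cat_M0[OF twistD(2)[OF t]] cat_M0[OF twistD(3)[OF t]]
      twist_functor[OF t] twist_functor[OF t2]])
    (simp_all add: twist_obj_inverse[OF t t2 gg(1) ss(1)] twist_obj_inverse[OF t2 t gg(2) ss(2)]
      twist_arr_inverse[OF t t2 gg(1) ss(1)] twist_arr_inverse[OF t2 t gg(2) ss(2)])


text \<open>If a module is viewed as the product of a simple object of degree \<open>g\<close> with
  its shift, moving the bracket in its product with \<open>X\<close> is an associator with first
  degree \<open>g\<close>; this is the origin of the scalar.\<close>

definition twist_zeta where
  "twist_zeta g s H \<psi> L \<xi> U X
      = Arrow (twist_obj g s L (mod_act H \<psi> U X)) (mod_act L \<xi> (twist_obj g s L U) X)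
     (diag (shift g (fst U)) X (\<lambda>z y. inverse (\<omega> g z y)))"

text \<open>The hypothesis \<open>comp\<close> is the equivariance of the constraint on pure
  tensors. Its compatibility with the associativity constraints is the pentagon at \<open>g\<close>
  and the three degrees, that with the unit constraints the normalization of \<omega>.\<close>

lemma twist_module_functor:
  assumes t: "twist g s H \<psi> L \<xi>"
    and comp: "\<And>l z y. l \<in> L \<Longrightarrow> z \<in> carrier G \<Longrightarrow> y \<in> carrier G \<Longrightarrow>
      inverse (\<omega> g (l \<otimes> z) y) * s l (z \<otimes> y) * \<omega> (conj_by G g l) (g \<otimes> z) y
        = inverse (\<omega> g z y) * \<omega> l z y * s l z"
  shows "is_module_functor (vec_cat G \<omega>) (MC H \<psi>) (MC L \<xi>) (twist_obj g s L) (twist_arr g s L)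
    (twist_zeta g s H \<psi> L \<xi>)"
proof -
  note t' = twistD[OF t]
  note g = t'(1) and H = t'(2) and L = t'(3)
  let ?c = "\<lambda>z y. inverse (\<omega> g z y)" and ?F = "twist_obj g s L" and ?Fa = "twist_arr g s L"
  let ?\<zeta> = "twist_zeta g s H \<psi> L \<xi>"
  have nz: "\<omega> g z y \<noteq> 0" if "z \<in> carrier G" "y \<in> carrier G" for z y
    by (rule omega_nonzero[OF g that])
  have \<zeta>_hom: "?\<zeta> U X \<in> Hom (MC L \<xi>) (?F (mod_act H \<psi> U X)) (mod_act L \<xi> (?F U) X)"
    and \<zeta>_iso: "iso_arrow (MC L \<xi>) (?\<zeta> U X)"
    if U: "U \<in> modules H \<psi>" and X: "X \<in> spaces" for U X
  proof -
    note u = moduleD[OF H U]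
    note UX = mod_act[OF H U X] and FU = twist_obj_modules[OF t U]
    note FUX = mod_act[OF L FU X] and F_UX = twist_obj_modules[OF t UX(1)]
    note S = shift_space[OF g u(1)]
    note b = twist_action[OF t U] and bX = twist_action[OF t UX(1)]
    let ?S = "shift g (fst U)"
    let ?d = "diag ?S X ?c"
    have d: "?d \<in> hom (?S \<boxtimes> X) (?S \<boxtimes> X)"
      by (rule diag_hom[OF S X])
    have src: "fst (?F (mod_act H \<psi> U X)) = ?S \<boxtimes> X" and trg: "fst (mod_act L \<xi> (?F U) X) = ?S \<boxtimes> X"
      by (simp_all add: shift_tensor[OF g])
    have d': "?d \<in> hom (?S \<boxtimes> X) (fst (mod_act L \<xi> (?F U) X))"
      unfolding trg by (rule d)
    have pure: "fn ?d (mact (snd (?F (mod_act H \<psi> U X))) l (pure_tensor v w))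
        = mact (snd (mod_act L \<xi> (?F U) X)) l (fn ?d (pure_tensor v w))"
      if l: "l \<in> L" and z: "z \<in> carrier G" and y: "y \<in> carrier G" and v: "v \<in> ?S z"
          and w: "w \<in> X y" for l z y v w
    proof -
      have v': "v \<in> fst U (g \<otimes> z)" using v z by simp
      have gz: "g \<otimes> z \<in> carrier G" and zy: "z \<otimes> y \<in> carrier G" using g z y by simp_all
      have lz: "l \<otimes> z \<in> carrier G" using l subgroup_carrier[OF L] z by auto
      let ?l = "conj_by G g l"
      have lv: "mact (snd U) ?l v \<in> fst U (g \<otimes> (l \<otimes> z))"
        using u(5)[OF t'(4)[OF l] gz v'] unfolding twist_degree[OF t l z] .
      then have lvS: "mact (snd U) ?l v \<in> ?S (l \<otimes> z)"
        using lz by simp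
      have p1: "pure_tensor v w \<in> fst (mod_act H \<psi> U X) (g \<otimes> (z \<otimes> y))"
        using tensor_component[where V = "fst U" and W = X, OF gz y v' w] g z y
            by (simp add: m_assoc)
      have wt: "w \<in> total G X" using y w by (rule total_component)
      have lvt: "mact (snd U) ?l v \<in> total G ?S" using lz lvS by (rule total_component)
      have vt: "v \<in> total G ?S" using z v by (rule total_component)
      have p2: "pure_tensor (mact (snd U) ?l v) w \<in> total G (?S \<boxtimes> X)"
        by (rule pure_total[OF lvt wt])
      have p3: "pure_tensor v w \<in> total G (?S \<boxtimes> X)"
        by (rule pure_total[OF vt wt])
      have vF: "v \<in> fst (?F U) z" using v by simp
      have "fn ?d (mact (snd (?F (mod_act H \<psi> U X))) l (pure_tensor v w))
          = scale (inverse (\<omega> g (l \<otimes> z) y) * s l (z \<otimes> y) * \<omega> ?l (g \<otimes> z) y)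
              (pure_tensor (mact (snd U) ?l v) w)"
        unfolding bX(2)[OF l zy p1] UX(2)[OF t'(4)[OF l] gz y v' w] vec.scale_scale
          graded_hom_scale[OF d p2] diag_apply[OF S X lz y lvS w] by (simp add: ac_simps)
      also have "\<dots> = scale (?c z y) (scale (\<omega> l z y) (pure_tensor (mact (snd (?F U)) l v) w))"
        unfolding comp[OF l z y] b(2)[OF l z v'] pure_scale_left vec.scale_scale
            by (simp add: ac_simps)
      also have "\<dots> = scale (?c z y) (mact (snd (mod_act L \<xi> (?F U) X)) l (pure_tensor v w))"
        unfolding FUX(2)[OF l z y vF w] ..
      also have "\<dots> = mact (snd (mod_act L \<xi> (?F U) X)) l (fn ?d (pure_tensor v w))"
        unfolding diag_apply[OF S X z y v w] using moduleD(7)[OF L FUX(1) l] p3 by (simp add: trg)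
      finally show ?thesis .
    qed
    show hom: "?\<zeta> U X \<in> Hom (MC L \<xi>) (?F (mod_act H \<psi> U X)) (mod_act L \<xi> (?F U) X)"
      unfolding twist_zeta_def
    proof (rule M0_HomI[OF L F_UX FUX(1)])
      show "?d \<in> hom (fst (?F (mod_act H \<psi> U X))) (fst (mod_act L \<xi> (?F U) X))"
        unfolding src trg by (rule d)
      fix l x v assume *: "l \<in> L" "x \<in> carrier G" "v \<in> fst (?F (mod_act H \<psi> U X)) x"
      show "fn ?d (mact (snd (?F (mod_act H \<psi> U X))) l v)
          = mact (snd (mod_act L \<xi> (?F U) X)) l (fn ?d v)"
        by (rule equivariant_tensorI[OF L F_UX FUX(1) src d' *(1) pure[OF *(1)] *(2)])
          (use d *(3) in \<open>simp_all only: src trg\<close>)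
    qed
    have c1: "?c z y * \<omega> g z y = 1" "\<omega> g z y * ?c z y = 1" if "z \<in> carrier G" "y \<in> carrier G"
        for z y
      using nz[OF that] by simp_all
    show "iso_arrow (MC L \<xi>) (?\<zeta> U X)"
      by (rule M0_iso[OF L hom, of "diag ?S X (\<omega> g)"])
        (simp_all add: twist_zeta_def shift_tensor[OF g] diag_hom[OF S X] diag_inverse[OF S X] c1)
  qed
  show ?thesis
    unfolding is_module_functor_def
  proof (intro conjI ballI)
    show "is_functor (MC H \<psi>) (MC L \<xi>) ?F ?Fa"
      by (rule twist_functor[OF t])
  next
    fix U X assume "U \<in> Obj (MC H \<psi>)" "X \<in> Obj (vec_cat G \<omega>)"
    then show "?\<zeta> U X \<in> Hom (MC L \<xi>) (?F (act_obj (MC H \<psi>) U X)) (act_obj (MC L \<xi>) (?F U) X)"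
      "iso_arrow (MC L \<xi>) (?\<zeta> U X)"
      using \<zeta>_hom \<zeta>_iso by simp_all
  next
    fix f h assume "f \<in> Arr (MC H \<psi>)" "h \<in> Arr (vec_cat G \<omega>)"
    then obtain U V X Y where f: "f \<in> Hom (MC H \<psi>) U V" and h: "h \<in> hom X Y"
      using hom_arrow by (auto simp: Hom_def)
    note f' = M0_HomD[OF H f] and h' = graded_homD[OF h]
    note u = moduleD[OF H f'(1)] and v = moduleD[OF H f'(2)]
    note SU = shift_space[OF g u(1)] and SV = shift_space[OF g v(1)]
    let ?SU = "shift g (fst U)" and ?SV = "shift g (fst V)"
    note sf = shift_arrow_hom[OF g f'(5)]
    note fh = tens_hom[OF f'(5) h] and sfh = tens_hom[OF sf h]
    have sh: "shift_arrow g (fn f \<otimes>\<otimes> h) \<in> hom (?SU \<boxtimes> X) (?SV \<boxtimes> Y)"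
      using shift_arrow_hom[OF g fh] unfolding shift_tensor[OF g] .
    note dU = diag_hom[OF SU h'(3), of ?c] and dV = diag_hom[OF SV h'(4), of ?c]
    have "diag ?SV Y ?c \<odot> shift_arrow g (fn f \<otimes>\<otimes> h) = (shift_arrow g (fn f) \<otimes>\<otimes> h) \<odot> diag ?SU X ?c"
    proof (rule tensor_hom_eqI[OF cc_hom[OF sh dV] cc_hom[OF dU sfh]])
      fix z y a b assume *: "z \<in> carrier G" "y \<in> carrier G" "a \<in> ?SU z" "b \<in> X y"
      have a: "a \<in> total G ?SU" using *(1,3) by (rule total_component)
      then have a': "a \<in> total G (fst U)" by (simp add: total_shift[OF g])
      have b: "b \<in> total G X" using *(2,4) by (rule total_component)
      note p = pure_total[OF a b]
      note fa = graded_homD(7)[OF sf *(1,3), unfolded shift_arrow_simps]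
      note hb = graded_homD(7)[OF h *(2,4)]
      show "fn (diag ?SV Y ?c \<odot> shift_arrow g (fn f \<otimes>\<otimes> h)) (pure_tensor a b)
          = fn ((shift_arrow g (fn f) \<otimes>\<otimes> h) \<odot> diag ?SU X ?c) (pure_tensor a b)"
        unfolding cc_apply[OF sh p] cc_apply[OF dU p] shift_arrow_simps tens_apply[OF f'(5) h a' b]
          diag_apply[OF SV h'(4) *(1,2) fa hb] diag_apply[OF SU h'(3) *]
          graded_hom_scale[OF sfh p] tens_apply[OF sf h a b] ..
    qed
    then show "Comp (MC L \<xi>) (?\<zeta> (Cod (MC H \<psi>) f) (Cod (vec_cat G \<omega>) h))
        (?Fa (act_arr (MC H \<psi>) f h))
        = Comp (MC L \<xi>) (act_arr (MC L \<xi>) (?Fa f) h) (?\<zeta> (Dom (MC H \<psi>) f) (Dom (vec_cat G \<omega>) h))"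
      using f'(3,4) h'(1,2) by (simp add: twist_zeta_def twist_arr_def)
  next
    fix U X Y assume "U \<in> Obj (MC H \<psi>)" "X \<in> Obj (vec_cat G \<omega>)" "Y \<in> Obj (vec_cat G \<omega>)"
    then have U: "U \<in> modules H \<psi>" and X: "X \<in> spaces" and Y: "Y \<in> spaces" by simp_all
    note u = moduleD[OF H U] note M = u(1)
    note S = shift_space[OF g M]
    let ?S = "shift g (fst U)"
    note SX = tensor_space[OF S X] and XY = tensor_space[OF X Y]
    note as = asc'_hom[OF M X Y] and as' = asc'_hom[OF S X Y]
    have sas: "shift_arrow g (asc' (fst U) X Y) \<in> hom (?S \<boxtimes> (X \<boxtimes> Y)) (?S \<boxtimes> X \<boxtimes> Y)"
      using shift_arrow_hom[OF g as] unfolding shift_tensor[OF g] .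
    note d1 = diag_hom[OF SX Y, of ?c] and d2 = diag_hom[OF S X, of ?c] and d3
        = diag_hom[OF S XY, of ?c]
    note d2Y = tens_hom[OF d2 idn_hom[OF Y]]
    note r1 = cc_hom[OF sas d1]
    have "(diag ?S X ?c \<otimes>\<otimes> idn Y) \<odot> diag (?S \<boxtimes> X) Y ?c \<odot> shift_arrow g (asc' (fst U) X Y)
        = asc' ?S X Y \<odot> diag ?S (X \<boxtimes> Y) ?c"
    proof (rule tensor3_hom_eqI'[OF cc_hom[OF r1 d2Y] cc_hom[OF d3 as']])
      fix z x y v a b assume *: "z \<in> carrier G" "x \<in> carrier G" "y \<in> carrier G" "v \<in> ?S z"
          "a \<in> X x" "b \<in> Y y"
      have v': "v \<in> fst U (g \<otimes> z)" using * by simp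
      have gz: "g \<otimes> z \<in> carrier G" using g * by simp
      have v: "v \<in> total G ?S" using *(1,4) by (rule total_component)
      have a: "a \<in> total G X" using *(2,5) by (rule total_component)
      have b: "b \<in> total G Y" using *(3,6) by (rule total_component)
      have va: "pure_tensor v a \<in> (?S \<boxtimes> X) (z \<otimes> x)"
        by (rule tensor_component[where V = ?S and W = X, OF *(1,2,4,5)])
      have zx: "z \<otimes> x \<in> carrier G" and xy: "x \<otimes> y \<in> carrier G" using * by simp_all
      have ab: "pure_tensor a b \<in> (X \<boxtimes> Y) (x \<otimes> y)"
        by (rule tensor_component[where V = X and W = Y, OF *(2,3,5,6)])
      note p = pure_total[OF v pure_total[OF a b]] and q = pure_total[OF pure_total[OF v a] b]
      note pva = pure_total[OF v a]
      have eq: "\<omega> (g \<otimes> z) x y * inverse (\<omega> g (z \<otimes> x) y) * inverse (\<omega> g z x)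
          = inverse (\<omega> g z (x \<otimes> y)) * \<omega> z x y"
        using pentagon[OF g *(1-3)] nz[OF *(1) xy] nz[OF zx *(3)] nz[OF *(1,2)]
        by (simp add: field_simps)
      show "fn ((diag ?S X ?c \<otimes>\<otimes> idn Y) \<odot> diag (?S \<boxtimes> X) Y ?c \<odot> shift_arrow g (asc' (fst U) X Y))
          (pure_tensor v (pure_tensor a b))
          = fn (asc' ?S X Y \<odot> diag ?S (X \<boxtimes> Y) ?c) (pure_tensor v (pure_tensor a b))"
        unfolding cc_apply[OF r1 p] cc_apply[OF sas p] cc_apply[OF d3 p] shift_arrow_simps
          asc'_apply[OF M X Y gz *(2,3) v' *(5,6)] graded_hom_scale[OF d1 q]
          diag_apply[OF SX Y zx *(3) va *(6)] vec.scale_scale graded_hom_scale[OF d2Y q]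
          tens_apply[OF d2 idn_hom[OF Y] pva b] diag_apply[OF S X *(1,2,4,5)] idn_apply[OF b]
              pure_scale_left
          diag_apply[OF S XY *(1) xy *(4) ab] graded_hom_scale[OF as' p] asc'_apply[OF S X Y *]
        by (simp add: eq)
    qed
    then show "Comp (MC L \<xi>) (act_arr (MC L \<xi>) (?\<zeta> U X) (Ident (vec_cat G \<omega>) Y))
        (Comp (MC L \<xi>) (?\<zeta> (act_obj (MC H \<psi>) U X) Y) (?Fa (act_assoc (MC H \<psi>) U X Y)))
      = Comp (MC L \<xi>) (act_assoc (MC L \<xi>) (?F U) X Y) (?\<zeta> U (tens_obj (vec_cat G \<omega>) X Y))"
      using graded_homD(1,2)[OF idn_hom[OF Y]]
      by (simp add: twist_zeta_def twist_arr_def shift_tensor[OF g])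
  next
    fix U assume "U \<in> Obj (MC H \<psi>)"
    then have U: "U \<in> modules H \<psi>" by simp
    note u = moduleD[OF H U] note M = u(1)
    note S = shift_space[OF g M]
    let ?S = "shift g (fst U)"
    note r = runit_hom[OF M] and rS = runit_hom[OF S]
    have sr: "shift_arrow g (runit (vec_cat G \<omega>) (fst U)) \<in> hom (?S \<boxtimes> graded_unit G) ?S"
      using shift_arrow_hom[OF g r] unfolding shift_tensor[OF g] .
    note d = diag_hom[OF S unit_space, of ?c]
    have "runit (vec_cat G \<omega>) ?S \<odot> diag ?S (graded_unit G) ?c
        = shift_arrow g (runit (vec_cat G \<omega>) (fst U))"
    proof (rule tensor_hom_eqI[OF cc_hom[OF d rS] sr])
      fix z y v and e :: "('g, 'k) vec" assume *: "z \<in> carrier G" "y \<in> carrier G" "v \<in> ?S z"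
          "e \<in> graded_unit G y"
      obtain k where k: "e = scale k uv"
        using *(4) by (rule graded_unitE)
      have v: "v \<in> total G ?S" using *(1,3) by (rule total_component)
      then have v': "v \<in> total G (fst U)" by (simp add: total_shift[OF g])
      have uv1: "uv \<in> graded_unit G \<one>" by (simp add: graded_unit_def vec.span_base)
      note p = pure_total[OF v uv_total]
      show "fn (runit (vec_cat G \<omega>) ?S \<odot> diag ?S (graded_unit G) ?c) (pure_tensor v e)
          = fn (shift_arrow g (runit (vec_cat G \<omega>) (fst U))) (pure_tensor v e)"
        unfolding k pure_scale_right graded_hom_scale[OF cc_hom[OF d rS] p]
            graded_hom_scale[OF r pure_total[OF v' uv_total]]
          cc_apply[OF d p] diag_apply[OF S unit_space *(1) one_closed *(3) uv1]
              graded_hom_scale[OF rS p]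
          runit_apply[OF S v] shift_arrow_simps runit_apply[OF M v'] omega_one(3)[OF g *(1)] by simp
    qed
    then show "Comp (MC L \<xi>) (act_unit (MC L \<xi>) (?F U)) (?\<zeta> U (unit_obj (vec_cat G \<omega>)))
        = ?Fa (act_unit (MC H \<psi>) U)"
      by (simp add: twist_zeta_def twist_arr_def)
  qed
qed

text \<open>
  The values of \<open>\<omega>\<close> arise from moving the simple object of degree \<open>g\<close> past \<open>l\<close> when the original
  module is written as its product with the shifted one.
\<close>

definition twist_scalar :: "'g \<Rightarrow> ('g \<Rightarrow> 'k) \<Rightarrow> 'g \<Rightarrow> 'g \<Rightarrow> 'k" where
  "twist_scalar g \<eta> l x = \<omega> g l x / (\<omega> (conj_by G g l) g x * \<eta> l)"

text \<open>With \<open>h\<close>, \<open>k\<close> the conjugates of \<open>l\<close>,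
  \<open>m\<close>, the first claim combines the pentagons at (\<open>g\<close>, \<open>l\<close>,
  \<open>m\<close>, \<open>x\<close>), (\<open>h\<close>, \<open>g\<close>, \<open>m\<close>,
  \<open>x\<close>) and (\<open>h\<close>, \<open>k\<close>, \<open>g\<close>, \<open>x\<close>), in
  which \<open>g\<close> stands before, between and after the group elements, with the coboundary
  relation for \<eta>. The second claim combines the first two, with \<open>z\<close>,
  \<open>y\<close> in place of \<open>m\<close>, \<open>x\<close>.\<close>

lemma cochain_twist:
  assumes g: "g \<in> carrier G" and H: "subgroup H G" and L: "subgroup L G" and HL: "H
      = conj_by G g ` L"
    and \<eta>: "\<And>l. l \<in> L \<Longrightarrow> \<eta> l \<noteq> 0" "\<eta> \<one> = 1"
    and cob: "\<And>l m. l \<in> L \<Longrightarrow> m \<in> L \<Longrightarrow>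
      conj_cochain G \<psi> g l m * Omega G \<omega> g l m * \<eta> (l \<otimes> m) = \<xi> l m * \<eta> l * \<eta> m"
  shows "twist g (twist_scalar g \<eta>) H \<psi> L \<xi>"
    and "\<And>l z y. l \<in> L \<Longrightarrow> z \<in> carrier G \<Longrightarrow> y \<in> carrier G \<Longrightarrow>
      inverse (\<omega> g (l \<otimes> z) y) * twist_scalar g \<eta> l (z \<otimes> y) * \<omega> (conj_by G g l) (g \<otimes> z) y
        = inverse (\<omega> g z y) * \<omega> l z y * twist_scalar g \<eta> l z"
proof -
  let ?s = "twist_scalar g \<eta>"
  note Lc = subgroup_carrier[OF L]
  show "twist g ?s H \<psi> L \<xi>"
    unfolding twist_def
  proof (intro conjI ballI g H L)
    show "conj_by G g ` L \<subseteq> H" using HL by simp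
    fix x assume "x \<in> carrier G"
    then show "?s \<one> x = 1" using g \<eta>(2) by (simp add: twist_scalar_def)
  next
    fix l m x assume l: "l \<in> L" and m: "m \<in> L" and x: "x \<in> carrier G"
    have lc: "l \<in> carrier G" and mc: "m \<in> carrier G" using l m Lc by auto
    have lm: "l \<otimes> m \<in> L" using L l m by (rule subgroup.m_closed)
    define h k where "h = conj_by G g l" and "k = conj_by G g m"
    have hc: "h \<in> carrier G" and kc: "k \<in> carrier G" using g lc mc by (auto simp: h_def k_def)
    have hg: "h \<otimes> g = g \<otimes> l" and kg: "k \<otimes> g = g \<otimes> m"
      using conj_by_shift[OF g] lc mc by (simp_all add: h_def k_def)
    have hk: "conj_by G g (l \<otimes> m) = h \<otimes> k"
      using conj_by_mult[OF g lc mc] by (simp add: h_def k_def)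
    \<comment> \<open>Opaque names turn the goal into an identity between monomials.\<close>
    define A B Cc D E F K M N P Q R S where
      "A = \<omega> l m x" and "B = \<omega> g (l \<otimes> m) x" and "Cc = \<omega> g l m" and "D = \<omega> (g \<otimes> l) m x" and
      "E = \<omega> g l (m \<otimes> x)" and "F = \<omega> g m x" and "K = \<omega> h (g \<otimes> m) x" and "M = \<omega> h g m" and
      "N = \<omega> h g (m \<otimes> x)" and "P = \<omega> k g x" and "Q = \<omega> h k g" and "R = \<omega> (h \<otimes> k) g x" and
      "S = \<omega> h k (g \<otimes> x)"
    note defs = A_def B_def Cc_def D_def E_def F_def K_def M_def N_def P_def Q_def R_def S_def
    have p1: "A * B * Cc = D * E"
      unfolding defs by (rule pentagon[OF g lc mc x])
    have p2: "F * K * M = D * N"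
      using pentagon[OF hc g mc x] unfolding defs hg .
    have p3: "P * K * Q = R * S"
      using pentagon[OF hc kc g x] unfolding defs kg .
    have nz: "M \<noteq> 0" "N \<noteq> 0" "P \<noteq> 0" "Q \<noteq> 0" "R \<noteq> 0" "Cc \<noteq> 0"
      unfolding defs using g lc mc hc kc x by (simp_all add: omega_nonzero)
    let ?p = "\<psi> h k"
    have c: "?p * Q * Cc * \<eta> (l \<otimes> m) = \<xi> l m * M * \<eta> l * \<eta> m"
      using cob[OF l m] nz(1) unfolding conj_cochain_def Omega_def h_def[symmetric] k_def[symmetric]
        Q_def[symmetric] Cc_def[symmetric] M_def[symmetric] by (simp add: field_simps)
    \<comment> \<open>The goal cleared of denominators, multiplied by \<open>Q * Cc\<close> so that
      the relation \<open>c\<close> and the three pentagons can be substituted one after another;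
      the extra factor is nonzero and cancels at the end.\<close>
    have "(F * E * S * ?p * R * \<eta> (l \<otimes> m)) * (Q * Cc)
        = (R * S) * (?p * Q * Cc * \<eta> (l \<otimes> m)) * (F * E)"
      by (simp only: ac_simps)
    also have "\<dots> = (F * K * M) * (P * Q * \<xi> l m * \<eta> l * \<eta> m * E)"
      unfolding c p3[symmetric] by (simp only: ac_simps)
    also have "\<dots> = (D * E) * (N * P * Q * \<xi> l m * \<eta> l * \<eta> m)"
      unfolding p2 by (simp only: ac_simps)
    also have "\<dots> = (A * \<xi> l m * B * (P * \<eta> m) * (N * \<eta> l)) * (Q * Cc)"
      unfolding p1[symmetric] by (simp only: ac_simps)
    finally have key: "F * E * S * ?p * R * \<eta> (l \<otimes> m) = A * \<xi> l m * B * (P * \<eta> m) * (N * \<eta> l)"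
      using nz by simp
    have "F / (P * \<eta> m) * (E / (N * \<eta> l)) * S * ?p = A * \<xi> l m * (B / (R * \<eta> (l \<otimes> m)))"
      using key nz \<eta>(1)[OF l] \<eta>(1)[OF m] \<eta>(1)[OF lm]
          by (simp add: divide_simps) (simp add: ac_simps)
    then show "?s m x * ?s l (m \<otimes> x) * \<omega> (conj_by G g l) (conj_by G g m) (g \<otimes> x) * conj_cochain G
        \<psi> g l m
        = \<omega> l m x * \<xi> l m * ?s (l \<otimes> m) x"
      unfolding defs twist_scalar_def conj_cochain_def hk h_def[symmetric] k_def[symmetric] .
  qed
  fix l z y assume l: "l \<in> L" and z: "z \<in> carrier G" and y: "y \<in> carrier G"
  have lc: "l \<in> carrier G" using l Lc by auto
  define h where "h = conj_by G g l"
  have hc: "h \<in> carrier G" using g lc by (auto simp: h_def)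
  have hg: "h \<otimes> g = g \<otimes> l"
    using conj_by_shift[OF g lc] by (simp add: h_def)
  define A B Cc D E F K M N where
    "A = \<omega> l z y" and "B = \<omega> g (l \<otimes> z) y" and "Cc = \<omega> g l z" and "D = \<omega> (g \<otimes> l) z y" and
    "E = \<omega> g l (z \<otimes> y)" and "F = \<omega> g z y" and "K = \<omega> h (g \<otimes> z) y" and "M = \<omega> h g z" and
    "N = \<omega> h g (z \<otimes> y)"
  note defs = A_def B_def Cc_def D_def E_def F_def K_def M_def N_def
  have p1: "A * B * Cc = D * E"
    unfolding defs by (rule pentagon[OF g lc z y])
  have p2: "F * K * M = D * N"
    using pentagon[OF hc g z y] unfolding defs hg .
  have nz: "B \<noteq> 0" "D \<noteq> 0" "F \<noteq> 0" "M \<noteq> 0" "N \<noteq> 0"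
    unfolding defs using g lc hc z y by (simp_all add: omega_nonzero)
  \<comment> \<open>The value \<open>D\<close> is common to the two pentagons because
    \<open>h \<otimes> g = g \<otimes> l\<close>; multiplying by it links them.\<close>
  have "E * K * F * M * D = (D * E) * (F * K * M)"
    by (simp only: ac_simps)
  also have "\<dots> = A * Cc * B * N * D"
    unfolding p1[symmetric] p2 by (simp only: ac_simps)
  finally have key: "E * K * F * M = A * Cc * B * N"
    using nz by simp
  have "inverse B * (E / (N * \<eta> l)) * K = inverse F * A * (Cc / (M * \<eta> l))"
    using key nz \<eta>(1)[OF l] by (simp add: divide_simps) (simp add: ac_simps)
  then show "inverse (\<omega> g (l \<otimes> z) y) * ?s l (z \<otimes> y) * \<omega> (conj_by G g l) (g \<otimes> z) y
        = inverse (\<omega> g z y) * \<omega> l z y * ?s l z"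
    unfolding defs twist_scalar_def h_def[symmetric] .
qed

text \<open>The equation at \<open>h\<close>, \<open>k\<close>, \<open>x\<close> is the given one at
  the conjugates of \<open>h\<close>, \<open>k\<close> by \<open>inv g\<close> and at
  \<open>inv g \<otimes> x\<close>, with the scalars \<open>s\<close> moved to the other
  side.\<close>

lemma twist_symmetric:
  assumes t: "twist g s H \<psi> L \<xi>" and HL: "H = conj_by G g ` L"
    and nz: "\<And>l x. l \<in> L \<Longrightarrow> x \<in> carrier G \<Longrightarrow> s l x \<noteq> 0"
  shows "twist (inv g) (\<lambda>h x. inverse (s (conj_by G (inv g) h) (inv g \<otimes> x))) L \<xi> H \<psi>"
      (is "twist ?g ?s L \<xi> H \<psi>")
proof -
  note t' = twistD[OF t]
  note g = t'(1) and H = t'(2) and L = t'(3)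
  have g': "inv g \<in> carrier G" using g by simp
  have conj_back: "conj_by G (inv g) (conj_by G g l) = l" if "l \<in> carrier G" for l
    using conj_by_cancel[OF g' g _ that] g by simp
  note Lc = subgroup_carrier[OF L] and Hc = subgroup_carrier[OF H]
  show ?thesis
    unfolding twist_def
  proof (intro conjI ballI g' H L)
    show "conj_by G ?g ` H \<subseteq> L"
      using HL conj_back Lc by auto
    fix x assume "x \<in> carrier G"
    then show "?s \<one> x = 1" using g t'(5) by simp
  next
    fix h k x assume h: "h \<in> H" and k: "k \<in> H" and x: "x \<in> carrier G"
    obtain l where l: "l \<in> L" "h = conj_by G g l" using h HL by auto
    obtain m where m: "m \<in> L" "k = conj_by G g m" using k HL by auto
    have lc: "l \<in> carrier G" and mc: "m \<in> carrier G" using l m Lc by auto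
    have lm: "l \<otimes> m \<in> L" using L l(1) m(1) by (rule subgroup.m_closed)
    have hk: "h \<otimes> k = conj_by G g (l \<otimes> m)"
      using conj_by_mult[OF g lc mc] l m by simp
    define x' where "x' = inv g \<otimes> x"
    have x': "x' \<in> carrier G" and gx': "g \<otimes> x' = x" using g x by (simp_all add: x'_def)
    have "inv g \<otimes> (k \<otimes> x) = inv g \<otimes> (k \<otimes> g \<otimes> x')"
      using gx' g x' k Hc by (simp add: m_assoc subsetD)
    also have "\<dots> = m \<otimes> x'"
      unfolding m(2) conj_by_shift[OF g mc] using g x' mc by (simp add: m_assoc)
    finally have kx: "inv g \<otimes> (k \<otimes> x) = m \<otimes> x'" .
    have mx: "m \<otimes> x' \<in> carrier G" using mc x' by simp
    have eq: "s m x' * s l (m \<otimes> x') * \<omega> h k x * \<psi> h k = \<omega> l m x' * \<xi> l m * s (l \<otimes> m) x'"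
      using t'(6)[OF l(1) m(1) x'] unfolding l(2)[symmetric] m(2)[symmetric] gx' .
    have "inverse (s m x') * inverse (s l (m \<otimes> x')) * \<omega> l m x' * \<xi> l m
        = \<omega> h k x * \<psi> h k * inverse (s (l \<otimes> m) x')"
      using eq nz[OF m(1) x'] nz[OF l(1) mx] nz[OF lm x'] by (simp add: field_simps)
    then show "?s k x * ?s h (k \<otimes> x) * \<omega> (conj_by G ?g h) (conj_by G ?g k) (?g \<otimes> x) * conj_cochain
        G \<xi> ?g h k
        = \<omega> h k x * \<psi> h k * ?s (h \<otimes> k) x"
      unfolding conj_cochain_def hk kx conj_back[OF m_closed[OF lc mc]]
      unfolding l(2) m(2) conj_back[OF lc] conj_back[OF mc]
          unfolding x'_def l(2)[symmetric] m(2)[symmetric] .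
  qed
qed

theorem equivalent_if_cohomologous:
  assumes g: "g \<in> carrier G" and H: "subgroup H G" and L: "subgroup L G" and HL: "H
      = conj_by G g ` L"
    and \<eta>: "\<And>l. l \<in> L \<Longrightarrow> \<eta> l \<noteq> 0" "\<eta> \<one> = 1"
    and cob: "\<And>l m. l \<in> L \<Longrightarrow> m \<in> L \<Longrightarrow>
      conj_cochain G \<psi> g l m * Omega G \<omega> g l m * \<eta> (l \<otimes> m) = \<xi> l m * \<eta> l * \<eta> m"
  shows "module_equivalent (vec_cat G \<omega>) (MC H \<psi>) (MC L \<xi>)"
proof -
  define s where "s = twist_scalar g \<eta>"
  \<comment> \<open>Reciprocals of the scalars of the first twist, transported to \<open>H\<close>;
    with them the two functors are mutually inverse.\<close>
  define s' where "s' h x = inverse (s (conj_by G (inv g) h) (inv g \<otimes> x))" for h x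
  have t: "twist g s H \<psi> L \<xi>"
    unfolding s_def
    by (rule cochain_twist(1)[OF g H L HL]) (erule \<eta>(1), rule \<eta>(2), erule (1) cob)
  have comp: "inverse (\<omega> g (l \<otimes> z) y) * s l (z \<otimes> y) * \<omega> (conj_by G g l) (g \<otimes> z) y
      = inverse (\<omega> g z y) * \<omega> l z y * s l z" if "l \<in> L" "z \<in> carrier G" "y \<in> carrier G" for l z y
    unfolding s_def
    by (rule cochain_twist(2)[OF g H L HL _ _ _ that]) (erule \<eta>(1), rule \<eta>(2), erule (1) cob)
  note Lc = subgroup_carrier[OF L]
  have nz: "s l x \<noteq> 0" if "l \<in> L" "x \<in> carrier G" for l x
    unfolding s_def twist_scalar_def
        using that g \<eta>(1) Lc omega_nonzero[of g l x] omega_nonzero[of "conj_by G g l" g x] by auto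
  have t2: "twist (inv g) s' L \<xi> H \<psi>"
    unfolding s'_def by (rule twist_symmetric[OF t HL nz])
  have g': "inv g \<in> carrier G" and gg: "g \<otimes> inv g = \<one>" "inv g \<otimes> g = \<one>" using g by simp_all
  have L': "conj_by G (inv g) h \<in> L" if "h \<in> H" for h
    using twistD(4)[OF t2 that] .
  have s1: "s' h x * s (conj_by G (inv g) h) (inv g \<otimes> x) = 1" if "h \<in> H" "x \<in> carrier G" for h x
    unfolding s'_def using nz[OF L'[OF that(1)], of "inv g \<otimes> x"] g that by simp
  have s2: "s l x * s' (conj_by G g l) (g \<otimes> x) = 1" if "l \<in> L" "x \<in> carrier G" for l x
  proof -
    have "conj_by G (inv g) (conj_by G g l) = l"
      using conj_by_cancel[OF g' g gg(2)] that Lc by auto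
    then show ?thesis
      unfolding s'_def using nz[OF that] g that by simp
  qed
  have "is_equivalence (MC H \<psi>) (MC L \<xi>) (twist_obj g s L) (twist_arr g s L)"
    by (rule twist_equivalence[OF t t2 gg]) (erule (1) s1, erule (1) s2)
  then show ?thesis
    unfolding module_equivalent_def using twist_module_functor[OF t comp] by blast
qed


section \<open>The regular module\<close>

abbreviation reg where
  "reg H \<psi> \<equiv> (twisted_space H, alg_mult (twisted_algebra G H \<psi>)) :: ('g, 'k) graded \<times> ('g, 'k)
      graded_arrow"

text \<open>On \<open>ev c\<close>, which has degree \<open>c\<close>, the twisted law of a module
  is the equation \<open>d\<close>, the condition on the differential of \<psi> without
  denominators.\<close>

lemma reg_modules:
  assumes H: "subgroup H G"
    and one: "\<And>h. h \<in> H \<Longrightarrow> \<psi> \<one> h = 1"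
    and d: "\<And>a b c. a \<in> H \<Longrightarrow> b \<in> H \<Longrightarrow> c \<in> H \<Longrightarrow>
      \<psi> b c * \<psi> a (b \<otimes> c) = \<omega> a b c * \<psi> (a \<otimes> b) c * \<psi> a b"
  shows "reg H \<psi> \<in> modules H \<psi>"
proof -
  note Hc = subgroup_carrier[OF H] and m = alg_mult[OF H, where \<psi> = \<psi>]
  note T = twisted_space[OF Hc]
  let ?m = "alg_mult (twisted_algebra G H \<psi>)"
  have sc: "mact ?m h (scale c (ev k)) = scale (c * \<psi> h k) (ev (h \<otimes> k))" if "h \<in> H" "k \<in> H"
      for h k c
    using mact_scale[OF m(1) Hc that(1) ev_total[OF Hc that(2)]] m(2)[OF that]
        by (simp add: mact_def)
  show ?thesis
    unfolding modules_iff[OF H]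
  proof (intro conjI ballI T m(1))
    fix h k x and v :: "('g, 'k) vec" assume h: "h \<in> H" and k: "k \<in> H"
        and v: "v \<in> twisted_space H x"
    have hk: "h \<otimes> k \<in> H" using H h k by (rule subgroup.m_closed)
    from v show "mact ?m h (mact ?m k v) = scale (\<omega> h k x * \<psi> h k) (mact ?m (h \<otimes> k) v)"
    proof (cases rule: twistedE)
      case (1 c)
      have kx: "k \<otimes> x \<in> H" using H k 1(2) by (rule subgroup.m_closed)
      have "h \<otimes> (k \<otimes> x) = h \<otimes> k \<otimes> x"
        using h k 1(2) Hc by (intro m_assoc[symmetric]) auto
      with d[OF h k 1(2)] show ?thesis
        unfolding 1(1) sc[OF k 1(2)] sc[OF h kx] sc[OF hk 1(2)] vec.scale_scale
            by (simp add: ac_simps)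
    next
      case 2
      then show ?thesis
        using mact_zero[OF m(1) Hc] h k hk by simp
    qed
  next
    fix x and v :: "('g, 'k) vec" assume "v \<in> twisted_space H x"
    then show "mact ?m \<one> v = v"
    proof (cases rule: twistedE)
      case (1 c)
      then show ?thesis
        using sc[OF subgroup.one_closed[OF H] 1(2)] one Hc by auto
    next
      case 2
      then show ?thesis
        using mact_zero[OF m(1) Hc subgroup.one_closed[OF H]] by simp
    qed
  qed
qed

text \<open>The multiplication read as right multiplication on the regular left module. As an arrow
  of the module category it can be transported along a functor.\<close>

definition reg_mult where
  "reg_mult H \<psi> = Arrow (mod_act H \<psi> (reg H \<psi>) (twisted_space H)) (reg H \<psi>)
      (alg_mult (twisted_algebra G H \<psi>))"

text \<open>Left equivariance of right multiplication is associativity of the algebra, so the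
  equation \<open>d\<close> is used once more.\<close>

lemma reg_mult:
  assumes H: "subgroup H G" and A: "reg H \<psi> \<in> modules H \<psi>"
    and d: "\<And>a b c. a \<in> H \<Longrightarrow> b \<in> H \<Longrightarrow> c \<in> H \<Longrightarrow>
      \<psi> b c * \<psi> a (b \<otimes> c) = \<omega> a b c * \<psi> (a \<otimes> b) c * \<psi> a b"
  shows "reg_mult H \<psi> \<in> Hom (MC H \<psi>) (mod_act H \<psi> (reg H \<psi>) (twisted_space H)) (reg H \<psi>)"
proof -
  note Hc = subgroup_carrier[OF H] and m = alg_mult[OF H, where \<psi> = \<psi>]
  note T = twisted_space[OF Hc]
  let ?m = "alg_mult (twisted_algebra G H \<psi>)" and ?T = "twisted_space H :: ('g, 'k) graded"
  let ?AT = "mod_act H \<psi> (reg H \<psi>) ?T"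
  note AT = mod_act[OF H A T]
  have tot: "pure_tensor (ev h) (ev k) \<in> total G (?T \<boxtimes> ?T)" if "h \<in> H" "k \<in> H" for h k
    by (intro pure_total ev_total[OF Hc] that)
  have fstAT: "fst ?AT = ?T \<boxtimes> ?T"
    by simp
  have eqv: "fn ?m (mact (snd ?AT) h (pure_tensor v w))
      = mact (snd (reg H \<psi>)) h (fn ?m (pure_tensor v w))"
    if h: "h \<in> H" and x: "x \<in> carrier G" and y: "y \<in> carrier G" and v: "v \<in> ?T x"
        and w: "w \<in> ?T y" for h x y v w
  proof -
    note zero = graded_hom_zero[OF m(1)] mact_zero[OF m(1) Hc h]
        mact_zero[OF moduleD(2)[OF H AT(1)] Hc h]
    from v show ?thesis
    proof (cases rule: twistedE)
      case v: (1 c)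
      from w show ?thesis
      proof (cases rule: twistedE)
        case w: (1 e)
        have hx: "h \<otimes> x \<in> H" using H h v(2) by (rule subgroup.m_closed)
        have xy: "x \<otimes> y \<in> H" using H v(2) w(2) by (rule subgroup.m_closed)
        have t: "pure_tensor (ev x) (ev y) \<in> total G (fst ?AT)"
          using tot[OF v(2) w(2)] by simp
        have hxm: "fn ?m (pure_tensor (ev h) (ev x)) = scale (\<psi> h x) (ev (h \<otimes> x))"
          by (rule m(2)[OF h v(2)])
        have "mact (snd ?AT) h (pure_tensor (ev x) (ev y))
            = scale (\<omega> h x y * \<psi> h x) (pure_tensor (ev (h \<otimes> x)) (ev y))"
          using AT(2)[OF h x y, of "ev x" "ev y"] ev_mem[OF v(2)] ev_mem[OF w(2)]
          by (simp add: mact_def hxm pure_scale_left)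
        then have "fn ?m (mact (snd ?AT) h (pure_tensor (ev x) (ev y)))
            = scale (\<omega> h x y * \<psi> h x * \<psi> (h \<otimes> x) y) (ev (h \<otimes> x \<otimes> y))"
          using graded_hom_scale[OF m(1) tot[OF hx w(2)]] m(2)[OF hx w(2)] by simp
        also have "\<dots> = scale (\<psi> x y * \<psi> h (x \<otimes> y)) (ev (h \<otimes> (x \<otimes> y)))"
          using d[OF h v(2) w(2)] h Hc x y by (simp add: ac_simps m_assoc subsetD)
        also have "\<dots> = mact ?m h (fn ?m (pure_tensor (ev x) (ev y)))"
          unfolding m(2)[OF v(2) w(2)] mact_scale[OF m(1) Hc h ev_total[OF Hc xy]]
          using m(2)[OF h xy] by (simp add: mact_def)
        finally have base: "fn ?m (mact (snd ?AT) h (pure_tensor (ev x) (ev y)))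
            = mact ?m h (fn ?m (pure_tensor (ev x) (ev y)))" .
        have t1: "mact (snd ?AT) h (pure_tensor (ev x) (ev y)) \<in> total G (?T \<boxtimes> ?T)"
          using moduleD(6)[OF H AT(1) h t] by simp
        have t2: "fn ?m (pure_tensor (ev x) (ev y)) \<in> total G ?T"
          by (rule graded_homD(6)[OF m(1) tot[OF v(2) w(2)]])
        show ?thesis
          unfolding v(1) w(1) pure_scale_left pure_scale_right vec.scale_scale
            moduleD(7)[OF H AT(1) h t] graded_hom_scale[OF m(1) t1] base
            graded_hom_scale[OF m(1) tot[OF v(2) w(2)]] snd_conv mact_scale[OF m(1) Hc h t2] ..
      qed (simp add: zero)
    qed (simp add: zero)
  qed
  show ?thesis
    unfolding reg_mult_def
  proof (rule M0_HomI[OF H AT(1) A])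
    show "?m \<in> hom (fst ?AT) (fst (reg H \<psi>))"
      using m(1) by simp
    have m': "?m \<in> hom (?T \<boxtimes> ?T) (fst (reg H \<psi>))"
      using m(1) by simp
    fix h z t assume *: "h \<in> H" "z \<in> carrier G" "t \<in> fst ?AT z"
    show "fn ?m (mact (snd ?AT) h t) = mact (snd (reg H \<psi>)) h (fn ?m t)"
      by (rule equivariant_tensorI[OF H AT(1) A fstAT m' *(1) eqv[OF *(1)] *(2)])
          (use *(3) in simp_all)
  qed
qed

text \<open>This is the module law of the regular module with the associator moved to the other
  side, the direction in which \<open>act_assoc\<close> points.\<close>

lemma reg_assoc:
  assumes H: "subgroup H G" and A: "reg H \<psi> \<in> modules H \<psi>"
  defines "m \<equiv> alg_mult (twisted_algebra G H \<psi>)" and "T \<equiv> twisted_space H"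
  shows "m \<odot> (m \<otimes>\<otimes> idn T) \<odot> asc' T T T = m \<odot> (idn T \<otimes>\<otimes> m)"
proof -
  interpret cat "vec_cat G \<omega>" by (rule cat_vec_cat)
  note T = twisted_space[OF subgroup_carrier[OF H], folded T_def]
  note m = alg_mult_hom[OF H, of \<psi>, folded m_def T_def]
  note mT = tens_hom[OF m idn_hom[OF T]] and Tm = tens_hom[OF idn_hom[OF T] m]
  note a = asc_hom[OF T T T] and a' = asc'_hom[OF T T T]
  have eq: "m \<odot> (m \<otimes>\<otimes> idn T) = m \<odot> (idn T \<otimes>\<otimes> m) \<odot> asc T T T"
    using A unfolding left_modules_def by (simp add: m_def T_def)
  have inv: "asc T T T \<odot> asc' T T T = idn (T \<boxtimes> (T \<boxtimes> T))"
    using asc_inverse[OF T T T] graded_homD(2)[OF a] by (simp add: inverse_arrows_def)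
  have "m \<odot> (m \<otimes>\<otimes> idn T) \<odot> asc' T T T = (m \<odot> (m \<otimes>\<otimes> idn T)) \<odot> asc' T T T"
    using comp_assoc[of "asc' T T T" _ _ "m \<otimes>\<otimes> idn T" _ m] a' mT m by simp
  also have "\<dots> = m \<odot> (idn T \<otimes>\<otimes> m) \<odot> asc T T T \<odot> asc' T T T"
    unfolding eq
    using comp_assoc[of "asc' T T T" _ _ "(idn T \<otimes>\<otimes> m) \<odot> asc T T T" _ m] a' cc_hom[OF a Tm] m
      comp_assoc[of "asc' T T T" _ _ "asc T T T" _ "idn T \<otimes>\<otimes> m"] a Tm by simp
  also have "\<dots> = m \<odot> (idn T \<otimes>\<otimes> m)"
    unfolding inv using ident_right[of "idn T \<otimes>\<otimes> m"] Tm by simp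
  finally show ?thesis .
qed

text \<open>The unit law on the right is not among the axioms of a left module; it is what makes the
  transported right multiplication unital.\<close>

lemma reg_unit:
  assumes H: "subgroup H G" and one: "\<And>h. h \<in> H \<Longrightarrow> \<psi> h \<one> = 1"
  defines "m \<equiv> alg_mult (twisted_algebra G H \<psi>)" and "T \<equiv> twisted_space H"
  shows "m \<odot> (idn T \<otimes>\<otimes> alg_unit (twisted_algebra G H \<psi>)) = runit (vec_cat G \<omega>) T"
proof -
  note Hc = subgroup_carrier[OF H]
  note T = twisted_space[OF Hc, folded T_def]
  note m = alg_mult[OF H, where \<psi> = \<psi>, folded m_def T_def]
  note u = alg_unit[OF H, where \<psi> = \<psi>, folded T_def]
  note Tu = tens_hom[OF idn_hom[OF T] u(1)]
  note l = cc_hom[OF Tu m(1)] and r = runit_hom[OF T]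
  show ?thesis
  proof (rule tensor_hom_eqI[OF l r])
    fix x y v and e :: "('g, 'k) vec"
    assume *: "v \<in> T x" "e \<in> graded_unit G y"
    obtain k where k: "e = scale k uv"
      using *(2) by (rule graded_unitE)
    from *(1)[unfolded T_def]
    show "fn (m \<odot> (idn T \<otimes>\<otimes> alg_unit (twisted_algebra G H \<psi>))) (pure_tensor v e)
        = fn (runit (vec_cat G \<omega>) T) (pure_tensor v e)"
    proof (cases rule: twistedE)
      case (1 c)
      have x: "ev x \<in> total G T"
        unfolding T_def by (rule ev_total[OF Hc 1(2)])
      note p = pure_total[OF x uv_total]
      have x1: "x \<otimes> \<one> = x" using 1(2) Hc by auto
      show ?thesis
        unfolding 1(1) k pure_scale_left pure_scale_right vec.scale_scale graded_hom_scale[OF l p]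
          graded_hom_scale[OF r p] runit_apply[OF T x] cc_apply[OF Tu p]
          tens_apply[OF idn_hom[OF T] u(1) x uv_total] idn_apply[OF x] u(2)
          m(2)[OF 1(2) subgroup.one_closed[OF H]] one[OF 1(2)] x1 by simp
    qed (simp add: graded_hom_zero[OF l] graded_hom_zero[OF r])
  qed
qed

text \<open>The regular module is generated by \<open>ev \<one>\<close>, whose image must lie in the
  one-dimensional component of degree \<one>.\<close>

lemma reg_endo:
  assumes H: "subgroup H G" and A: "reg H \<psi> \<in> modules H \<psi>" and one: "\<And>h. h \<in> H \<Longrightarrow> \<psi> h \<one> = 1"
    and f: "f \<in> Hom (MC H \<psi>) (reg H \<psi>) (reg H \<psi>)"
  shows "\<exists>c. \<forall>h\<in>H. fn (fn f) (ev h) = scale c (ev h)"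
proof -
  note Hc = subgroup_carrier[OF H] and m = alg_mult[OF H, where \<psi> = \<psi>]
  note f' = M0_HomD[OF H f]
  note H1 = subgroup.one_closed[OF H]
  have fT: "fn f \<in> hom (twisted_space H) (twisted_space H)"
    using f'(5) by simp
  have "fn (fn f) (ev \<one>) \<in> twisted_space H \<one>"
    by (rule graded_homD(7)[OF fT one_closed ev_mem[OF H1]])
  then obtain c where c: "fn (fn f) (ev \<one>) = scale c (ev \<one>)"
    using H1 by (cases rule: twistedE) auto
  have "fn (fn f) (ev h) = scale c (ev h)" if h: "h \<in> H" for h
  proof -
    have h1: "h \<otimes> \<one> = h" using h Hc by auto
    have eh: "ev h = mact (alg_mult (twisted_algebra G H \<psi>)) h (ev \<one>)"
      using m(2)[OF h H1] one[OF h] h1 by (simp add: mact_def)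
    have "fn (fn f) (ev h) = mact (alg_mult (twisted_algebra G H \<psi>)) h (scale c (ev \<one>))"
      unfolding eh using f'(6)[OF h one_closed, of "ev \<one>"] ev_mem[OF H1] c by simp
    also have "\<dots> = scale c (ev h)"
      unfolding mact_scale[OF m(1) Hc h ev_total[OF Hc H1]] eh ..
    finally show ?thesis .
  qed
  then show ?thesis by blast
qed

section \<open>Extending a map from one component\<close>

lemma scale_inverse_cancel: "c \<noteq> 0 \<Longrightarrow> scale (inverse c) (scale c v) = v"
  unfolding vec.scale_scale by simp

text \<open>By the twisted law, \<open>inv k\<close> followed by \<open>k\<close> acts as a nonzero
  scalar on the component of degree \<open>k \<otimes> y\<close>; dividing by it gives the
  preimage.\<close>

lemma module_component_surj:
  assumes H: "subgroup H G" and U: "U \<in> modules H \<psi>" and nz: "\<And>a b. a \<in> H \<Longrightarrow> b \<in> H \<Longrightarrow> \<psi> a b \<noteq> 0"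
    and k: "k \<in> H" and y: "y \<in> carrier G" and v: "v \<in> fst U (k \<otimes> y)"
  shows "\<exists>w\<in>fst U y. mact (snd U) k w = v"
proof -
  note u = moduleD[OF H U] and Hc = subgroup_carrier[OF H]
  have kc: "k \<in> carrier G" and k': "inv k \<in> H" using k Hc subgroup.m_inv_closed[OF H] by auto
  have ky: "k \<otimes> y \<in> carrier G" using kc y by simp
  let ?c = "\<omega> k (inv k) (k \<otimes> y) * \<psi> k (inv k)"
  have c: "?c \<noteq> 0"
    using nz[OF k k'] omega_nonzero[of k "inv k" "k \<otimes> y"] kc ky by simp
  have w: "mact (snd U) (inv k) v \<in> fst U y"
    using u(5)[OF k' ky v] kc y by simp
  have wt: "mact (snd U) (inv k) v \<in> total G (fst U)"
    using y w by (rule total_component)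
  have "mact (snd U) k (mact (snd U) (inv k) v) = scale ?c v"
    unfolding u(3)[OF k k' ky v] using kc u(4)[OF ky v] by simp
  then have "mact (snd U) k (scale (inverse ?c) (mact (snd U) (inv k) v)) = v"
    unfolding u(7)[OF k wt] by (simp only: scale_inverse_cancel[OF c])
  then show ?thesis
    using vec.subspace_scale[OF graded_space_subspace[OF u(1)] w] by blast
qed

text \<open>By the twisted law, \<open>k\<close> followed by \<open>inv k\<close> acts as a nonzero
  scalar on the component of degree \<open>y\<close>.\<close>

lemma module_component_inj:
  assumes H: "subgroup H G" and U: "U \<in> modules H \<psi>" and nz: "\<And>a b. a \<in> H \<Longrightarrow> b \<in> H \<Longrightarrow> \<psi> a b \<noteq> 0"
    and k: "k \<in> H" and y: "y \<in> carrier G" and v: "v \<in> fst U y" and z: "mact (snd U) k v = 0"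
  shows "v = 0"
proof -
  note u = moduleD[OF H U] and Hc = subgroup_carrier[OF H]
  have kc: "k \<in> carrier G" and k': "inv k \<in> H" using k Hc subgroup.m_inv_closed[OF H] by auto
  have c: "\<omega> (inv k) k y * \<psi> (inv k) k \<noteq> 0"
    using nz[OF k' k] omega_nonzero[of "inv k" k y] kc y by simp
  have "scale (\<omega> (inv k) k y * \<psi> (inv k) k) v = mact (snd U) (inv k) (mact (snd U) k v)"
    unfolding u(3)[OF k' k y v] using kc u(4)[OF y v] by simp
  also have "\<dots> = 0"
    unfolding z by (rule mact_zero[OF u(2) Hc k'])
  finally show ?thesis
    using c by simp
qed

text \<open>The part of \<open>U\<close> supported on the coset of all \<open>k \<otimes> y\<close>
  is freely generated by its component of degree \<open>y\<close>: every vector of degree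
  \<open>k \<otimes> y\<close> is \<open>k\<close> applied to a unique vector of degree
  \<open>y\<close>. So \<open>t\<close> extends equivariantly, and by zero off the coset.\<close>

lemma component_extension:
  assumes H: "subgroup H G" and U: "U \<in> modules H \<psi>" and W: "W \<in> modules H \<psi>"
    and nz: "\<And>a b. a \<in> H \<Longrightarrow> b \<in> H \<Longrightarrow> \<psi> a b \<noteq> 0"
    and y: "y \<in> carrier G" and t: "lin t" and tU: "\<And>u. u \<in> fst U y \<Longrightarrow> t u \<in> fst W y"
  shows "\<exists>S\<in>Hom (MC H \<psi>) U W.
    (\<forall>k\<in>H. \<forall>u\<in>fst U y. fn (fn S) (mact (snd U) k u) = mact (snd W) k (t u)) \<and>
    (\<forall>x\<in>carrier G. \<forall>u\<in>fst U x. (\<forall>k\<in>H. x \<noteq> k \<otimes> y) \<longrightarrow> fn (fn S) u = 0)"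
proof -
  note u = moduleD[OF H U] and w = moduleD[OF H W] and Hc = subgroup_carrier[OF H]
  have inv: "inv k \<in> H" if "k \<in> H" for k using subgroup.m_inv_closed[OF H that] .
  have fin: "finite H" using Hc finite_carrier finite_subset by blast
  have "\<forall>k\<in>H. \<exists>\<rho>. lin \<rho> \<and> (\<forall>v\<in>total G (fst U). mact (snd U) k v = \<rho> v)"
    using mact_extend[OF u(2) Hc] by blast
  then obtain \<rho> where \<rho>: "\<And>k. k \<in> H \<Longrightarrow> lin (\<rho> k)"
    "\<And>k v. k \<in> H \<Longrightarrow> v \<in> total G (fst U) \<Longrightarrow> mact (snd U) k v = \<rho> k v"
    by metis
  have "\<forall>k\<in>H. \<exists>\<rho>. lin \<rho> \<and> (\<forall>v\<in>total G (fst W). mact (snd W) k v = \<rho> v)"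
    using mact_extend[OF w(2) Hc] by blast
  then obtain \<sigma> where \<sigma>: "\<And>k. k \<in> H \<Longrightarrow> lin (\<sigma> k)"
    "\<And>k v. k \<in> H \<Longrightarrow> v \<in> total G (fst W) \<Longrightarrow> mact (snd W) k v = \<sigma> k v"
    by metis
  let ?P = "gproj G (fst U) y"
  \<comment> \<open>On degree \<open>k \<otimes> y\<close> only the summand of \<open>k\<close>
    survives: it moves the vector to degree \<open>y\<close>, applies \<open>t\<close> and moves the
    result back. The inverse scalar makes up for \<open>k\<close> followed by \<open>inv k\<close>
    being a multiple of the identity.\<close>
  define F where "F v = (\<Sum>k\<in>H. scale (inverse (\<omega> (inv k) k y * \<psi> (inv k) k))
      (\<sigma> k (t (?P (\<rho> (inv k) v)))))" for v
  have P: "lin ?P" by (rule gproj_lin[OF u(1) y])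
  have F: "lin F"
    unfolding F_def by (intro lin_sum_fun lin_scale_fun lin_comp[OF _ \<sigma>(1)] lin_comp[OF _ t]
        lin_comp[OF _ P] \<rho>(1) inv)
  have P\<rho>: "?P (\<rho> (inv k) v) = (if x = k \<otimes> y then mact (snd U) (inv k) v else 0)"
    if k: "k \<in> H" and x: "x \<in> carrier G" and v: "v \<in> fst U x" for k x v
  proof -
    have vt: "v \<in> total G (fst U)" using x v by (rule total_component)
    have kc: "k \<in> carrier G" using k Hc by auto
    have kx: "inv k \<otimes> x \<in> carrier G" using kc x by simp
    note kv = u(5)[OF inv[OF k] x v]
    have "?P (mact (snd U) (inv k) v) = (if inv k \<otimes> x = y then mact (snd U) (inv k) v else 0)"
      by (rule gproj_comp[where V = "fst U", OF u(1) y kx kv])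
    moreover have "inv k \<otimes> x = y \<longleftrightarrow> x = k \<otimes> y"
      using kc x y by auto
    ultimately show ?thesis
      unfolding \<rho>(2)[OF inv[OF k] vt] by simp
  qed
  have zero: "F v = 0" if x: "x \<in> carrier G" and v: "v \<in> fst U x" and out: "\<forall>k\<in>H. x \<noteq> k \<otimes> y" for x v
  proof -
    have "scale (inverse (\<omega> (inv k) k y * \<psi> (inv k) k)) (\<sigma> k (t (?P (\<rho> (inv k) v)))) = 0"
        if k: "k \<in> H" for k
    proof -
      have "?P (\<rho> (inv k) v) = 0" using P\<rho>[OF k x v] out k by simp
      then show ?thesis
        using lin_zero[OF t] lin_zero[OF \<sigma>(1)[OF k]] by simp
    qed
    then show ?thesis
      unfolding F_def by (intro sum.neutral) blast
  qed
  have ext: "F (mact (snd U) k v) = mact (snd W) k (t v)" if k: "k \<in> H" and v: "v \<in> fst U y" for k v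
  proof -
    have kc: "k \<in> carrier G" using k Hc by auto
    have ky: "k \<otimes> y \<in> carrier G" using kc y by simp
    note kv = u(5)[OF k y v]
    have tv: "t v \<in> total G (fst W)" using y tU[OF v] by (rule total_component)
    let ?c = "\<omega> (inv k) k y * \<psi> (inv k) k"
    have c: "?c \<noteq> 0"
      using nz[OF inv[OF k] k] omega_nonzero[of "inv k" k y] kc y by simp
    have kk: "mact (snd U) (inv k) (mact (snd U) k v) = scale ?c v"
      unfolding u(3)[OF inv[OF k] k y v] using kc u(4)[OF y v] by simp
    have "F (mact (snd U) k v) = (\<Sum>j\<in>H. if j = k then \<sigma> k (t v) else 0)"
      unfolding F_def
    proof (rule sum.cong[OF refl])
      fix j assume j: "j \<in> H"
      have jc: "j \<in> carrier G" using j Hc by auto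
      show "scale (inverse (\<omega> (inv j) j y * \<psi> (inv j) j))
          (\<sigma> j (t (?P (\<rho> (inv j) (mact (snd U) k v)))))
          = (if j = k then \<sigma> k (t v) else 0)"
      proof (cases "j = k")
        case True
        show ?thesis
          unfolding True P\<rho>[OF k ky kv] kk
          by (simp only: lin_scale[OF t] lin_scale[OF \<sigma>(1)[OF k]] scale_inverse_cancel[OF c]
              if_True refl)
      next
        case False
        then have "k \<otimes> y \<noteq> j \<otimes> y" using kc jc y by simp
        then have "?P (\<rho> (inv j) (mact (snd U) k v)) = 0" using P\<rho>[OF j ky kv] by simp
        then show ?thesis
          using False lin_zero[OF t] lin_zero[OF \<sigma>(1)[OF j]] by simp
      qed
    qed
    also have "\<dots> = mact (snd W) k (t v)"
      using fin k \<sigma>(2)[OF k tv] by simp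
    finally show ?thesis .
  qed
  let ?S = "lin_arrow G (fst U) (fst W) F"
  have surj: "\<exists>v\<in>fst U y. mact (snd U) k v = v'" if "k \<in> H" "v' \<in> fst U (k \<otimes> y)" for k v'
    by (rule module_component_surj[OF H U nz that(1) y that(2)])
  have S: "?S \<in> hom (fst U) (fst W)"
  proof (rule lin_arrow_hom[OF u(1) w(1) F])
    fix x v assume x: "x \<in> carrier G" and v: "v \<in> fst U x"
    show "F v \<in> fst W x"
    proof (cases "\<exists>k\<in>H. x = k \<otimes> y")
      case True
      then obtain k where k: "k \<in> H" "x = k \<otimes> y" by blast
      then obtain v' where v': "v' \<in> fst U y" "mact (snd U) k v' = v"
        using surj v by blast
      show ?thesis
        using ext[OF k(1) v'(1)] w(5)[OF k(1) y tU[OF v'(1)]] unfolding v'(2) k(2) by simp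
    next
      case False
      then show ?thesis
        using zero[OF x v] vec.subspace_0[OF graded_space_subspace[OF w(1)]] by auto
    qed
  qed
  have S_apply: "fn ?S v = F v" if "x \<in> carrier G" "v \<in> fst U x" for x v
    using total_component[where V = "fst U", OF that] by (rule lin_arrow_apply)
  have "Arrow U W ?S \<in> Hom (MC H \<psi>) U W"
  proof (rule M0_HomI[OF H U W S])
    fix h x v assume h: "h \<in> H" and x: "x \<in> carrier G" and v: "v \<in> fst U x"
    have hc: "h \<in> carrier G" using h Hc by auto
    have hx: "h \<otimes> x \<in> carrier G" using hc x by simp
    note hv = u(5)[OF h x v]
    have "F (mact (snd U) h v) = mact (snd W) h (F v)"
    proof (cases "\<exists>k\<in>H. x = k \<otimes> y")
      case True
      then obtain k where k: "k \<in> H" "x = k \<otimes> y" by blast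
      then obtain v' where v': "v' \<in> fst U y" "mact (snd U) k v' = v"
        using surj v by blast
      have kc: "k \<in> carrier G" using k Hc by auto
      have hk: "h \<otimes> k \<in> H" using H h k(1) by (rule subgroup.m_closed)
      have "F (mact (snd U) h v) = scale (\<omega> h k y * \<psi> h k) (mact (snd W) (h \<otimes> k) (t v'))"
        unfolding v'(2)[symmetric] u(3)[OF h k(1) y v'(1)] lin_scale[OF F] ext[OF hk v'(1)] ..
      also have "\<dots> = mact (snd W) h (F v)"
        unfolding v'(2)[symmetric] ext[OF k(1) v'(1)] w(3)[OF h k(1) y tU[OF v'(1)]] ..
      finally show ?thesis .
    next
      case False
      \<comment> \<open>The complement of the coset is stable under \<open>H\<close>, so both sides
        vanish.\<close>
      have "\<forall>k\<in>H. h \<otimes> x \<noteq> k \<otimes> y"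
      proof (intro ballI notI)
        fix k assume k: "k \<in> H" and eq: "h \<otimes> x = k \<otimes> y"
        have kc: "k \<in> carrier G" using k Hc by auto
        have "x = inv h \<otimes> k \<otimes> y"
          using eq hc kc x y by (metis inv_cancel_left(1) inv_closed m_assoc)
        with False subgroup.m_closed[OF H inv[OF h] k] show False by blast
      qed
      from zero[OF hx hv this] zero[OF x v] False show ?thesis
        using mact_zero[OF w(2) Hc h] by auto
    qed
    then show "fn ?S (mact (snd U) h v) = mact (snd W) h (fn ?S v)"
      unfolding S_apply[OF x v] S_apply[OF hx hv] .
  qed
  moreover have "fn ?S (mact (snd U) k v) = mact (snd W) k (t v)" if "k \<in> H" "v \<in> fst U y" for k v
  proof -
    have "k \<otimes> y \<in> carrier G" using that Hc y by auto
    from S_apply[OF this u(5)[OF that(1) y that(2)]] ext[OF that] show ?thesis by simp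
  qed
  moreover have "fn ?S v = 0" if "x \<in> carrier G" "v \<in> fst U x" "\<forall>k\<in>H. x \<noteq> k \<otimes> y" for x v
    using zero[OF that] S_apply[OF that(1,2)] by simp
  ultimately show ?thesis
    by (intro bexI[of _ "Arrow U W ?S"]) auto
qed

lemma zero_arrow_hom: "V \<in> spaces \<Longrightarrow> W \<in> spaces \<Longrightarrow> lin_arrow G V W (\<lambda>_. 0) \<in> hom V W"
  by (rule lin_arrow_hom) (auto intro!: linI simp: vec.subspace_0 graded_space_subspace)

lemma zero_M0_arrow:
  assumes H: "subgroup H G" and U: "U \<in> modules H \<psi>" and V: "V \<in> modules H \<psi>"
  shows "Arrow U V (lin_arrow G (fst U) (fst V) (\<lambda>_. 0)) \<in> Hom (MC H \<psi>) U V"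
proof (rule M0_HomI[OF H U V zero_arrow_hom])
  note u = moduleD[OF H U] and v = moduleD[OF H V] and Hc = subgroup_carrier[OF H]
  show "fst U \<in> spaces" "fst V \<in> spaces" by (fact u(1) v(1))+
  fix h x w assume h: "h \<in> H" and "x \<in> carrier G" "w \<in> fst U x"
  then have w: "w \<in> total G (fst U)" by (intro total_component)
  show "fn (lin_arrow G (fst U) (fst V) (\<lambda>_. 0)) (mact (snd U) h w)
      = mact (snd V) h (fn (lin_arrow G (fst U) (fst V) (\<lambda>_. 0)) w)"
    unfolding lin_arrow_apply[OF w] lin_arrow_apply[OF u(6)[OF h w]] mact_zero[OF v(2) Hc h] ..
qed


section \<open>The bimodule of a module functor\<close>

lemma M0_comp_apply:
  assumes H: "subgroup H G" and f: "f \<in> Hom (MC H \<psi>) U V" and v: "v \<in> total G (fst U)"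
  shows "fn (fn (Comp (MC H \<psi>) k f)) v = fn (fn k) (fn (fn f) v)"
  using cc_apply[OF M0_HomD(5)[OF H f] v] by simp

lemma act_arr_hom:
  assumes H: "subgroup H G" and f: "f \<in> Hom (MC H \<psi>) U V" and h: "h \<in> hom X Y"
  shows "act_arr (MC H \<psi>) f h \<in> Hom (MC H \<psi>) (mod_act H \<psi> U X) (mod_act H \<psi> V Y)"
proof -
  note f' = M0_HomD[OF H f] and h' = graded_homD[OF h]
  note UX = mod_act[OF H f'(1) h'(3)] and VY = mod_act[OF H f'(2) h'(4)]
  note u = moduleD[OF H f'(1)]
  note fh = tens_hom[OF f'(5) h]
  have fh': "fn f \<otimes>\<otimes> h \<in> hom (fst U \<boxtimes> X) (fst (mod_act H \<psi> V Y))"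
    using fh by simp
  have eqv: "fn (fn f \<otimes>\<otimes> h) (mact (snd (mod_act H \<psi> U X)) k (pure_tensor v w))
      = mact (snd (mod_act H \<psi> V Y)) k (fn (fn f \<otimes>\<otimes> h) (pure_tensor v w))"
    if *: "k \<in> H" "x \<in> carrier G" "y \<in> carrier G" "v \<in> fst U x" "w \<in> X y" for k x y v w
  proof -
    have v: "v \<in> total G (fst U)" using *(2,4) by (rule total_component)
    have w: "w \<in> total G X" using *(3,5) by (rule total_component)
    note kv = u(6)[OF *(1) v]
    note fv = graded_homD(7)[OF f'(5) *(2,4)] and hw = graded_homD(7)[OF h *(3,5)]
    show ?thesis
      unfolding UX(2)[OF *] graded_hom_scale[OF fh pure_total[OF kv w]] tens_apply[OF f'(5) h kv w]
        tens_apply[OF f'(5) h v w] f'(6)[OF *(1,2,4)] VY(2)[OF *(1-3) fv hw] ..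
  qed
  show ?thesis
    unfolding M0_simps f'(3,4) h'(1,2)
  proof (rule M0_HomI[OF H UX(1) VY(1)])
    show "fn f \<otimes>\<otimes> h \<in> hom (fst (mod_act H \<psi> U X)) (fst (mod_act H \<psi> V Y))"
      using fh by simp
    fix k z t assume *: "k \<in> H" "z \<in> carrier G" "t \<in> fst (mod_act H \<psi> U X) z"
    show "fn (fn f \<otimes>\<otimes> h) (mact (snd (mod_act H \<psi> U X)) k t)
        = mact (snd (mod_act H \<psi> V Y)) k (fn (fn f \<otimes>\<otimes> h) t)"
      by (rule equivariant_tensorI[OF H UX(1) VY(1) fst_mod_act fh' *(1) eqv[OF *(1)] *(2)])
        (use *(3) in simp_all)
  qed
qed

text \<open>On triple pure tensors equivariance is the pentagon at \<open>h\<close> and the three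
  degrees. The second factor has to be reduced to pure tensors as well, which is done with linear
  extensions of all maps involved.\<close>

lemma act_assoc_hom:
  assumes H: "subgroup H G" and U: "U \<in> modules H \<psi>" and X: "X \<in> spaces" and Y: "Y \<in> spaces"
  shows "act_assoc (MC H \<psi>) U X Y \<in>
    Hom (MC H \<psi>) (mod_act H \<psi> U (X \<boxtimes> Y)) (mod_act H \<psi> (mod_act H \<psi> U X) Y)"
proof -
  note u = moduleD[OF H U] and Hc = subgroup_carrier[OF H]
  note XY = tensor_space[OF X Y]
  note UX = mod_act[OF H U X] and U1 = mod_act[OF H U XY] and U2 = mod_act[OF H UX(1) Y]
  let ?M = "fst U" and ?U1 = "mod_act H \<psi> U (X \<boxtimes> Y)" and ?U2 = "mod_act H \<psi> (mod_act H \<psi> U X) Y"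
  note as = asc'_hom[OF u(1) X Y]
  have as': "asc' ?M X Y \<in> hom (?M \<boxtimes> (X \<boxtimes> Y)) (fst ?U2)"
    using as by simp
  have eqv: "fn (asc' ?M X Y) (mact (snd ?U1) h (pure_tensor v t))
      = mact (snd ?U2) h (fn (asc' ?M X Y) (pure_tensor v t))"
    if h: "h \<in> H" and z: "z \<in> carrier G" and c: "c \<in> carrier G" and v: "v \<in> ?M z"
        and t: "t \<in> (X \<boxtimes> Y) c" for h z c v t
  proof -
    have hc: "h \<in> carrier G" using h Hc by auto
    have vt: "v \<in> total G ?M" using z v by (rule total_component)
    have hz: "h \<otimes> z \<in> carrier G" using hc z by simp
    note hv = u(5)[OF h z v] and hvt = u(6)[OF h vt]
    obtain F where F: "lin F" "\<And>s. s \<in> total G (?M \<boxtimes> (X \<boxtimes> Y)) \<Longrightarrow> fn (asc' ?M X Y) s = F s"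
      using graded_hom_lin[OF as] by blast
    obtain \<rho> where \<rho>: "lin \<rho>" "\<And>s. s \<in> total G (fst ?U1) \<Longrightarrow> mact (snd ?U1) h s = \<rho> s"
      using mact_extend[OF moduleD(2)[OF H U1(1)] Hc h] by blast
    obtain \<sigma> where \<sigma>: "lin \<sigma>" "\<And>s. s \<in> total G (fst ?U2) \<Longrightarrow> mact (snd ?U2) h s = \<sigma> s"
      using mact_extend[OF moduleD(2)[OF H U2(1)] Hc h] by blast
    have l: "fn (asc' ?M X Y) (mact (snd ?U1) h (pure_tensor v s)) = F (\<rho> (pure_tensor v s))"
      "mact (snd ?U2) h (fn (asc' ?M X Y) (pure_tensor v s)) = \<sigma> (F (pure_tensor v s))"
      if s: "s \<in> total G (X \<boxtimes> Y)" for s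
    proof -
      note p = pure_total[OF vt s]
      have p': "pure_tensor v s \<in> total G (fst ?U1)" using p by simp
      have q: "mact (snd ?U1) h (pure_tensor v s) \<in> total G (?M \<boxtimes> (X \<boxtimes> Y))"
        using moduleD(6)[OF H U1(1) h p'] by simp
      show "fn (asc' ?M X Y) (mact (snd ?U1) h (pure_tensor v s)) = F (\<rho> (pure_tensor v s))"
        using F(2)[OF q] \<rho>(2)[OF p'] by simp
      show "mact (snd ?U2) h (fn (asc' ?M X Y) (pure_tensor v s)) = \<sigma> (F (pure_tensor v s))"
        using \<sigma>(2)[OF graded_homD(6)[OF as' p]] F(2)[OF p] by simp
    qed
    have "F (\<rho> (pure_tensor v t)) = \<sigma> (F (pure_tensor v t))"
      using t lin_comp[OF lin_comp[OF lin_pure_right \<rho>(1)] F(1)]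
          lin_comp[OF lin_comp[OF lin_pure_right F(1)] \<sigma>(1)]
    proof (rule tensor_lin_eq)
      fix x y a b assume xy: "x \<in> carrier G" "y \<in> carrier G" "x \<otimes> y = c" and a: "a \<in> X x"
          and b: "b \<in> Y y"
      have at: "a \<in> total G X" using xy(1) a by (rule total_component)
      have bt: "b \<in> total G Y" using xy(2) b by (rule total_component)
      have zx: "z \<otimes> x \<in> carrier G" using z xy by simp
      have xyc: "x \<otimes> y \<in> carrier G" using xy c by simp
      have ab: "pure_tensor a b \<in> (X \<boxtimes> Y) (x \<otimes> y)"
        by (rule tensor_component[where V = X and W = Y, OF xy(1,2) a b])
      have va: "pure_tensor v a \<in> fst (mod_act H \<psi> U X) (z \<otimes> x)"
        using tensor_component[where V = ?M and W = X, OF z xy(1) v a] by simp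
      have pvab: "pure_tensor (pure_tensor v a) b \<in> total G (fst ?U2)"
        using pure_total[OF pure_total[OF vt at] bt] by simp
      note pent = pentagon[OF hc z xy(1,2)]
      have "fn (asc' ?M X Y) (mact (snd ?U1) h (pure_tensor v (pure_tensor a b)))
          = scale (\<omega> h z (x \<otimes> y) * \<omega> (h \<otimes> z) x y) (pure_tensor (pure_tensor (mact (snd U) h v) a)
              b)"
        unfolding U1(2)[OF h z xyc v ab]
            graded_hom_scale[OF as pure_total[OF hvt pure_total[OF at bt]]]
          asc'_apply[OF u(1) X Y hz xy(1,2) hv a b] vec.scale_scale ..
      also have "\<dots> = scale (\<omega> z x y * \<omega> h (z \<otimes> x) y * \<omega> h z x)
          (pure_tensor (pure_tensor (mact (snd U) h v) a) b)"
        using pent by (simp add: mult.commute)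
      also have "\<dots> = mact (snd ?U2) h (fn (asc' ?M X Y) (pure_tensor v (pure_tensor a b)))"
        unfolding asc'_apply[OF u(1) X Y z xy(1,2) v a b] moduleD(7)[OF H U2(1) h pvab]
          U2(2)[OF h zx xy(2) va b] UX(2)[OF h z xy(1) v a] pure_scale_left vec.scale_scale
        by (simp add: ac_simps)
      finally show "F (\<rho> (pure_tensor v (pure_tensor a b)))
          = \<sigma> (F (pure_tensor v (pure_tensor a b)))"
        using l[OF pure_total[OF at bt]] by simp
    qed
    moreover have "t \<in> total G (X \<boxtimes> Y)" using c t by (rule total_component)
    ultimately show ?thesis using l by simp
  qed
  show ?thesis
    unfolding M0_simps
  proof (rule M0_HomI[OF H U1(1) U2(1)])
    show "asc' ?M X Y \<in> hom (fst ?U1) (fst ?U2)"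
      using as by simp
    fix h x t assume *: "h \<in> H" "x \<in> carrier G" "t \<in> fst ?U1 x"
    show "fn (asc' ?M X Y) (mact (snd ?U1) h t) = mact (snd ?U2) h (fn (asc' ?M X Y) t)"
      by (rule equivariant_tensorI[OF H U1(1) U2(1) fst_mod_act as' *(1) eqv[OF *(1)] *(2)])
        (use *(3) in simp_all)
  qed
qed

lemma tens_comp_apply:
  assumes f: "f \<in> hom U V" and h: "h \<in> hom V W" and X: "X \<in> spaces" and t: "t \<in> total G (U \<boxtimes> X)"
  shows "fn (h \<otimes>\<otimes> idn X) (fn (f \<otimes>\<otimes> idn X) t) = fn ((h \<odot> f) \<otimes>\<otimes> idn X) t"
proof -
  note i = idn_hom[OF X]
  note fX = tens_hom[OF f i] and hX = tens_hom[OF h i] and hfX = tens_hom[OF cc_hom[OF f h] i]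
  have "(h \<otimes>\<otimes> idn X) \<odot> (f \<otimes>\<otimes> idn X) = (h \<odot> f) \<otimes>\<otimes> idn X"
  proof (rule tensor_hom_eqI[OF cc_hom[OF fX hX] hfX])
    fix x y v w assume *: "x \<in> carrier G" "y \<in> carrier G" "v \<in> U x" "w \<in> X y"
    have v: "v \<in> total G U" using *(1,3) by (rule total_component)
    have w: "w \<in> total G X" using *(2,4) by (rule total_component)
    show "fn ((h \<otimes>\<otimes> idn X) \<odot> (f \<otimes>\<otimes> idn X)) (pure_tensor v w)
        = fn ((h \<odot> f) \<otimes>\<otimes> idn X) (pure_tensor v w)"
      unfolding cc_apply[OF fX pure_total[OF v w]] tens_apply[OF f i v w] idn_apply[OF w]
        tens_apply[OF h i graded_homD(6)[OF f v] w] tens_apply[OF cc_hom[OF f h] i v w]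
            cc_apply[OF f v] ..
  qed
  with cc_apply[OF fX t, of "h \<otimes>\<otimes> idn X"] show ?thesis by simp
qed

lemma module_functorD:
  assumes F: "is_module_functor (vec_cat G \<omega>) (MC H \<psi>) (MC L \<xi>) Fo Fa \<zeta>"
  shows "is_functor (MC H \<psi>) (MC L \<xi>) Fo Fa"
    and "\<And>U X. U \<in> modules H \<psi> \<Longrightarrow> X \<in> spaces \<Longrightarrow>
      \<zeta> U X \<in> Hom (MC L \<xi>) (Fo (mod_act H \<psi> U X)) (mod_act L \<xi> (Fo U) X)"
    and "\<And>U X. U \<in> modules H \<psi> \<Longrightarrow> X \<in> spaces \<Longrightarrow> iso_arrow (MC L \<xi>) (\<zeta> U X)"
    and "\<And>f h U V X Y. f \<in> Hom (MC H \<psi>) U V \<Longrightarrow> h \<in> hom X Y \<Longrightarrow>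
      Comp (MC L \<xi>) (\<zeta> V Y) (Fa (act_arr (MC H \<psi>) f h))
          = Comp (MC L \<xi>) (act_arr (MC L \<xi>) (Fa f) h) (\<zeta> U X)"
    and "\<And>U X Y. U \<in> modules H \<psi> \<Longrightarrow> X \<in> spaces \<Longrightarrow> Y \<in> spaces \<Longrightarrow>
      Comp (MC L \<xi>) (act_arr (MC L \<xi>) (\<zeta> U X) (idn Y))
        (Comp (MC L \<xi>) (\<zeta> (mod_act H \<psi> U X) Y) (Fa (act_assoc (MC H \<psi>) U X Y)))
      = Comp (MC L \<xi>) (act_assoc (MC L \<xi>) (Fo U) X Y) (\<zeta> U (X \<boxtimes> Y))"
    and "\<And>U. U \<in> modules H \<psi> \<Longrightarrow>
      Comp (MC L \<xi>) (act_unit (MC L \<xi>) (Fo U)) (\<zeta> U (graded_unit G)) = Fa (act_unit (MC H \<psi>) U)"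
proof -
  note F' = F[unfolded is_module_functor_def]
  show "is_functor (MC H \<psi>) (MC L \<xi>) Fo Fa"
    using F' by blast
  have o: "U \<in> Obj (MC H \<psi>)" if "U \<in> modules H \<psi>" for U using that by simp
  have o': "X \<in> Obj (vec_cat G \<omega>)" if "X \<in> spaces" for X using that by simp
  show "\<zeta> U X \<in> Hom (MC L \<xi>) (Fo (mod_act H \<psi> U X)) (mod_act L \<xi> (Fo U) X)"
      "iso_arrow (MC L \<xi>) (\<zeta> U X)"
    if "U \<in> modules H \<psi>" "X \<in> spaces" for U X
    using F'[THEN conjunct2, THEN conjunct1, rule_format, OF o[OF that(1)] o'[OF that(2)]]
        by simp_all
  show "Comp (MC L \<xi>) (\<zeta> V Y) (Fa (act_arr (MC H \<psi>) f h))
      = Comp (MC L \<xi>) (act_arr (MC L \<xi>) (Fa f) h) (\<zeta> U X)"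
    if "f \<in> Hom (MC H \<psi>) U V" "h \<in> hom X Y" for f h U V X Y
  proof -
    have "f \<in> Arr (MC H \<psi>)" "h \<in> Arr (vec_cat G \<omega>)" "Dom (MC H \<psi>) f = U" "Cod (MC H \<psi>) f = V"
      "Dom (vec_cat G \<omega>) h = X" "Cod (vec_cat G \<omega>) h = Y"
      using that by (auto simp: Hom_def graded_hom_def)
    with F'[THEN conjunct2, THEN conjunct2, THEN conjunct1, rule_format, of f h] show ?thesis
        by simp
  qed
  show "Comp (MC L \<xi>) (act_arr (MC L \<xi>) (\<zeta> U X) (idn Y))
        (Comp (MC L \<xi>) (\<zeta> (mod_act H \<psi> U X) Y) (Fa (act_assoc (MC H \<psi>) U X Y)))
      = Comp (MC L \<xi>) (act_assoc (MC L \<xi>) (Fo U) X Y) (\<zeta> U (X \<boxtimes> Y))"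
    if "U \<in> modules H \<psi>" "X \<in> spaces" "Y \<in> spaces" for U X Y
    using F'[THEN conjunct2, THEN conjunct2, THEN conjunct2, THEN conjunct1, rule_format,
        OF o[OF that(1)] o'[OF that(2)] o'[OF that(3)]] by simp
  show "Comp (MC L \<xi>) (act_unit (MC L \<xi>) (Fo U)) (\<zeta> U (graded_unit G)) = Fa (act_unit (MC H \<psi>) U)"
    if "U \<in> modules H \<psi>" for U
    using F'[THEN conjunct2, THEN conjunct2, THEN conjunct2, THEN conjunct2, rule_format, OF
        o[OF that]] by simp
qed

text \<open>
  The right multiplication of the regular module is transported along the functor and its
  constraint; it makes the image of the regular module a bimodule.
\<close>

lemma functor_bimodule:
  assumes H: "subgroup H G" and L: "subgroup L G" and A: "reg H \<psi> \<in> modules H \<psi>"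
    and one_all: "\<forall>h\<in>H. \<psi> h \<one> = 1"
    and d_all: "\<forall>a\<in>H. \<forall>b\<in>H. \<forall>c\<in>H.
      \<psi> b c * \<psi> a (b \<otimes> c) = \<omega> a b c * \<psi> (a \<otimes> b) c * \<psi> a b"
    and F: "is_module_functor (vec_cat G \<omega>) (MC H \<psi>) (MC L \<xi>) Fo Fa \<zeta>"
  defines "N \<equiv> Fo (reg H \<psi>)"
  shows "\<exists>R\<in>hom (fst N \<boxtimes> twisted_space H) (fst N).
    (\<forall>l\<in>L. \<forall>h\<in>H. \<forall>x\<in>carrier G. \<forall>v\<in>fst N x.
      scale (\<omega> l x h) (fn R (pure_tensor (mact (snd N) l v) (ev h)))
          = mact (snd N) l (fn R (pure_tensor v (ev h)))) \<and>
    (\<forall>h\<in>H. \<forall>k\<in>H. \<forall>x\<in>carrier G. \<forall>v\<in>fst N x.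
      scale (\<omega> x h k) (fn R (pure_tensor (fn R (pure_tensor v (ev h))) (ev k)))
        = scale (\<psi> h k) (fn R (pure_tensor v (ev (h \<otimes> k))))) \<and>
    (\<forall>x\<in>carrier G. \<forall>v\<in>fst N x. fn R (pure_tensor v (ev \<one>)) = v)"
proof -
  interpret C: cat "MC H \<psi>" by (rule cat_M0[OF H])
  interpret D: cat "MC L \<xi>" by (rule cat_M0[OF L])
  note one = one_all[rule_format] and d = d_all[rule_format]
  note Hc = subgroup_carrier[OF H]
  let ?T = "twisted_space H :: ('g, 'k) graded" and ?A = "reg H \<psi>" and ?m
      = "alg_mult (twisted_algebra G H \<psi>)"
  let ?u = "alg_unit (twisted_algebra G H \<psi>)"
  note T = twisted_space[OF Hc] and m = alg_mult[OF H, where \<psi> = \<psi>] and u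
      = alg_unit[OF H, where \<psi> = \<psi>]
  note TT = tensor_space[OF T T] and i = idn_hom[OF T]
  note F' = module_functorD[OF F]
  let ?AT = "mod_act H \<psi> ?A ?T"
  let ?A1 = "mod_act H \<psi> ?A (?T \<boxtimes> ?T)" and ?A2 = "mod_act H \<psi> ?AT ?T"
  note AT = mod_act_modules[OF H A T]
  define r where "r = reg_mult H \<psi>"
  have r: "r \<in> Hom (MC H \<psi>) ?AT ?A"
    unfolding r_def by (rule reg_mult[OF H A d])
  have fnr: "fn r = ?m"
    by (simp add: r_def reg_mult_def)
  note idA = C.ident_hom[of ?A, simplified M0_simps(1), OF A]
  \<comment> \<open>\<open>q\<close> multiplies the first two of three factors, \<open>\<mu>\<close>
    rebrackets, and \<open>j\<close> multiplies the last two.\<close>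
  define q where "q = act_arr (MC H \<psi>) r (idn ?T)"
  define \<mu> where "\<mu> = act_assoc (MC H \<psi>) ?A ?T ?T"
  define j where "j = act_arr (MC H \<psi>) (Ident (MC H \<psi>) ?A) ?m"
  have q: "q \<in> Hom (MC H \<psi>) ?A2 ?AT"
    unfolding q_def by (rule act_arr_hom[OF H r i])
  have \<mu>: "\<mu> \<in> Hom (MC H \<psi>) ?A1 ?A2"
    unfolding \<mu>_def by (rule act_assoc_hom[OF H A T T])
  have j: "j \<in> Hom (MC H \<psi>) ?A1 ?AT"
    unfolding j_def by (rule act_arr_hom[OF H idA m(1)])
  have fnq: "fn q = ?m \<otimes>\<otimes> idn ?T" and fn\<mu>: "fn \<mu> = asc' ?T ?T ?T" and fnj: "fn j = idn ?T \<otimes>\<otimes> ?m"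
    by (simp_all add: q_def \<mu>_def j_def fnr)
  \<comment> \<open>Associativity of right multiplication, written inside the module category so
    that the functor applies to it.\<close>
  have assoc_eq: "Comp (MC H \<psi>) r (Comp (MC H \<psi>) q \<mu>) = Comp (MC H \<psi>) r j"
    using M0_HomD(3)[OF H \<mu>] M0_HomD(3)[OF H j] reg_assoc[OF H A]
    by (simp add: fnr fnq fn\<mu> fnj)
  note z1 = F'(2)[OF A T] and z2 = F'(2)[OF AT T] and z3 = F'(2)[OF A TT]
  note Fr = functor_hom[OF F'(1) r] and Fq = functor_hom[OF F'(1) q]
    and F\<mu> = functor_hom[OF F'(1) \<mu>] and Fj = functor_hom[OF F'(1) j]
  note N = M0_HomD(2)[OF L Fr, folded N_def]
  note n = moduleD[OF L N]
  \<comment> \<open>An inverse of the constraint turns the image of right multiplication into a map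
    out of the product of \<open>N\<close> with the algebra.\<close>
  obtain Z where Z: "Z \<in> Hom (MC L \<xi>) (mod_act L \<xi> N ?T) (Fo ?AT)"
    "Comp (MC L \<xi>) Z (\<zeta> ?A ?T) = Ident (MC L \<xi>) (Fo ?AT)"
    using D.iso_arrow_inverse[OF F'(3)[OF A T] z1] unfolding N_def by metis
  define R where "R = Comp (MC L \<xi>) (Fa r) Z"
  have R: "R \<in> Hom (MC L \<xi>) (mod_act L \<xi> N ?T) N"
    unfolding R_def using D.comp_hom[OF Z(1) Fr] unfolding N_def .
  note R' = M0_HomD[OF L R]
  have fnR: "fn R \<in> hom (fst N \<boxtimes> ?T) (fst N)"
    using R'(5) by simp
  have Rz: "Comp (MC L \<xi>) R (\<zeta> ?A ?T) = Fa r"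
    unfolding R_def D.comp_assoc[OF z1 Z(1)[unfolded N_def] Fr] Z(2) by (rule D.ident_right[OF Fr])
  then have fnRz: "fn R \<odot> fn (\<zeta> ?A ?T) = fn (Fa r)"
    by (metis M0_simps(6) arrow.sel(3))
  have Rz_apply: "fn (fn R) (fn (fn (\<zeta> ?A ?T)) w) = fn (fn (Fa r)) w"
      if "w \<in> total G (fst (Fo ?AT))" for w
    using M0_comp_apply[OF L z1 that, of R] unfolding Rz by simp
  have fnz1: "fn (\<zeta> ?A ?T) \<in> hom (fst (Fo ?AT)) (fst N \<boxtimes> ?T)"
    using M0_HomD(5)[OF L z1] unfolding N_def by simp
  \<comment> \<open>Associativity of \<open>R\<close>. Every tensor \<open>w\<close> is the image of
    some \<open>s\<close> under the constraint; on \<open>s\<close> the pentagon of the functor and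
    naturality in \<open>r\<close> and in the multiplication reduce the claim to the image of
    \<open>assoc_eq\<close>.\<close>
  have key: "fn (fn R) (fn (fn R \<otimes>\<otimes> idn ?T) (fn (asc' (fst N) ?T ?T) w))
      = fn (fn R) (fn (idn (fst N) \<otimes>\<otimes> ?m) w)"
    if w: "w \<in> total G (fst N \<boxtimes> (?T \<boxtimes> ?T))" for w
  proof -
    obtain Z3 where Z3: "Z3 \<in> Hom (MC L \<xi>) (mod_act L \<xi> N (?T \<boxtimes> ?T)) (Fo ?A1)"
      "Comp (MC L \<xi>) (\<zeta> ?A (?T \<boxtimes> ?T)) Z3 = Ident (MC L \<xi>) (mod_act L \<xi> N (?T \<boxtimes> ?T))"
      using D.iso_arrow_inverse[OF F'(3)[OF A TT] z3] unfolding N_def by metis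
    define s where "s = fn (fn Z3) w"
    have w': "w \<in> total G (fst (mod_act L \<xi> N (?T \<boxtimes> ?T)))" using w by simp
    have s: "s \<in> total G (fst (Fo ?A1))"
      unfolding s_def by (rule graded_homD(6)[OF M0_HomD(5)[OF L Z3(1)] w'])
    have zs: "fn (fn (\<zeta> ?A (?T \<boxtimes> ?T))) s = w"
      using M0_comp_apply[OF L Z3(1) w', of "\<zeta> ?A (?T \<boxtimes> ?T)"] idn_apply[OF w]
          unfolding Z3(2) s_def by simp
    define a where "a = fn (fn (Fa \<mu>)) s"
    have a: "a \<in> total G (fst (Fo ?A2))"
      unfolding a_def by (rule graded_homD(6)[OF M0_HomD(5)[OF L F\<mu>] s])
    define b where "b = fn (fn (\<zeta> ?AT ?T)) a"
    have b: "b \<in> total G (fst (Fo ?AT) \<boxtimes> ?T)"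
      unfolding b_def using graded_homD(6)[OF M0_HomD(5)[OF L z2] a] by simp
    have pent: "fn (fn (\<zeta> ?A ?T) \<otimes>\<otimes> idn ?T) b = fn (asc' (fst N) ?T ?T) w"
    proof -
      have "Comp (MC L \<xi>) (act_arr (MC L \<xi>) (\<zeta> ?A ?T) (idn ?T)) (Comp (MC L \<xi>) (\<zeta> ?AT ?T) (Fa \<mu>))
          = Comp (MC L \<xi>) (act_assoc (MC L \<xi>) N ?T ?T) (\<zeta> ?A (?T \<boxtimes> ?T))"
        using F'(5)[OF A T T] unfolding \<mu>_def N_def .
      then have "fn (fn (Comp (MC L \<xi>) (act_arr (MC L \<xi>) (\<zeta> ?A ?T) (idn ?T))
          (Comp (MC L \<xi>) (\<zeta> ?AT ?T) (Fa \<mu>)))) s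
          = fn (fn (Comp (MC L \<xi>) (act_assoc (MC L \<xi>) N ?T ?T) (\<zeta> ?A (?T \<boxtimes> ?T)))) s"
        by (rule arg_cong)
      then show ?thesis
        unfolding M0_comp_apply[OF L D.comp_hom[OF F\<mu> z2] s] M0_comp_apply[OF L F\<mu> s]
            M0_comp_apply[OF L z3 s]
          a_def[symmetric] b_def[symmetric] zs by simp
    qed
    have nat1: "fn (fn (\<zeta> ?A ?T)) (fn (fn (Fa q)) a) = fn (fn (Fa r) \<otimes>\<otimes> idn ?T) b"
      using arg_cong[OF F'(4)[OF r i], of "\<lambda>f. fn (fn f) a"]
      unfolding q_def[symmetric] M0_comp_apply[OF L Fq a] M0_comp_apply[OF L z2 a]
          b_def[symmetric] by simp
    have FId: "Fa (Ident (MC H \<psi>) ?A) = Ident (MC L \<xi>) N"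
      using F'(1) A unfolding is_functor_def N_def by (simp only: M0_simps)
    have nat2: "fn (fn (\<zeta> ?A ?T)) (fn (fn (Fa j)) s) = fn (idn (fst N) \<otimes>\<otimes> ?m) w"
      using arg_cong[OF F'(4)[OF idA m(1)], of "\<lambda>f. fn (fn f) s"]
      unfolding j_def[symmetric] M0_comp_apply[OF L Fj s] M0_comp_apply[OF L z3 s] zs FId by simp
    have Feq: "fn (fn (Fa r)) (fn (fn (Fa q)) a) = fn (fn (Fa r)) (fn (fn (Fa j)) s)"
    proof -
      have "Comp (MC L \<xi>) (Fa r) (Comp (MC L \<xi>) (Fa q) (Fa \<mu>)) = Comp (MC L \<xi>) (Fa r) (Fa j)"
        using assoc_eq functor_comp[OF F'(1) \<mu> q] functor_comp[OF F'(1) C.comp_hom[OF \<mu> q] r]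
          functor_comp[OF F'(1) j r] by metis
      then have "fn (fn (Comp (MC L \<xi>) (Fa r) (Comp (MC L \<xi>) (Fa q) (Fa \<mu>)))) s
          = fn (fn (Comp (MC L \<xi>) (Fa r) (Fa j))) s"
        by (rule arg_cong)
      then show ?thesis
        unfolding M0_comp_apply[OF L D.comp_hom[OF F\<mu> Fq] s] M0_comp_apply[OF L F\<mu> s]
          M0_comp_apply[OF L Fj s] a_def[symmetric] .
    qed
    have qa: "fn (fn (Fa q)) a \<in> total G (fst (Fo ?AT))"
      by (rule graded_homD(6)[OF M0_HomD(5)[OF L Fq] a])
    have js: "fn (fn (Fa j)) s \<in> total G (fst (Fo ?AT))"
      by (rule graded_homD(6)[OF M0_HomD(5)[OF L Fj] s])
    have "fn (fn R) (fn (fn R \<otimes>\<otimes> idn ?T) (fn (asc' (fst N) ?T ?T) w))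
        = fn (fn R) (fn (fn (Fa r) \<otimes>\<otimes> idn ?T) b)"
      unfolding pent[symmetric] tens_comp_apply[OF fnz1 fnR T b] fnRz ..
    also have "\<dots> = fn (fn R) (fn (idn (fst N) \<otimes>\<otimes> ?m) w)"
      unfolding nat1[symmetric] Rz_apply[OF qa] Feq Rz_apply[OF js, symmetric] nat2 ..
    finally show ?thesis .
  qed
  \<comment> \<open>The same method: naturality in the unit of the algebra and the unit axiom of the
    functor reduce the claim to \<open>reg_unit\<close>.\<close>
  have unit: "fn (fn R) (pure_tensor v (ev \<one>)) = v" if v: "v \<in> total G (fst N)" for v
  proof -
    define k where "k = act_arr (MC H \<psi>) (Ident (MC H \<psi>) ?A) ?u"
    have k: "k \<in> Hom (MC H \<psi>) (mod_act H \<psi> ?A (graded_unit G)) ?AT"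
      unfolding k_def by (rule act_arr_hom[OF H idA u(1)])
    note Fk = functor_hom[OF F'(1) k] and z0 = F'(2)[OF A unit_space]
    have rk: "Comp (MC H \<psi>) r k = act_unit (MC H \<psi>) ?A"
      using reg_unit[where \<psi> = \<psi>, OF H one] M0_HomD(4)[OF H r] graded_homD(1)[OF u(1)]
          by (simp add: k_def fnr)
    obtain Z0 where Z0: "Z0 \<in> Hom (MC L \<xi>) (mod_act L \<xi> N (graded_unit G))
        (Fo (mod_act H \<psi> ?A (graded_unit G)))"
      "Comp (MC L \<xi>) (\<zeta> ?A (graded_unit G)) Z0 = Ident (MC L \<xi>) (mod_act L \<xi> N (graded_unit G))"
      using D.iso_arrow_inverse[OF F'(3)[OF A unit_space] z0] unfolding N_def by metis
    let ?w = "pure_tensor v uv"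
    have w: "?w \<in> total G (fst N \<boxtimes> graded_unit G)"
      by (rule pure_total[OF v uv_total])
    then have w': "?w \<in> total G (fst (mod_act L \<xi> N (graded_unit G)))" by simp
    define s where "s = fn (fn Z0) ?w"
    have s: "s \<in> total G (fst (Fo (mod_act H \<psi> ?A (graded_unit G))))"
      unfolding s_def by (rule graded_homD(6)[OF M0_HomD(5)[OF L Z0(1)] w'])
    have zs: "fn (fn (\<zeta> ?A (graded_unit G))) s = ?w"
      using M0_comp_apply[OF L Z0(1) w', of "\<zeta> ?A (graded_unit G)"] idn_apply[OF w]
          unfolding Z0(2) s_def by simp
    have FId: "Fa (Ident (MC H \<psi>) ?A) = Ident (MC L \<xi>) N"
      using F'(1) A unfolding is_functor_def N_def by (simp only: M0_simps)
    have nat: "fn (fn (\<zeta> ?A ?T)) (fn (fn (Fa k)) s) = fn (idn (fst N) \<otimes>\<otimes> ?u) ?w"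
      using arg_cong[OF F'(4)[OF idA u(1)], of "\<lambda>f. fn (fn f) s"]
      unfolding k_def[symmetric] M0_comp_apply[OF L Fk s] M0_comp_apply[OF L z0 s] zs FId by simp
    have ks: "fn (fn (Fa k)) s \<in> total G (fst (Fo ?AT))"
      by (rule graded_homD(6)[OF M0_HomD(5)[OF L Fk] s])
    have "fn (fn R) (pure_tensor v (ev \<one>)) = fn (fn R) (fn (idn (fst N) \<otimes>\<otimes> ?u) ?w)"
      unfolding tens_apply[OF idn_hom[OF n(1)] u(1) v uv_total] idn_apply[OF v] u(2) ..
    also have "\<dots> = fn (fn (Fa r)) (fn (fn (Fa k)) s)"
      unfolding nat[symmetric] Rz_apply[OF ks] ..
    also have "\<dots> = fn (fn (Fa (act_unit (MC H \<psi>) ?A))) s"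
      unfolding rk[symmetric] functor_comp[OF F'(1) k r] M0_comp_apply[OF L Fk s] ..
    also have "\<dots> = fn (runit (vec_cat G \<omega>) (fst N)) ?w"
      unfolding F'(6)[OF A, symmetric] M0_comp_apply[OF L z0 s] zs N_def by simp
    also have "\<dots> = v"
      by (rule runit_apply[OF n(1) v])
    finally show ?thesis .
  qed
  show ?thesis
  proof (intro bexI[of _ "fn R"] conjI ballI fnR)
    fix l h x v assume l: "l \<in> L" and h: "h \<in> H" and x: "x \<in> carrier G" and v: "v \<in> fst N x"
    have hc: "h \<in> carrier G" using h Hc by auto
    have vt: "v \<in> total G (fst N)" using x v by (rule total_component)
    have xh: "x \<otimes> h \<in> carrier G" using x hc by simp
    have p: "pure_tensor v (ev h) \<in> fst (mod_act L \<xi> N ?T) (x \<otimes> h)"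
      using tensor_component[where V = "fst N" and W = ?T, OF x hc v ev_mem[OF h]] by simp
    have q: "pure_tensor (mact (snd N) l v) (ev h) \<in> total G (fst N \<boxtimes> ?T)"
      by (rule pure_total[OF n(6)[OF l vt] ev_total[OF Hc h]])
    show "scale (\<omega> l x h) (fn (fn R) (pure_tensor (mact (snd N) l v) (ev h)))
        = mact (snd N) l (fn (fn R) (pure_tensor v (ev h)))"
      unfolding R'(6)[OF l xh p, symmetric] mod_act_apply[OF L N T l x hc v ev_mem[OF h]]
        graded_hom_scale[OF fnR q] ..
  next
    fix h k x v assume h: "h \<in> H" and k: "k \<in> H" and x: "x \<in> carrier G" and v: "v \<in> fst N x"
    have hc: "h \<in> carrier G" and kc: "k \<in> carrier G" using h k Hc by auto
    have hk: "h \<otimes> k \<in> H" using H h k by (rule subgroup.m_closed)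
    have vt: "v \<in> total G (fst N)" using x v by (rule total_component)
    note eh = ev_total[OF Hc h] and ek = ev_total[OF Hc k]
    have w: "pure_tensor v (pure_tensor (ev h) (ev k)) \<in> total G (fst N \<boxtimes> (?T \<boxtimes> ?T))"
      by (intro pure_total vt eh ek)
    note vh = pure_total[OF vt eh] and RT = tens_hom[OF fnR i]
    note Rvh = graded_homD(6)[OF fnR vh]
    have pk: "pure_tensor (fn (fn R) (pure_tensor v (ev h))) (ev k) \<in> total G (fst N \<boxtimes> ?T)"
      by (rule pure_total[OF Rvh ek])
    have pm: "pure_tensor v (ev (h \<otimes> k)) \<in> total G (fst N \<boxtimes> ?T)"
      by (rule pure_total[OF vt ev_total[OF Hc hk]])
    show "scale (\<omega> x h k) (fn (fn R) (pure_tensor (fn (fn R) (pure_tensor v (ev h))) (ev k)))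
        = scale (\<psi> h k) (fn (fn R) (pure_tensor v (ev (h \<otimes> k))))"
      using key[OF w]
      unfolding asc'_apply[OF n(1) T T x hc kc v ev_mem[OF h] ev_mem[OF k]]
        graded_hom_scale[OF RT pure_total[OF vh ek]] tens_apply[OF fnR i vh ek] idn_apply[OF ek]
        graded_hom_scale[OF fnR pk]
        tens_apply[OF idn_hom[OF n(1)] m(1) vt pure_total[OF eh ek]] idn_apply[OF vt] m(2)[OF h k]
        pure_scale_right graded_hom_scale[OF fnR pm] .
  next
    fix x v assume "x \<in> carrier G" "v \<in> fst N x"
    then have "v \<in> total G (fst N)" by (rule total_component)
    then show "fn (fn R) (pure_tensor v (ev \<one>)) = v" by (rule unit)
  qed
qed


section \<open>Full faithfulness applied to the regular module\<close>

lemma reg_idempotent: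
  assumes H: "subgroup H G" and A: "reg H \<psi> \<in> modules H \<psi>" and one: "\<And>h. h \<in> H \<Longrightarrow> \<psi> h \<one> = 1"
    and f: "f \<in> Hom (MC H \<psi>) (reg H \<psi>) (reg H \<psi>)" and ff: "Comp (MC H \<psi>) f f = f"
  shows "f = Ident (MC H \<psi>) (reg H \<psi>) \<or>
    f = Arrow (reg H \<psi>) (reg H \<psi>) (lin_arrow G (twisted_space H) (twisted_space H) (\<lambda>_. 0))"
proof -
  note Hc = subgroup_carrier[OF H] and H1 = subgroup.one_closed[OF H]
  note T = twisted_space[OF Hc]
  note f' = M0_HomD[OF H f]
  have fT: "fn f \<in> hom (twisted_space H) (twisted_space H)"
    using f'(5) by simp
  obtain c where c: "\<And>h. h \<in> H \<Longrightarrow> fn (fn f) (ev h) = scale c (ev h)"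
    using reg_endo[OF H A one f] by blast
  have t1: "ev \<one> \<in> total G (twisted_space H)" by (rule ev_total[OF Hc H1])
  have "scale (c * c) (ev \<one> :: ('g, 'k) vec) = fn (fn f) (fn (fn f) (ev \<one>))"
    unfolding c[OF H1] graded_hom_scale[OF fT t1] vec.scale_scale ..
  also have "\<dots> = fn (fn (Comp (MC H \<psi>) f f)) (ev \<one>)"
    using cc_apply[OF fT t1, of "fn f"] by simp
  also have "\<dots> = scale c (ev \<one>)"
    unfolding ff by (rule c[OF H1])
  finally have "c * c = c"
    using vec.scale_right_imp_eq[OF basis_vec_nonzero] by blast
  then have "c = 1 \<or> c = 0" by auto
  then show ?thesis
  proof
    assume c1: "c = 1"
    have "fn f = idn (twisted_space H)"
      by (rule twisted_hom_eqI[OF fT idn_hom[OF T] Hc]) (simp add: c c1 idn_apply ev_total[OF Hc])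
    then have "f = Ident (MC H \<psi>) (reg H \<psi>)"
      using f'(3,4) by (auto intro!: arrow_eqI)
    then show ?thesis ..
  next
    assume c0: "c = 0"
    have "fn f = lin_arrow G (twisted_space H) (twisted_space H) (\<lambda>_. 0)"
      by (rule twisted_hom_eqI[OF fT zero_arrow_hom[OF T T] Hc])
        (simp only: c c0 lin_arrow_apply[OF ev_total[OF Hc]] vec.scale_zero_left)
    then have "f = Arrow (reg H \<psi>) (reg H \<psi>) (lin_arrow G (twisted_space H) (twisted_space H)
        (\<lambda>_. 0))"
      using f'(3,4) by (auto intro!: arrow_eqI)
    then show ?thesis ..
  qed
qed

text \<open>Idempotents of \<open>N\<close> lift to idempotents of the regular module, of which
  there are only two. The zero arrow of \<open>N\<close> is lifted too: its lift cannot be the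
  identity, so it is the zero arrow, and the lift of \<open>t\<close> differs from it because
  \<open>t\<close> fixes a nonzero vector. Thus \<open>t\<close> lifts to the identity.\<close>

lemma equivalence_reg_idempotent:
  assumes H: "subgroup H G" and L: "subgroup L G" and A: "reg H \<psi> \<in> modules H \<psi>"
    and one: "\<And>h. h \<in> H \<Longrightarrow> \<psi> h \<one> = 1"
    and E: "is_equivalence (MC H \<psi>) (MC L \<xi>) Fo Fa"
  defines "N \<equiv> Fo (reg H \<psi>)"
  assumes t: "t \<in> Hom (MC L \<xi>) N N" "Comp (MC L \<xi>) t t = t"
    and v: "v \<in> total G (fst N)" "v \<noteq> 0" "fn (fn t) v = v"
  shows "t = Ident (MC L \<xi>) N"
proof -
  interpret C: cat "MC H \<psi>" by (rule cat_M0[OF H])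
  interpret D: cat "MC L \<xi>" by (rule cat_M0[OF L])
  let ?A = "reg H \<psi>"
  from E have F: "is_functor (MC H \<psi>) (MC L \<xi>) Fo Fa"
    unfolding is_equivalence_def by blast
  have A': "?A \<in> Obj (MC H \<psi>)" using A by simp
  have N: "N \<in> modules L \<xi>" using M0_HomD(1)[OF L t(1)] .
  note n = moduleD[OF L N]
  have lift: "\<exists>f\<in>Hom (MC H \<psi>) ?A ?A. Fa f = s \<and> Comp (MC H \<psi>) f f = f"
    if s: "s \<in> Hom (MC L \<xi>) N N" "Comp (MC L \<xi>) s s = s" for s
  proof -
    obtain f where f: "f \<in> Hom (MC H \<psi>) ?A ?A" "Fa f = s"
      using equivalence_full[OF C.cat_axioms D.cat_axioms E A' A'] s(1) unfolding N_def by blast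
    have "Fa (Comp (MC H \<psi>) f f) = Fa f"
      unfolding functor_comp[OF F f(1) f(1)] f(2) by (rule s(2))
    then have "Comp (MC H \<psi>) f f = f"
      by (rule equivalence_faithful[OF C.cat_axioms D.cat_axioms E C.comp_hom[OF f(1) f(1)] f(1)])
    with f show ?thesis by blast
  qed
  define z where "z = Arrow N N (lin_arrow G (fst N) (fst N) (\<lambda>_. 0))"
  have z: "z \<in> Hom (MC L \<xi>) N N"
    unfolding z_def by (rule zero_M0_arrow[OF L N N])
  have zv: "fn (fn z) w = 0" if "w \<in> total G (fst N)" for w
    using lin_arrow_apply[OF that, of "fst N" "\<lambda>_. 0"] by (simp only: z_def arrow.sel)
  have fnz: "fn z \<in> hom (fst N) (fst N)" using M0_HomD(5)[OF L z] .
  have "fn z \<odot> fn z = fn z"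
  proof (rule graded_hom_eqI[OF cc_hom[OF fnz fnz] fnz])
    fix x w assume "x \<in> carrier G" "w \<in> fst N x"
    then have w: "w \<in> total G (fst N)" by (rule total_component)
    show "fn (fn z \<odot> fn z) w = fn (fn z) w"
      unfolding cc_apply[OF fnz w] zv[OF w] by (rule graded_hom_zero[OF fnz])
  qed
  then have zz: "Comp (MC L \<xi>) z z = z"
    by (auto intro!: arrow_eqI simp: z_def)
  obtain f where f: "f \<in> Hom (MC H \<psi>) ?A ?A" "Fa f = t" "Comp (MC H \<psi>) f f = f"
    using lift[OF t] by blast
  obtain f0 where f0: "f0 \<in> Hom (MC H \<psi>) ?A ?A" "Fa f0 = z" "Comp (MC H \<psi>) f0 f0 = f0"
    using lift[OF z zz] by blast
  have FId: "Fa (Ident (MC H \<psi>) ?A) = Ident (MC L \<xi>) N"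
    using F A' unfolding is_functor_def N_def by blast
  have z_ne: "z \<noteq> Ident (MC L \<xi>) N" "z \<noteq> t"
    using zv[OF v(1)] v idn_apply[OF v(1)] by auto
  from reg_idempotent[OF H A one f(1,3)] reg_idempotent[OF H A one f0(1,3)]
  show ?thesis
    using f(2) f0(2) FId z_ne by metis
qed

text \<open>If the image were zero, the images of the zero and of the identity arrow of the regular
  module would coincide, against faithfulness and \<open>ev \<one> \<noteq> 0\<close>.\<close>

lemma equivalence_reg_nonzero:
  assumes H: "subgroup H G" and L: "subgroup L G" and A: "reg H \<psi> \<in> modules H \<psi>"
    and E: "is_equivalence (MC H \<psi>) (MC L \<xi>) Fo Fa"
  shows "\<exists>x\<in>carrier G. \<exists>v\<in>fst (Fo (reg H \<psi>)) x. v \<noteq> 0"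
proof (rule ccontr)
  assume no: "\<not> ?thesis"
  interpret C: cat "MC H \<psi>" by (rule cat_M0[OF H])
  interpret D: cat "MC L \<xi>" by (rule cat_M0[OF L])
  note Hc = subgroup_carrier[OF H]
  let ?A = "reg H \<psi>" and ?N = "Fo (reg H \<psi>)"
  from E have F: "is_functor (MC H \<psi>) (MC L \<xi>) Fo Fa"
    unfolding is_equivalence_def by blast
  define z where "z = Arrow ?A ?A (lin_arrow G (fst ?A) (fst ?A) (\<lambda>_. 0))"
  have z: "z \<in> Hom (MC H \<psi>) ?A ?A"
    unfolding z_def by (rule zero_M0_arrow[OF H A A])
  have i: "Ident (MC H \<psi>) ?A \<in> Hom (MC H \<psi>) ?A ?A"
    by (rule C.ident_hom) (use A in simp)
  note Fz = M0_HomD[OF L functor_hom[OF F z]] and Fi = M0_HomD[OF L functor_hom[OF F i]]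
  have "fn (Fa z) = fn (Fa (Ident (MC H \<psi>) ?A))"
  proof (rule graded_hom_eqI[OF Fz(5) Fi(5)])
    fix x v assume "x \<in> carrier G" "v \<in> fst ?N x"
    with no have "v = 0" by blast
    then show "fn (fn (Fa z)) v = fn (fn (Fa (Ident (MC H \<psi>) ?A))) v"
      by (simp only: graded_hom_zero[OF Fz(5)] graded_hom_zero[OF Fi(5)])
  qed
  then have "Fa z = Fa (Ident (MC H \<psi>) ?A)"
    using Fz(3,4) Fi(3,4) by (intro arrow_eqI) simp_all
  then have eq: "z = Ident (MC H \<psi>) ?A"
    by (rule equivalence_faithful[OF C.cat_axioms D.cat_axioms E z i])
  have e: "ev \<one> \<in> total G (fst ?A)"
    using ev_total[OF Hc subgroup.one_closed[OF H]] by simp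
  have "(ev \<one> :: ('g, 'k) vec) = fn (fn (Ident (MC H \<psi>) ?A)) (ev \<one>)"
    using idn_apply[OF e] by simp
  also have "\<dots> = 0"
    using lin_arrow_apply[OF e, of "fst ?A" "\<lambda>_. 0"] unfolding eq[symmetric]
        by (simp only: z_def arrow.sel)
  finally show False by simp
qed

text \<open>By fullness \<open>s\<close> and the zero arrow, each composed with the constraint, come
  from arrows of modules over the algebra of \<open>H\<close>. If \<open>x\<close> is outside
  \<open>H\<close>, the source of these lives in degrees outside \<open>H\<close>, where the target
  vanishes; so they are equal, and cancelling the constraint makes \<open>s\<close> zero.\<close>

lemma equivalence_reg_degree:
  assumes H: "subgroup H G" and L: "subgroup L G" and A: "reg H \<psi> \<in> modules H \<psi>"
    and F: "is_module_functor (vec_cat G \<omega>) (MC H \<psi>) (MC L \<xi>) Fo Fa \<zeta>"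
    and E: "is_equivalence (MC H \<psi>) (MC L \<xi>) Fo Fa"
  defines "N \<equiv> Fo (reg H \<psi>)"
  assumes x: "x \<in> carrier G" and s: "s \<in> Hom (MC L \<xi>) (mod_act L \<xi> N (twisted_space {x})) N"
    and w: "w \<in> total G (fst N \<boxtimes> twisted_space {x})" "fn (fn s) w \<noteq> 0"
  shows "x \<in> H"
proof (rule ccontr)
  assume xH: "x \<notin> H"
  interpret C: cat "MC H \<psi>" by (rule cat_M0[OF H])
  interpret D: cat "MC L \<xi>" by (rule cat_M0[OF L])
  note Hc = subgroup_carrier[OF H]
  note F' = module_functorD[OF F]
  let ?A = "reg H \<psi>" and ?X = "twisted_space {x} :: ('g, 'k) graded"
  have X: "?X \<in> spaces" by (rule twisted_space) (use x in simp)
  let ?AX = "mod_act H \<psi> ?A ?X"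
  have AX: "?AX \<in> Obj (MC H \<psi>)" using mod_act_modules[OF H A X] by simp
  have A': "?A \<in> Obj (MC H \<psi>)" using A by simp
  note z1 = F'(2)[OF A X, folded N_def]
  have NX: "mod_act L \<xi> N ?X \<in> modules L \<xi>" and N: "N \<in> modules L \<xi>"
    using M0_HomD(1,2)[OF L s] .
  define z where "z = Arrow (mod_act L \<xi> N ?X) N (lin_arrow G (fst (mod_act L \<xi> N ?X)) (fst N)
      (\<lambda>_. 0))"
  have z: "z \<in> Hom (MC L \<xi>) (mod_act L \<xi> N ?X) N"
    unfolding z_def by (rule zero_M0_arrow[OF L NX N])
  obtain f where f: "f \<in> Hom (MC H \<psi>) ?AX ?A" "Fa f = Comp (MC L \<xi>) s (\<zeta> ?A ?X)"
    using equivalence_full[OF C.cat_axioms D.cat_axioms E AX A' D.comp_hom[OF z1 s, unfolded N_def]]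
    unfolding N_def by blast
  obtain k where k: "k \<in> Hom (MC H \<psi>) ?AX ?A" "Fa k = Comp (MC L \<xi>) z (\<zeta> ?A ?X)"
    using equivalence_full[OF C.cat_axioms D.cat_axioms E AX A' D.comp_hom[OF z1 z, unfolded N_def]]
    unfolding N_def by blast
  have vanish: "fn t (pure_tensor v u) = 0"
    if t: "t \<in> hom (twisted_space H \<boxtimes> ?X) (twisted_space H)" and "a \<in> carrier G" "b \<in> carrier G"
      "v \<in> twisted_space H a" "u \<in> ?X b" for t a b v u
  proof -
    have p: "fn t (pure_tensor v u) \<in> twisted_space H (a \<otimes> b)"
      by (rule graded_homD(7)[OF t]) (use that in \<open>auto intro!: tensor_component\<close>)
    show ?thesis
    proof (cases "a \<in> H \<and> b = x")
      case True
      have "a \<otimes> x \<notin> H"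
      proof
        assume ax: "a \<otimes> x \<in> H"
        have "inv a \<otimes> (a \<otimes> x) \<in> H"
          using subgroup.m_closed[OF H subgroup.m_inv_closed[OF H] ax] True by blast
        with xH x True Hc show False by auto
      qed
      with p True show ?thesis by (simp add: twisted_space_def)
    next
      case False
      then have "v = 0 \<or> u = 0"
        using that(4,5) by (auto simp: twisted_space_def split: if_splits)
      then show ?thesis
        using graded_hom_zero[OF t] by auto
    qed
  qed
  have fn_hom: "fn f \<in> hom (twisted_space H \<boxtimes> ?X) (twisted_space H)"
    "fn k \<in> hom (twisted_space H \<boxtimes> ?X) (twisted_space H)"
    using M0_HomD(5)[OF H f(1)] M0_HomD(5)[OF H k(1)] by simp_all
  have "fn f = fn k"
    by (rule tensor_hom_eqI[OF fn_hom]) (simp only: vanish[OF fn_hom(1)] vanish[OF fn_hom(2)])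
  then have "f = k"
    using M0_HomD(3,4)[OF H f(1)] M0_HomD(3,4)[OF H k(1)] by (intro arrow_eqI) simp_all
  with f(2) k(2) have "Comp (MC L \<xi>) s (\<zeta> ?A ?X) = Comp (MC L \<xi>) z (\<zeta> ?A ?X)"
    by simp
  then have sz: "s = z"
    by (rule D.iso_cancel_right[OF F'(3)[OF A X] z1 s z])
  have w': "w \<in> total G (fst (mod_act L \<xi> N ?X))" using w(1) by simp
  have "fn (fn z) w = 0"
    using lin_arrow_apply[OF w', of "fst N" "\<lambda>_. 0"] by (simp only: z_def arrow.sel)
  with w(2) sz show False by simp
qed

text \<open>
  The generator of the bimodule yields a relation for \<open>Omega\<close> at its own degree, the inverse of
  the conjugating element; this coboundary formula turns it into one for \<open>Omega\<close> at that element.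
\<close>

lemma Omega_inverse:
  assumes g: "g \<in> carrier G" and y: "y \<in> carrier G" and yg: "y \<otimes> g = \<one>" and gy: "g \<otimes> y = \<one>"
    and l: "l \<in> carrier G" and m: "m \<in> carrier G"
  defines "\<gamma> \<equiv> \<lambda>l. \<omega> y (conj_by G g l) g / (\<omega> l y g * \<omega> y g l)"
  shows "Omega G \<omega> y (conj_by G g l) (conj_by G g m) * Omega G \<omega> g l m * \<gamma> (l \<otimes> m) = \<gamma> l * \<gamma> m"
proof -
  \<comment> \<open>\<open>\<gamma> l\<close> is the scalar of moving \<open>l\<close> from the
    right of \<open>y \<otimes> g = \<one>\<close> to its left: (y g) l is rebracketed as y (g l) =
    y (h g), then as (y h) g = (l y) g, then as l (y g).\<close>
  define h k where "h = conj_by G g l" and "k = conj_by G g m"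
  have hc: "h \<in> carrier G" and kc: "k \<in> carrier G" using g l m by (auto simp: h_def k_def)
  have hg: "h \<otimes> g = g \<otimes> l" and kg: "k \<otimes> g = g \<otimes> m"
    using conj_by_shift[OF g] l m by (simp_all add: h_def k_def)
  have yh: "conj_by G y h = l" and yk: "conj_by G y k = m"
    using conj_by_cancel[OF y g yg] l m by (simp_all add: h_def k_def)
  have yhl: "y \<otimes> h = l \<otimes> y" and ykm: "y \<otimes> k = m \<otimes> y"
    using conj_by_shift[OF y hc] conj_by_shift[OF y kc] unfolding yh yk by simp_all
  have hk: "conj_by G g (l \<otimes> m) = h \<otimes> k"
    using conj_by_mult[OF g l m] by (simp add: h_def k_def)
  have ygl: "y \<otimes> (g \<otimes> l) = l" using g y l yg by (simp add: m_assoc[symmetric])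
  have ygm: "y \<otimes> (g \<otimes> m) = m" using g y m yg by (simp add: m_assoc[symmetric])
  note c = g y l m hc kc
  \<comment> \<open>The six quadruples are the stages of moving \<open>y\<close> and
    \<open>g\<close> past \<open>l\<close> and \<open>m\<close>: each step replaces a product g l by
    h g or y h by l y, and likewise with m and k.\<close>
  have p1: "\<omega> g l m * \<omega> y (g \<otimes> l) m * \<omega> y g l = \<omega> y g (l \<otimes> m)"
    using pentagon[OF y g l m] yg l m by simp
  have p2: "\<omega> h g m * \<omega> y (g \<otimes> l) m * \<omega> y h g = \<omega> (l \<otimes> y) g m * \<omega> y h (g \<otimes> m)"
    using pentagon[OF y hc g m] unfolding hg yhl .
  have p3: "\<omega> h k g * \<omega> y (h \<otimes> k) g * \<omega> y h k = \<omega> (l \<otimes> y) k g * \<omega> y h (g \<otimes> m)"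
    using pentagon[OF y hc kc g] unfolding yhl kg .
  have p4: "\<omega> y g m * \<omega> l y g = \<omega> (l \<otimes> y) g m * \<omega> l y (g \<otimes> m)"
    using pentagon[OF l y g m] yg l m by simp
  have p5: "\<omega> y k g * \<omega> l (m \<otimes> y) g * \<omega> l y k = \<omega> (l \<otimes> y) k g * \<omega> l y (g \<otimes> m)"
    using pentagon[OF l y kc g] unfolding ykm kg .
  have p6: "\<omega> m y g * \<omega> l (m \<otimes> y) g * \<omega> l m y = \<omega> (l \<otimes> m) y g"
    using pentagon[OF l m y g] yg l m by simp
  define a1 a2 a3 where "a1 = \<omega> g l m" and "a2 = \<omega> y (g \<otimes> l) m" and "a3 = \<omega> y g l"
  define b0 b1 b2 b3 b4 where "b0 = \<omega> y g (l \<otimes> m)" and "b1 = \<omega> h g m" and "b2 = \<omega> y h g"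
    and "b3 = \<omega> (l \<otimes> y) g m" and "b4 = \<omega> y h (g \<otimes> m)"
  define c1 c2 c3 c4 where "c1 = \<omega> h k g" and "c2 = \<omega> y (h \<otimes> k) g" and "c3 = \<omega> y h k"
      and "c4 = \<omega> (l \<otimes> y) k g"
  define d1 d2 d3 where "d1 = \<omega> y g m" and "d2 = \<omega> l y g" and "d3 = \<omega> l y (g \<otimes> m)"
  define e1 e2 e3 where "e1 = \<omega> y k g" and "e2 = \<omega> l (m \<otimes> y) g" and "e3 = \<omega> l y k"
  define f1 f2 f3 where "f1 = \<omega> m y g" and "f2 = \<omega> l m y" and "f3 = \<omega> (l \<otimes> m) y g"
  note defs = a1_def a2_def a3_def b0_def b1_def b2_def b3_def b4_def c1_def c2_def c3_def c4_def
    d1_def d2_def d3_def e1_def e2_def e3_def f1_def f2_def f3_def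
  have nz: "a1 \<noteq> 0" "a2 \<noteq> 0" "a3 \<noteq> 0" "b1 \<noteq> 0" "b2 \<noteq> 0" "b3 \<noteq> 0" "b4 \<noteq> 0"
    "c1 \<noteq> 0" "c2 \<noteq> 0" "c3 \<noteq> 0" "c4 \<noteq> 0" "d1 \<noteq> 0" "d2 \<noteq> 0" "d3 \<noteq> 0" "e1 \<noteq> 0" "e2 \<noteq> 0" "e3 \<noteq> 0"
    "f1 \<noteq> 0" "f2 \<noteq> 0" "f3 \<noteq> 0" "b0 \<noteq> 0"
    unfolding defs using c by (simp_all add: omega_nonzero)
  note p = p1[folded defs] p2[folded defs] p3[folded defs] p4[folded defs] p5[folded defs]
      p6[folded defs]
  \<comment> \<open>Each pentagon is solved for one of its values; substituting these leaves an
    identity of fractions.\<close>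
  have b0: "b0 = a1 * a2 * a3" and b1: "b1 = b3 * b4 / (a2 * b2)" and c3: "c3 = c4 * b4 / (c1 * c2)"
    and d3: "d3 = d1 * d2 / b3" and e3: "e3 = c4 * d3 / (e1 * e2)" and f3: "f3 = f1 * e2 * f2"
    using p nz by (simp_all add: field_simps)
  have "(f2 * c3 / e3) * (c1 * a1 / b1) * (c2 / (f3 * b0)) = (b2 / (d2 * a3)) * (e1 / (f1 * d1))"
    unfolding b0 b1 c3 e3 d3 f3 using nz by (simp add: field_simps)
  then show ?thesis
    unfolding Omega_def \<gamma>_def hk unfolding h_def[symmetric] k_def[symmetric] yh yk defs .
qed

section \<open>The conjugating element and its coboundary relation\<close>

theorem cohomologous_if_equivalent:
  assumes H: "subgroup H G" and L: "subgroup L G"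
    and one: "\<And>h. h \<in> H \<Longrightarrow> \<psi> \<one> h = 1" "\<And>h. h \<in> H \<Longrightarrow> \<psi> h \<one> = 1"
    and nz\<psi>: "\<And>a b. a \<in> H \<Longrightarrow> b \<in> H \<Longrightarrow> \<psi> a b \<noteq> 0"
    and d: "\<And>a b c. a \<in> H \<Longrightarrow> b \<in> H \<Longrightarrow> c \<in> H \<Longrightarrow>
      \<psi> b c * \<psi> a (b \<otimes> c) = \<omega> a b c * \<psi> (a \<otimes> b) c * \<psi> a b"
    and nz\<xi>: "\<And>a b. a \<in> L \<Longrightarrow> b \<in> L \<Longrightarrow> \<xi> a b \<noteq> 0"
    and F: "is_module_functor (vec_cat G \<omega>) (MC H \<psi>) (MC L \<xi>) Fo Fa \<zeta>"
    and E: "is_equivalence (MC H \<psi>) (MC L \<xi>) Fo Fa"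
  shows "\<exists>g\<in>carrier G. H = conj_by G g ` L \<and> (\<exists>\<eta>. (\<forall>l\<in>L. \<eta> l \<noteq> 0) \<and>
    (\<forall>l\<in>L. \<forall>m\<in>L. conj_cochain G \<psi> g l m * Omega G \<omega> g l m * \<eta> (l \<otimes> m) = \<xi> l m * \<eta> l * \<eta> m))"
proof -
  interpret D: cat "MC L \<xi>" by (rule cat_M0[OF L])
  note Hc = subgroup_carrier[OF H] and Lc = subgroup_carrier[OF L]
  have A: "reg H \<psi> \<in> modules H \<psi>"
    by (rule reg_modules[OF H]) (erule one(1), erule (2) d)
  have one_all: "\<forall>h\<in>H. \<psi> h \<one> = 1"
    and d_all: "\<forall>a\<in>H. \<forall>b\<in>H. \<forall>c\<in>H.
      \<psi> b c * \<psi> a (b \<otimes> c) = \<omega> a b c * \<psi> (a \<otimes> b) c * \<psi> a b"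
    using one(2) d by blast+
  define N where "N = Fo (reg H \<psi>)"
  have "is_functor (MC H \<psi>) (MC L \<xi>) Fo Fa" using F unfolding is_module_functor_def by blast
  then have N: "N \<in> modules L \<xi>"
    using A unfolding N_def is_functor_def by simp
  note n = moduleD[OF L N]
  let ?n = "snd N"
  from functor_bimodule[OF H L A one_all d_all F, folded N_def]
  obtain R where R: "R \<in> hom (fst N \<boxtimes> twisted_space H) (fst N)"
    and R1: "\<forall>l\<in>L. \<forall>h\<in>H. \<forall>x\<in>carrier G. \<forall>v\<in>fst N x.
      scale (\<omega> l x h) (fn R (pure_tensor (mact ?n l v) (ev h)))
          = mact ?n l (fn R (pure_tensor v (ev h)))"
    and R2: "\<forall>h\<in>H. \<forall>k\<in>H. \<forall>x\<in>carrier G. \<forall>v\<in>fst N x.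
      scale (\<omega> x h k) (fn R (pure_tensor (fn R (pure_tensor v (ev h))) (ev k)))
        = scale (\<psi> h k) (fn R (pure_tensor v (ev (h \<otimes> k))))"
    and R3: "\<forall>x\<in>carrier G. \<forall>v\<in>fst N x. fn R (pure_tensor v (ev \<one>)) = v"
    by (elim bexE conjE)
  define rr where "rr h v = fn R (pure_tensor v (ev h))" for h v
  note R1 = R1[rule_format, folded rr_def] and R2 = R2[rule_format, folded rr_def]
    and R3 = R3[rule_format, folded rr_def]
  have rr_mem: "rr h v \<in> fst N (x \<otimes> h)" if "h \<in> H" "x \<in> carrier G" "v \<in> fst N x" for h x v
    unfolding rr_def
    by (rule graded_homD(7)[OF R]) (use that Hc in \<open>auto intro!: tensor_component ev_mem\<close>)
  have rr_scale: "rr h (scale c v) = scale c (rr h v)" if "h \<in> H" "v \<in> total G (fst N)" for h c v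
    unfolding rr_def pure_scale_left
    by (rule graded_hom_scale[OF R pure_total[OF that(2) ev_total[OF Hc that(1)]]])
  \<comment> \<open>Any nonzero homogeneous vector will do; it turns out to generate
    \<open>N\<close>.\<close>
  obtain y v where y: "y \<in> carrier G" and v: "v \<in> fst N y" and v0: "v \<noteq> 0"
    using equivalence_reg_nonzero[OF H L A E] unfolding N_def by blast
  have vt: "v \<in> total G (fst N)" using y v by (rule total_component)
  obtain P where P: "lin P" "P v = v" "\<And>u. \<exists>c. P u = scale c v"
    using lin_projection_line[OF v0] by blast
  have PN: "P u \<in> fst N y" for u
    using P(3)[of u] v vec.subspace_scale[OF graded_space_subspace[OF n(1)]] by auto
  have PP: "P (P u) = P u" for u
    using P(3)[of u] P(2) lin_scale[OF P(1)] by auto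
  \<comment> \<open>The projection of degree \<open>y\<close> onto the line of \<open>v\<close>
    extends to an idempotent endomorphism of \<open>N\<close> that fixes \<open>v\<close>.\<close>
  obtain S where S: "S \<in> Hom (MC L \<xi>) N N"
    and S1: "\<And>l u. l \<in> L \<Longrightarrow> u \<in> fst N y \<Longrightarrow> fn (fn S) (mact ?n l u) = mact ?n l (P u)"
    and S2: "\<And>x u. x \<in> carrier G \<Longrightarrow> u \<in> fst N x \<Longrightarrow> (\<forall>l\<in>L. x \<noteq> l \<otimes> y) \<Longrightarrow> fn (fn S) u = 0"
    using component_extension[OF L N N nz\<xi> y P(1) PN] by blast
  note S' = M0_HomD[OF L S]
  have surj: "\<exists>u'\<in>fst N y. mact ?n l u' = u" if "l \<in> L" "u \<in> fst N (l \<otimes> y)" for l u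
    by (rule module_component_surj[OF L N nz\<xi> that(1) y that(2)])
  have "fn S \<odot> fn S = fn S"
  proof (rule graded_hom_eqI[OF cc_hom[OF S'(5) S'(5)] S'(5)])
    fix x u assume x: "x \<in> carrier G" and u: "u \<in> fst N x"
    have ut: "u \<in> total G (fst N)" using x u by (rule total_component)
    show "fn (fn S \<odot> fn S) u = fn (fn S) u"
    proof (cases "\<exists>l\<in>L. x = l \<otimes> y")
      case True
      then obtain l u' where l: "l \<in> L" and u': "u' \<in> fst N y" "mact ?n l u' = u"
        using surj u by blast
      show ?thesis
        unfolding cc_apply[OF S'(5) ut] S1[OF l u'(1), unfolded u'(2)] S1[OF l PN] PP ..
    next
      case False
      then show ?thesis
        unfolding cc_apply[OF S'(5) ut] using S2[OF x u] graded_hom_zero[OF S'(5)] by auto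
    qed
  qed
  then have SS: "Comp (MC L \<xi>) S S = S"
    using S'(3,4) by (auto intro!: arrow_eqI)
  have "fn (fn S) v = v"
    using S1[OF subgroup.one_closed[OF L] v] n(4)[OF y v] P(2) by simp
  then have S_id: "S = Ident (MC L \<xi>) N"
    using equivalence_reg_idempotent[OF H L A one(2) E] S SS vt v0 unfolding N_def by blast
  have S_fix: "fn (fn S) u = u" if "u \<in> total G (fst N)" for u
    unfolding S_id using idn_apply[OF that] by simp
  \<comment> \<open>\<open>S\<close> is zero off the coset of all \<open>l \<otimes> y\<close>, and
    in degree \<open>l \<otimes> y\<close> its image is spanned by \<open>mact ?n l v\<close>. As
    \<open>S\<close> is the identity, this and the next claim describe all of
    \<open>N\<close>.\<close>
  have support: "\<exists>l\<in>L. x = l \<otimes> y" if x: "x \<in> carrier G" and u: "u \<in> fst N x" "u \<noteq> 0" for x u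
  proof (rule ccontr)
    assume "\<not> ?thesis"
    then have "fn (fn S) u = 0" using S2[OF x u(1)] by blast
    moreover have "u \<in> total G (fst N)" using x u(1) by (rule total_component)
    ultimately show False using S_fix u(2) by simp
  qed
  have line: "\<exists>c. u = scale c (mact ?n l v)" if l: "l \<in> L" and u: "u \<in> fst N (l \<otimes> y)" for l u
  proof -
    obtain u' where u': "u' \<in> fst N y" "mact ?n l u' = u"
      using surj[OF l u] by blast
    have ly: "l \<otimes> y \<in> carrier G" using l Lc y by auto
    have ut: "u \<in> total G (fst N)" using ly u by (rule total_component)
    obtain c where c: "P u' = scale c v" using P(3) by blast
    have "u = mact ?n l (P u')"
      using S_fix[OF ut] S1[OF l u'(1)] u'(2) by simp
    also have "\<dots> = scale c (mact ?n l v)"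
      unfolding c by (rule n(7)[OF l vt])
    finally show ?thesis by blast
  qed
  have inv_H: "inv h \<in> H" if "h \<in> H" for h using subgroup.m_inv_closed[OF H that] .
  \<comment> \<open>Right multiplication by \<open>h\<close> and then by \<open>inv h\<close> takes
    \<open>v\<close> to a nonzero multiple of itself.\<close>
  have rr_nz: "rr h v \<noteq> 0" if h: "h \<in> H" for h
  proof
    assume z: "rr h v = 0"
    have hh: "h \<otimes> inv h = \<one>" using h Hc by auto
    have "scale (\<psi> h (inv h)) v = scale (\<omega> y h (inv h)) (rr (inv h) (rr h v))"
      unfolding R2[OF h inv_H[OF h] y v] hh R3[OF y v] ..
    also have "\<dots> = 0"
      unfolding z using graded_hom_zero[OF R] by (simp add: rr_def)
    finally show False using nz\<psi>[OF h inv_H[OF h]] v0 by simp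
  qed
  define g where "g = inv y"
  have g: "g \<in> carrier G" and yg: "y \<otimes> g = \<one>" and gy: "g \<otimes> y = \<one>" using y by (simp_all add: g_def)
  have y_conj: "conj_by G y h \<in> L" if h: "h \<in> H" for h
  proof -
    have hc: "h \<in> carrier G" using h Hc by auto
    have yh: "y \<otimes> h \<in> carrier G" using y hc by simp
    obtain l where l: "l \<in> L" "y \<otimes> h = l \<otimes> y"
      using support[OF yh rr_mem[OF h y v] rr_nz[OF h]] by blast
    have lc: "l \<in> carrier G" using l Lc by auto
    have "conj_by G y h = l"
      unfolding conj_by_def l(2) using lc y by (simp add: m_assoc)
    with l(1) show ?thesis by simp
  qed
  have yh_eq: "y \<otimes> h = conj_by G y h \<otimes> y" if "h \<in> H" for h
    using conj_by_shift[OF y] that Hc by auto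
  \<comment> \<open>\<open>rr h v\<close> has degree
    \<open>y \<otimes> h = conj_by G y h \<otimes> y\<close>, and that component is spanned by the
    left translate of \<open>v\<close>; \<theta> is the coefficient comparing the right with the
    left action.\<close>
  have "\<forall>h\<in>H. \<exists>c. rr h v = scale c (mact ?n (conj_by G y h) v)"
    using line[OF y_conj] rr_mem[OF _ y v] yh_eq by simp
  then obtain \<theta> where \<theta>: "\<And>h. h \<in> H \<Longrightarrow> rr h v = scale (\<theta> h) (mact ?n (conj_by G y h) v)"
    by metis
  have \<theta>_nz: "\<theta> h \<noteq> 0" if "h \<in> H" for h
    using rr_nz[OF that] \<theta>[OF that] by auto
  have g_conj: "conj_by G g l \<in> H" if l: "l \<in> L" for l
  proof -
    define x where "x = conj_by G g l"
    have lc: "l \<in> carrier G" using l Lc by auto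
    have x: "x \<in> carrier G" using g lc by (simp add: x_def)
    have yx: "y \<otimes> x = l \<otimes> y"
      unfolding x_def g_def conj_by_def using y lc by (simp add: m_assoc)
    have ly: "l \<otimes> y \<in> carrier G" using lc y by simp
    let ?X = "twisted_space {x} :: ('g, 'k) graded"
    have X: "?X \<in> spaces" by (rule twisted_space) (use x in simp)
    note NX = mod_act_modules[OF L N X]
    obtain \<rho> where \<rho>: "lin \<rho>" "\<And>u. u \<in> total G (fst N) \<Longrightarrow> mact ?n l u = \<rho> u"
      using mact_extend[OF n(2) Lc l] by blast
    \<comment> \<open>In degree \<open>l \<otimes> y = y \<otimes> x\<close> the product of
      \<open>N\<close> with the simple object of degree \<open>x\<close> consists of vectors of
      degree \<open>y\<close> tensored with \<open>ev x\<close>. The map \<open>t\<close> drops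
      \<open>ev x\<close> and applies \<open>l\<close>, so it lands in the same degree of
      \<open>N\<close> and does not kill \<open>v\<close>.\<close>
    define t where "t s = \<rho> (slice' (Elem_label x) s)" for s
    have t: "lin t"
      unfolding t_def by (rule lin_comp[OF lin_slice' \<rho>(1)])
    have tmem: "t s \<in> fst N (l \<otimes> y)" if s: "s \<in> fst (mod_act L \<xi> N ?X) (l \<otimes> y)" for s
      using s unfolding fst_mod_act
    proof (rule tensor_lin_mem[OF _ t graded_space_subspace[OF n(1)]])
      fix a b u w assume a: "a \<in> carrier G" and b: "b \<in> carrier G" and ab: "a \<otimes> b = l \<otimes> y"
        and u: "u \<in> fst N a" and w: "w \<in> ?X b"
      from w show "t (pure_tensor u w) \<in> fst N (l \<otimes> y)"
      proof (cases rule: twistedE)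
        case (1 c)
        have "a \<otimes> x = y \<otimes> x" using ab 1(2) yx by simp
        then have ay: "a = y" using a y x by simp
        have ut: "u \<in> total G (fst N)" using a u by (rule total_component)
        have "t (pure_tensor u w) = scale c (mact ?n l u)"
          using 1(2) \<rho>(2)[OF ut]
          by (simp add: t_def 1(1) slice'_pure pure_scale_right lin_scale[OF lin_slice']
              basis_vec_apply
            lin_scale[OF \<rho>(1)])
        then show ?thesis
          using n(5)[OF l y] u ay vec.subspace_scale[OF graded_space_subspace[OF n(1)]] by auto
      next
        case 2
        then show ?thesis
          using lin_zero[OF t] vec.subspace_0[OF graded_space_subspace[OF n(1)]] by simp
      qed
    qed
    obtain s where s: "s \<in> Hom (MC L \<xi>) (mod_act L \<xi> N ?X) N"
      and s1: "\<And>k u. k \<in> L \<Longrightarrow> u \<in> fst (mod_act L \<xi> N ?X) (l \<otimes> y) \<Longrightarrow>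
        fn (fn s) (mact (snd (mod_act L \<xi> N ?X)) k u) = mact ?n k (t u)"
      using component_extension[OF L NX N nz\<xi> ly t tmem] by blast
    let ?w = "pure_tensor v (ev x)"
    have ex: "ev x \<in> ?X x" by (rule ev_mem) simp
    have w: "?w \<in> fst (mod_act L \<xi> N ?X) (l \<otimes> y)"
      using tensor_component[where V = "fst N" and W = ?X, OF y x v ex] yx by simp
    have wt: "?w \<in> total G (fst N \<boxtimes> ?X)"
      using ly w unfolding fst_mod_act by (rule total_component)
    have tw: "t ?w = mact ?n l v"
      unfolding t_def slice'_pure \<rho>(2)[OF vt] by (simp add: basis_vec_apply)
    have "fn (fn s) ?w = mact ?n \<one> (t ?w)"
      using s1[OF subgroup.one_closed[OF L] w] moduleD(4)[OF L NX ly w] by simp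
    also have "\<dots> = mact ?n l v"
      unfolding tw by (rule n(4)[OF ly n(5)[OF l y v]])
    finally have "fn (fn s) ?w \<noteq> 0"
      using module_component_inj[OF L N nz\<xi> l y v] v0 by auto
    then have "x \<in> H"
      using equivalence_reg_degree[OF H L A F E x] s wt unfolding N_def by blast
    then show ?thesis by (simp add: x_def)
  qed
  have gyc: "conj_by G g (conj_by G y h) = h" if "h \<in> carrier G" for h
    by (rule conj_by_cancel[OF g y gy that])
  have ygc: "conj_by G y (conj_by G g l) = l" if "l \<in> carrier G" for l
    by (rule conj_by_cancel[OF y g yg that])
  have HL: "H = conj_by G g ` L"
  proof
    show "conj_by G g ` L \<subseteq> H" using g_conj by auto
    show "H \<subseteq> conj_by G g ` L"
    proof
      fix h assume h: "h \<in> H"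
      then have "h = conj_by G g (conj_by G y h)" using gyc Hc by auto
      then show "h \<in> conj_by G g ` L" using y_conj[OF h] by blast
    qed
  qed
  have rel: "\<psi> h k * \<theta> (h \<otimes> k) = \<theta> h * \<theta> k * \<xi> (conj_by G y h) (conj_by G y k) * Omega G \<omega> y h k"
    if h: "h \<in> H" and k: "k \<in> H" for h k
  proof -
    define l m where "l = conj_by G y h" and "m = conj_by G y k"
    have l: "l \<in> L" and m: "m \<in> L" using y_conj h k by (simp_all add: l_def m_def)
    have hc: "h \<in> carrier G" and kc: "k \<in> carrier G" and lc: "l \<in> carrier G" and mc: "m \<in> carrier G"
      using h k l m Hc Lc by auto
    have hk: "h \<otimes> k \<in> H" using H h k by (rule subgroup.m_closed)
    have lm: "l \<otimes> m \<in> L" using L l m by (rule subgroup.m_closed)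
    have lm_eq: "conj_by G y (h \<otimes> k) = l \<otimes> m"
      unfolding l_def m_def by (rule conj_by_mult[OF y hc kc])
    have lv: "mact ?n l v \<in> total G (fst N)" by (rule n(6)[OF l vt])
    have mv: "mact ?n m v \<in> total G (fst N)" by (rule n(6)[OF m vt])
    let ?q = "mact ?n (l \<otimes> m) v"
    have q0: "?q \<noteq> 0" using module_component_inj[OF L N nz\<xi> lm y v] v0 by auto
    have lyk: "\<omega> l y k \<noteq> 0" by (rule omega_nonzero[OF lc y kc])
    \<comment> \<open>The vector \<open>rr k (rr h v)\<close> is computed twice: by
      \<open>R2\<close> it is a multiple of \<open>rr (h \<otimes> k) v\<close>, while taking the
      left action of \<open>l\<close> out by \<open>R1\<close> expresses it through \<theta>, \<xi>
      and \<omega>. Both results are multiples of the nonzero vector \<open>?q\<close>.\<close>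
    have "rr k (mact ?n l v) = scale (inverse (\<omega> l y k)) (scale (\<omega> l y k) (rr k (mact ?n l v)))"
      by (rule scale_inverse_cancel[OF lyk, symmetric])
    also have "\<dots> = scale (inverse (\<omega> l y k) * \<theta> k * \<omega> l m y * \<xi> l m) ?q"
      unfolding R1[OF l k y v] \<theta>[OF k] m_def[symmetric] n(7)[OF l mv] n(3)[OF l m y v]
          vec.scale_scale
      by (simp add: ac_simps)
    finally have "rr k (rr h v) = scale (\<theta> h * (inverse (\<omega> l y k) * \<theta> k * \<omega> l m y * \<xi> l m)) ?q"
      unfolding \<theta>[OF h] l_def[symmetric] rr_scale[OF k lv] by simp
    then have "scale (\<omega> y h k * (\<theta> h * (inverse (\<omega> l y k) * \<theta> k * \<omega> l m y * \<xi> l m))) ?q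
        = scale (\<psi> h k * \<theta> (h \<otimes> k)) ?q"
      using R2[OF h k y v] unfolding \<theta>[OF hk] lm_eq by simp
    then have "\<omega> y h k * (\<theta> h * (inverse (\<omega> l y k) * \<theta> k * \<omega> l m y * \<xi> l m)) = \<psi> h k * \<theta> (h \<otimes> k)"
      using vec.scale_right_imp_eq[OF q0] by blast
    then show ?thesis
      unfolding Omega_def l_def[symmetric] m_def[symmetric] by (simp add: field_simps)
  qed
  define \<gamma> where "\<gamma> l = \<omega> y (conj_by G g l) g / (\<omega> l y g * \<omega> y g l)" for l
  have \<gamma>_nz: "\<gamma> l \<noteq> 0" if "l \<in> carrier G" for l
    using that g y by (simp add: \<gamma>_def omega_nonzero)
  \<comment> \<open>Conjugation by \<open>g\<close> turns \<open>rel\<close> into a relation on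
    \<open>L\<close> involving \<open>Omega\<close> at \<open>y\<close>; by
    \<open>Omega_inverse\<close> the factor \<gamma> replaces this by the reciprocal of
    \<open>Omega\<close> at \<open>g\<close>.\<close>
  define \<eta> where "\<eta> l = \<theta> (conj_by G g l) * \<gamma> l" for l
  have "conj_cochain G \<psi> g l m * Omega G \<omega> g l m * \<eta> (l \<otimes> m) = \<xi> l m * \<eta> l * \<eta> m"
    if l: "l \<in> L" and m: "m \<in> L" for l m
  proof -
    have lc: "l \<in> carrier G" and mc: "m \<in> carrier G" using l m Lc by auto
    let ?h = "conj_by G g l" and ?k = "conj_by G g m"
    have rel': "\<psi> ?h ?k * \<theta> (conj_by G g (l \<otimes> m)) = \<theta> ?h * \<theta> ?k * \<xi> l m * Omega G \<omega> y ?h ?k"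
      using rel[OF g_conj[OF l] g_conj[OF m]]
          unfolding ygc[OF lc] ygc[OF mc] conj_by_mult[OF g lc mc] .
    have "conj_cochain G \<psi> g l m * Omega G \<omega> g l m * \<eta> (l \<otimes> m)
        = (\<psi> ?h ?k * \<theta> (conj_by G g (l \<otimes> m))) * (Omega G \<omega> g l m * \<gamma> (l \<otimes> m))"
      by (simp add: conj_cochain_def \<eta>_def ac_simps)
    also have "\<dots> = \<theta> ?h * \<theta> ?k * \<xi> l m * (Omega G \<omega> y ?h ?k * Omega G \<omega> g l m * \<gamma> (l \<otimes> m))"
      unfolding rel' by (simp add: ac_simps)
    also have "\<dots> = \<xi> l m * \<eta> l * \<eta> m"
      unfolding Omega_inverse[OF g y yg gy lc mc, folded \<gamma>_def] by (simp add: \<eta>_def ac_simps)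
    finally show ?thesis .
  qed
  moreover have "\<eta> l \<noteq> 0" if "l \<in> L" for l
    using \<theta>_nz[OF g_conj[OF that]] \<gamma>_nz that Lc by (auto simp: \<eta>_def)
  ultimately show ?thesis
    using g HL by blast
qed

end

section \<open>The second cohomology group\<close>

lemma (in group) B2_mult:
  assumes "f \<in> B2 G" and "h \<in> (B2 G :: ('a \<Rightarrow> 'a \<Rightarrow> 'k::field) set)"
  shows "(\<lambda>a b. f a b * h a b) \<in> B2 G"
proof -
  from assms obtain \<eta> \<theta> where \<eta>: "\<eta> \<in> C1 G" "f = restrict2 (carrier G) (d1 G \<eta>)"
    and \<theta>: "\<theta> \<in> C1 G" "h = restrict2 (carrier G) (d1 G \<theta>)"
    by (auto simp: B2_def)
  have "(\<lambda>a. \<eta> a * \<theta> a) \<in> C1 G"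
    using \<eta>(1) \<theta>(1) by (simp add: C1_def)
  moreover have "(\<lambda>a b. f a b * h a b) = restrict2 (carrier G) (d1 G (\<lambda>a. \<eta> a * \<theta> a))"
    by (simp add: \<eta>(2) \<theta>(2) restrict2_def d1_def fun_eq_iff)
  ultimately show ?thesis
    by (auto simp: B2_def)
qed

lemma (in group) B2_inverse:
  assumes "f \<in> (B2 G :: ('a \<Rightarrow> 'a \<Rightarrow> 'k::field) set)"
  shows "(\<lambda>a b. inverse (f a b)) \<in> B2 G"
proof -
  from assms obtain \<eta> where \<eta>: "\<eta> \<in> C1 G" "f = restrict2 (carrier G) (d1 G \<eta>)"
    by (auto simp: B2_def)
  have "(\<lambda>a. inverse (\<eta> a)) \<in> C1 G"
    using \<eta>(1) by (simp add: C1_def)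
  moreover have "(\<lambda>a b. inverse (f a b)) = restrict2 (carrier G) (d1 G (\<lambda>a. inverse (\<eta> a)))"
    by (auto simp: \<eta>(2) restrict2_def d1_def fun_eq_iff divide_inverse)
  ultimately show ?thesis
    by (auto simp: B2_def)
qed

lemma (in group) B2_one: "(\<lambda>a b. 1) \<in> (B2 G :: ('a \<Rightarrow> 'a \<Rightarrow> 'k::field) set)"
proof -
  have "(\<lambda>a. 1 :: 'k) \<in> C1 G"
    by (simp add: C1_def)
  moreover have "(\<lambda>a b. 1 :: 'k) = restrict2 (carrier G) (d1 G (\<lambda>a. 1))"
    by (simp add: restrict2_def d1_def fun_eq_iff)
  ultimately show ?thesis
    by (auto simp: B2_def)
qed

lemma (in group) B2_nonzero: "f \<in> (B2 G :: ('a \<Rightarrow> 'a \<Rightarrow> 'k::field) set) \<Longrightarrow> f a b \<noteq> 0"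
  by (auto simp: B2_def C1_def restrict2_def d1_def split: if_splits)

text \<open>The identity of the quotient is the coset \<open>B2\<close> itself, and
  \<open>B2\<close> contains 1 and is closed under products and inverses.\<close>

lemma (in group) class2_trivial_iff:
  fixes f :: "'a \<Rightarrow> 'a \<Rightarrow> 'k::field"
  shows "class2 G f = \<one>\<^bsub>H2 G\<^esub> \<longleftrightarrow> f \<in> B2 G"
proof -
  have one: "\<one>\<^bsub>H2 G\<^esub> = (B2 G :: ('a \<Rightarrow> 'a \<Rightarrow> 'k) set)"
    by (simp add: H2_def FactGroup_def)
  have cl: "class2 G f = (\<lambda>h a b. h a b * f a b) ` B2 G"
    by (auto simp: class2_def r_coset_def Z2_def)
  show ?thesis
    unfolding one
  proof
    assume "class2 G f = B2 G"
    then show "f \<in> B2 G"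
      using B2_one unfolding cl by (metis (no_types, lifting) ext image_eqI mult_1)
  next
    assume f: "f \<in> B2 G"
    show "class2 G f = B2 G"
    proof
      show "class2 G f \<subseteq> B2 G"
        unfolding cl using B2_mult f by blast
      show "B2 G \<subseteq> class2 G f"
      proof
        fix h :: "'a \<Rightarrow> 'a \<Rightarrow> 'k" assume "h \<in> B2 G"
        from B2_mult[OF this B2_inverse[OF f]] have hf: "(\<lambda>a b. h a b * inverse (f a b)) \<in> B2 G" .
        have h: "h = (\<lambda>a b. (h a b * inverse (f a b)) * f a b)"
          using B2_nonzero[OF f] by (simp add: fun_eq_iff mult.assoc)
        show "h \<in> class2 G f"
          unfolding cl by (rule image_eqI[where x = "\<lambda>a b. h a b * inverse (f a b)"]) (fact h hf)+
      qed
    qed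
  qed
qed

theorem theorem1p1:
  fixes G :: "('g, 'z) monoid_scheme"
    and \<omega> :: "'g \<Rightarrow> 'g \<Rightarrow> 'g \<Rightarrow> 'k::{alg_closed_field, field_char_0}"
    and \<psi> \<xi> :: "'g \<Rightarrow> 'g \<Rightarrow> 'k"
    and H L :: "'g set"
  assumes "group G" and "finite (carrier G)"
    and "\<omega> \<in> Z3 G"
    and "subgroup H G" and "subgroup L G"
    and "\<psi> \<in> C2 (G\<lparr>carrier := H\<rparr>)"
    and "\<xi> \<in> C2 (G\<lparr>carrier := L\<rparr>)"
    and "\<forall>a\<in>H. \<forall>b\<in>H. \<forall>c\<in>H. d2 (G\<lparr>carrier := H\<rparr>) \<psi> a b c = \<omega> a b c"
    and "\<forall>a\<in>L. \<forall>b\<in>L. \<forall>c\<in>L. d2 (G\<lparr>carrier := L\<rparr>) \<xi> a b c = \<omega> a b c"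
  shows "module_equivalent (vec_cat G \<omega>) (M0 G \<omega> H \<psi>) (M0 G \<omega> L \<xi>) \<longleftrightarrow>
    (\<exists>g\<in>carrier G. H = conj_by G g ` L \<and>
       class2 (G\<lparr>carrier := L\<rparr>)
         (restrict2 L (\<lambda>a b. inverse (\<xi> a b) * conj_cochain G \<psi> g a b * Omega G \<omega> g a b))
       = \<one>\<^bsub>H2 (G\<lparr>carrier := L\<rparr>)\<^esub>)"
proof -
  interpret group G by fact
  interpret pointed G \<omega>
    by unfold_locales fact+
  note H = assms(4) and L = assms(5)
  note Hc = subgroup_carrier[OF H] and Lc = subgroup_carrier[OF L]
  interpret L: group "G\<lparr>carrier := L\<rparr>"
    by (rule subgroup.subgroup_is_group[OF L group_axioms])
  have nz\<psi>: "\<psi> a b \<noteq> 0" if "a \<in> H" "b \<in> H" for a b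
    using assms(6) that by (simp add: C2_def)
  have one\<psi>: "\<psi> \<one>\<^bsub>G\<^esub> a = 1" "\<psi> a \<one>\<^bsub>G\<^esub> = 1" if "a \<in> H" for a
    using assms(6) that by (simp_all add: C2_def)
  have nz\<xi>: "\<xi> a b \<noteq> 0" if "a \<in> L" "b \<in> L" for a b
    using assms(7) that by (simp add: C2_def)
  have one\<xi>: "\<xi> \<one>\<^bsub>G\<^esub> a = 1" if "a \<in> L" for a
    using assms(7) that by (simp_all add: C2_def)
  have d\<psi>: "\<psi> b c * \<psi> a (b \<otimes>\<^bsub>G\<^esub> c) = \<omega> a b c * \<psi> (a \<otimes>\<^bsub>G\<^esub> b) c * \<psi> a b"
    if "a \<in> H" "b \<in> H" "c \<in> H" for a b c
  proof -
    have "\<omega> a b c = d2 (G\<lparr>carrier := H\<rparr>) \<psi> a b c" using assms(8) that by simp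
    then show ?thesis
      using nz\<psi>[OF that(1,2)] nz\<psi>[OF subgroup.m_closed[OF H that(1,2)] that(3)]
      by (simp add: d2_def)
  qed
  let ?f = "\<lambda>g. restrict2 L (\<lambda>a b. inverse (\<xi> a b) * conj_cochain G \<psi> g a b * Omega G \<omega> g a b)"
  let ?cob = "\<lambda>g \<eta>. \<forall>l\<in>L. \<forall>m\<in>L.
    conj_cochain G \<psi> g l m * Omega G \<omega> g l m * \<eta> (l \<otimes>\<^bsub>G\<^esub> m) = \<xi> l m * \<eta> l * \<eta> m"
  note L1 = subgroup.one_closed[OF L]
  \<comment> \<open>This puts the cohomological condition into the multiplicative form in which both
    implications are proved.\<close>
  have B2_iff: "?f g \<in> B2 (G\<lparr>carrier := L\<rparr>) \<longleftrightarrow> (\<exists>\<eta>. (\<forall>l\<in>L. \<eta> l \<noteq> 0) \<and> \<eta> \<one>\<^bsub>G\<^esub> = 1 \<and> ?cob g \<eta>)"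
    if g: "g \<in> carrier G" for g
  proof
    assume "?f g \<in> B2 (G\<lparr>carrier := L\<rparr>)"
    then obtain \<eta> where \<eta>: "\<eta> \<in> C1 (G\<lparr>carrier := L\<rparr>)"
      and eq: "?f g = restrict2 L (d1 (G\<lparr>carrier := L\<rparr>) \<eta>)"
      by (auto simp: B2_def)
    have nz: "\<eta> l \<noteq> 0" if "l \<in> L" for l
      using \<eta> that by (simp add: C1_def)
    have "conj_cochain G \<psi> g l m * Omega G \<omega> g l m * \<eta> (l \<otimes>\<^bsub>G\<^esub> m) = \<xi> l m * \<eta> l * \<eta> m"
      if "l \<in> L" "m \<in> L" for l m
      using fun_cong[OF fun_cong[OF eq, of l], of m] that nz\<xi>[OF that] nz[OF subgroup.m_closed[OF L that]]
      by (simp add: restrict2_def d1_def field_simps)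
    then show "\<exists>\<eta>. (\<forall>l\<in>L. \<eta> l \<noteq> 0) \<and> \<eta> \<one>\<^bsub>G\<^esub> = 1 \<and> ?cob g \<eta>"
      using \<eta> nz by (intro exI[of _ \<eta>]) (simp add: C1_def)
  next
    assume "\<exists>\<eta>. (\<forall>l\<in>L. \<eta> l \<noteq> 0) \<and> \<eta> \<one>\<^bsub>G\<^esub> = 1 \<and> ?cob g \<eta>"
    then obtain \<eta> where nz: "\<And>l. l \<in> L \<Longrightarrow> \<eta> l \<noteq> 0" and one: "\<eta> \<one>\<^bsub>G\<^esub> = 1" and cob: "?cob g \<eta>"
      by blast
    \<comment> \<open>A cochain on \<open>L\<close> has to take the value 1 outside
      \<open>L\<close>.\<close>
    define \<eta>' where "\<eta>' l = (if l \<in> L then \<eta> l else 1)" for l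
    have "\<eta>' \<in> C1 (G\<lparr>carrier := L\<rparr>)"
      using nz one by (simp add: C1_def \<eta>'_def)
    moreover have "?f g = restrict2 L (d1 (G\<lparr>carrier := L\<rparr>) \<eta>')"
    proof (intro ext)
      fix l m
      show "?f g l m = restrict2 L (d1 (G\<lparr>carrier := L\<rparr>) \<eta>') l m"
      proof (cases "l \<in> L \<and> m \<in> L")
        case True
        then have lm: "l \<otimes>\<^bsub>G\<^esub> m \<in> L" using subgroup.m_closed[OF L] by blast
        have "conj_cochain G \<psi> g l m * Omega G \<omega> g l m * \<eta> (l \<otimes>\<^bsub>G\<^esub> m) = \<xi> l m * \<eta> l * \<eta> m"
          using cob True by blast
        then show ?thesis
          using True lm nz[OF lm] nz\<xi>[of l m] by (simp add: restrict2_def d1_def \<eta>'_def field_simps)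
      qed (auto simp: restrict2_def)
    qed
    ultimately show "?f g \<in> B2 (G\<lparr>carrier := L\<rparr>)"
      by (auto simp: B2_def)
  qed
  show ?thesis
    unfolding L.class2_trivial_iff
  proof
    assume "module_equivalent (vec_cat G \<omega>) (M0 G \<omega> H \<psi>) (M0 G \<omega> L \<xi>)"
    then obtain Fo Fa \<zeta> where F: "is_module_functor (vec_cat G \<omega>) (M0 G \<omega> H \<psi>) (M0 G \<omega> L \<xi>) Fo Fa \<zeta>"
      and E: "is_equivalence (M0 G \<omega> H \<psi>) (M0 G \<omega> L \<xi>) Fo Fa"
      by (auto simp: module_equivalent_def)
    obtain g \<eta> where g: "g \<in> carrier G" "H = conj_by G g ` L" and \<eta>: "\<forall>l\<in>L. \<eta> l \<noteq> 0" "?cob g \<eta>"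
      using cohomologous_if_equivalent[where \<psi> = \<psi> and \<xi> = \<xi>, OF H L one\<psi> nz\<psi> d\<psi> nz\<xi> F E] by blast
    \<comment> \<open>Normalization of \<eta> is automatic: since \<psi>, \<xi> and \<omega> are
      normalized, the relation at the identity says that the nonzero value of \<eta> there equals
      its own square.\<close>
    have "conj_cochain G \<psi> g \<one>\<^bsub>G\<^esub> \<one>\<^bsub>G\<^esub> * Omega G \<omega> g \<one>\<^bsub>G\<^esub> \<one>\<^bsub>G\<^esub> * \<eta> (\<one>\<^bsub>G\<^esub> \<otimes>\<^bsub>G\<^esub> \<one>\<^bsub>G\<^esub>)
        = \<xi> \<one>\<^bsub>G\<^esub> \<one>\<^bsub>G\<^esub> * \<eta> \<one>\<^bsub>G\<^esub> * \<eta> \<one>\<^bsub>G\<^esub>"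
      using \<eta>(2) L1 by blast
    then have "\<eta> \<one>\<^bsub>G\<^esub> = 1"
      using g(1) \<eta>(1) L1 one\<psi>(1)[OF subgroup.one_closed[OF H]] one\<xi>[OF L1]
      by (simp add: conj_cochain_def Omega_def)
    with \<eta> B2_iff[OF g(1)] have "?f g \<in> B2 (G\<lparr>carrier := L\<rparr>)"
      by blast
    with g show "\<exists>g\<in>carrier G. H = conj_by G g ` L \<and> ?f g \<in> B2 (G\<lparr>carrier := L\<rparr>)"
      by blast
  next
    assume "\<exists>g\<in>carrier G. H = conj_by G g ` L \<and> ?f g \<in> B2 (G\<lparr>carrier := L\<rparr>)"
    then obtain g where g: "g \<in> carrier G" "H = conj_by G g ` L" "?f g \<in> B2 (G\<lparr>carrier := L\<rparr>)"
      by blast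
    from g(3) obtain \<eta> where \<eta>: "\<And>l. l \<in> L \<Longrightarrow> \<eta> l \<noteq> 0" "\<eta> \<one>\<^bsub>G\<^esub> = 1" "?cob g \<eta>"
      unfolding B2_iff[OF g(1)] by blast
    show "module_equivalent (vec_cat G \<omega>) (M0 G \<omega> H \<psi>) (M0 G \<omega> L \<xi>)"
      by (rule equivalent_if_cohomologous[OF g(1) H L g(2), of \<eta>]) (use \<eta> in auto)
  qed
qed

end
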